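(* Let $\Sigma$ be a finite CW complex of dimension $d$ with girth $g$ and connectivity $k$, whose top boundary map $\partial_d$ has rank $r$, and let $b=\operatorname{rank}\tilde H_d(\Sigma;\mathbb{Z})$. Then $$k\,\tau(\Sigma)^{-1/r}\le\gamma_r\qquad\text{and}\qquad g\,\tau^*(\Sigma)^{-1/b}\le\gamma_b.$$
   Context: $\Sigma$ has the convention of a unique $(-1)$-cell (reduced homology); $d$-cells are facets; cells are oriented and $\partial_d$ is the top cellular boundary matrix. The cellular matroid of $\Sigma$ is the matroid on the facets represented over $\mathbb{R}$ by the columns of $\partial_d$. The girth is the size of a smallest circuit, and the connectivity the size of a smallest cocircuit, of this matroid. A cellular spanning forest (CSF) is a subcomplex $\Upsilon$ containing the full $(d-1)$-skeleton whose facets form a basis of this matroid; $\mathbf{t}_i(X)=|\operatorname{tor}(\tilde H_i(X;\mathbb{Z}))|$; $\tau(\Sigma)=\sum_{\Upsilon}\mathbf{t}_{d-1}(\Upsilon)^2$ over all CSFs. An acyclization is a $(d+1)$-dimensional complex $\Omega$ with $d$-skeleton $\Sigma$ and $\tilde H_{d+1}(\Omega;\mathbb{Z})=\tilde H_d(\Omega;\mathbb{Z})=0$, and $\tau^*(\Sigma)=\sum_{\Upsilon}|\tilde H_d(\Omega,\Upsilon;\mathbb{Z})|^2$ over all CSFs (this equals the order of the cocritical group $C_{d+1}(\Omega;\mathbb{Z})/\operatorname{im}\partial_{d+1}^*\partial_{d+1}$ and is independent of $\Omega$). For $m\ge1$, Hermite's constant $\gamma_m$ is the maximum, over all lattices $\mathcal{L}$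 of rank $m$ in a Euclidean space, of $\big(\min_{x\in\mathcal{L}\setminus\{0\}}\langle x,x\rangle\big)\cdot(\det M^TM)^{-1/m}$, where $M$ is a matrix whose columns form an integral basis of $\mathcal{L}$ (for integral lattices $\det M^TM=|\mathcal{L}^\sharp/\mathcal{L}|$). *)

theory Defs
  imports
    "HOL-Homology.Homology"
    "Jordan_Normal_Form.Determinant"
begin

section \<open>Finite CW complexes\<close>

text \<open>
  The closed \<open>n\<close>-ball is modelled by \<^term>\<open>standard_simplex n\<close>, so that a
  characteristic map is literally a singular simplex. Its vertex order orients the cell;
  composing it with a transposition of two vertices reverses the orientation.
\<close>

record ('a, 'c) cw =
  cw_space :: "'a topology"
  cw_cells :: "'c set"
  cw_dim :: "'c \<Rightarrow> nat"
  cw_map :: "'c \<Rightarrow> (nat \<Rightarrow> real) \<Rightarrow> 'a"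

definition open_simplex :: "nat \<Rightarrow> (nat \<Rightarrow> real) set" where
  "open_simplex n = {x \<in> standard_simplex n. \<forall>i\<le>n. 0 < x i}"

definition open_cell :: "('a, 'c) cw \<Rightarrow> 'c \<Rightarrow> 'a set" where
  "open_cell S e = cw_map S e ` open_simplex (cw_dim S e)"

text \<open>The bound is strict: \<open>cw_skel S n\<close> is the skeleton of dimension \<open>n - 1\<close>.\<close>

definition cw_skel :: "('a, 'c) cw \<Rightarrow> nat \<Rightarrow> 'a set" where
  "cw_skel S n = (\<Union>e \<in> {e \<in> cw_cells S. cw_dim S e < n}. open_cell S e)"

text \<open>
  For finitely many cells in a Hausdorff space the weak topology is automatic, and so is the
  fact that each characteristic map is a homeomorphism from the open ball onto the open cell.
\<close>

definition finite_cw_complex :: "('a, 'c) cw \<Rightarrow> bool" where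
  "finite_cw_complex S \<longleftrightarrow>
     Hausdorff_space (cw_space S) \<and>
     finite (cw_cells S) \<and>
     (\<forall>e\<in>cw_cells S. singular_simplex (cw_dim S e) (cw_space S) (cw_map S e)) \<and>
     (\<forall>e\<in>cw_cells S. inj_on (cw_map S e) (open_simplex (cw_dim S e))) \<and>
     (\<forall>e\<in>cw_cells S. \<forall>e'\<in>cw_cells S. e \<noteq> e' \<longrightarrow> open_cell S e \<inter> open_cell S e' = {}) \<and>
     (\<Union>e\<in>cw_cells S. open_cell S e) = topspace (cw_space S) \<and>
     (\<forall>e\<in>cw_cells S. cw_map S e ` (standard_simplex (cw_dim S e) - open_simplex (cw_dim S e))
        \<subseteq> cw_skel S (cw_dim S e))"

definition cw_has_dimension :: "('a, 'c) cw \<Rightarrow> nat \<Rightarrow> bool" where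
  "cw_has_dimension S d \<longleftrightarrow>
     (\<forall>e\<in>cw_cells S. cw_dim S e \<le> d) \<and> (\<exists>e\<in>cw_cells S. cw_dim S e = d)"


section \<open>Based chain complexes\<close>

record 'x based_complex =
  bc_cells :: "'x set"
  bc_deg :: "'x \<Rightarrow> int"
  bc_bd :: "'x \<Rightarrow> ('x \<Rightarrow>\<^sub>0 int)"

definition cells_of_deg :: "'x based_complex \<Rightarrow> 'x set \<Rightarrow> int \<Rightarrow> 'x set" where
  "cells_of_deg K A i = {x \<in> A. bc_deg K x = i}"

definition bc_boundary :: "'x based_complex \<Rightarrow> ('x \<Rightarrow>\<^sub>0 int) \<Rightarrow> ('x \<Rightarrow>\<^sub>0 int)" where
  "bc_boundary K = frag_extend (bc_bd K)"

definition based_complex :: "'x based_complex \<Rightarrow> bool" where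
  "based_complex K \<longleftrightarrow>
     finite (bc_cells K) \<and>
     (\<forall>x\<in>bc_cells K.
        Poly_Mapping.keys (bc_bd K x) \<subseteq> cells_of_deg K (bc_cells K) (bc_deg K x - 1)) \<and>
     (\<forall>x\<in>bc_cells K. bc_boundary K (bc_bd K x) = 0)"

text \<open>
  \<open>K\<close> is the augmented cellular chain complex of \<open>S\<close>; \<open>None\<close> is the unique cell of
  dimension \<open>-1\<close>. The group \<open>H\<^sub>n(X\<^sub>n, X\<^sub>n\<^sub>-\<^sub>1)\<close> of relative singular homology is free on the
  classes of the characteristic maps of the \<open>n\<close>-cells, and the last clause says that the
  integers in \<open>bc_bd K\<close> are the coefficients, in these bases, of the connecting
  homomorphism \<open>H\<^sub>n\<^sub>+\<^sub>1(X\<^sub>n\<^sub>+\<^sub>1, X\<^sub>n) \<rightarrow> H\<^sub>n(X\<^sub>n, X\<^sub>n\<^sub>-\<^sub>1)\<close>. Hence \<open>S\<close> determines \<open>K\<close> on its cells.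
\<close>

definition cellular_chain_complex ::
    "('a, 'c) cw \<Rightarrow> 'c option based_complex \<Rightarrow> bool" where
  "cellular_chain_complex S K \<longleftrightarrow>
     based_complex K \<and>
     bc_cells K = insert None (Some ` cw_cells S) \<and>
     bc_deg K None = -1 \<and>
     (\<forall>e\<in>cw_cells S. bc_deg K (Some e) = int (cw_dim S e)) \<and>
     (\<forall>e\<in>cw_cells S. cw_dim S e = 0 \<longrightarrow> bc_bd K (Some e) = frag_of None) \<and>
     (\<forall>e\<in>cw_cells S. \<forall>n. cw_dim S e = Suc n \<longrightarrow>
        homologous_rel n (subtopology (cw_space S) (cw_skel S (Suc n))) (cw_skel S n)
          (chain_boundary (Suc n) (frag_of (cw_map S e)))
          (frag_extend (\<lambda>x. frag_of (cw_map S (the x))) (bc_bd K (Some e))))"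


section \<open>Homology\<close>

text \<open>
  Homology \<open>H\<^sub>i(A, U)\<close> of a pair of subcomplexes \<open>U \<subseteq> A\<close> of \<open>K\<close>, given by their sets of cells.
\<close>

definition bc_chains :: "'x based_complex \<Rightarrow> 'x set \<Rightarrow> int \<Rightarrow> ('x \<Rightarrow>\<^sub>0 int) monoid" where
  "bc_chains K A i = free_Abelian_group (cells_of_deg K A i)"

definition bc_relcycles ::
    "'x based_complex \<Rightarrow> 'x set \<Rightarrow> 'x set \<Rightarrow> int \<Rightarrow> ('x \<Rightarrow>\<^sub>0 int) set" where
  "bc_relcycles K A U i =
     {c \<in> carrier (bc_chains K A i). bc_boundary K c \<in> carrier (bc_chains K U (i - 1))}"

definition bc_relboundaries ::
    "'x based_complex \<Rightarrow> 'x set \<Rightarrow> 'x set \<Rightarrow> int \<Rightarrow> ('x \<Rightarrow>\<^sub>0 int) set" where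
  "bc_relboundaries K A U i =
     {bc_boundary K c + u | c u.
        c \<in> carrier (bc_chains K A (i + 1)) \<and> u \<in> carrier (bc_chains K U i)}"

definition bc_rel_homology ::
    "'x based_complex \<Rightarrow> 'x set \<Rightarrow> 'x set \<Rightarrow> int \<Rightarrow> ('x \<Rightarrow>\<^sub>0 int) set monoid" where
  "bc_rel_homology K A U i =
     subgroup_generated (bc_chains K A i) (bc_relcycles K A U i) Mod bc_relboundaries K A U i"

definition bc_homology ::
    "'x based_complex \<Rightarrow> 'x set \<Rightarrow> int \<Rightarrow> ('x \<Rightarrow>\<^sub>0 int) set monoid" where
  "bc_homology K A i = bc_rel_homology K A {} i"

definition torsion_part :: "('g, 'm) monoid_scheme \<Rightarrow> 'g set" where
  "torsion_part G = {x \<in> carrier G. \<exists>n::nat. 0 < n \<and> x [^]\<^bsub>G\<^esub> n = \<one>\<^bsub>G\<^esub>}"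

definition int_independent :: "('g, 'm) monoid_scheme \<Rightarrow> 'g set \<Rightarrow> bool" where
  "int_independent G B \<longleftrightarrow>
     finite B \<and> B \<subseteq> carrier G \<and>
     (\<forall>c :: 'g \<Rightarrow> int.
        finprod G (\<lambda>x. x [^]\<^bsub>G\<^esub> c x) B = \<one>\<^bsub>G\<^esub> \<longrightarrow> (\<forall>x\<in>B. c x = 0))"

definition abelian_rank :: "('g, 'm) monoid_scheme \<Rightarrow> nat" where
  "abelian_rank G = Sup (card ` {B. int_independent G B})"


section \<open>Matroids\<close>

text \<open>A matroid is given by its ground set \<open>E\<close> and its family \<open>I\<close> of independent sets.\<close>

definition matroid_bases :: "'x set set \<Rightarrow> 'x set set" where
  "matroid_bases I = {B \<in> I. \<forall>A\<in>I. B \<subseteq> A \<longrightarrow> A = B}"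

definition dual_indeps :: "'x set \<Rightarrow> 'x set set \<Rightarrow> 'x set set" where
  "dual_indeps E I = {A. A \<subseteq> E \<and> (\<exists>B\<in>matroid_bases I. A \<inter> B = {})}"

definition circuits :: "'x set \<Rightarrow> 'x set set \<Rightarrow> 'x set set" where
  "circuits E I = {C. C \<subseteq> E \<and> C \<notin> I \<and> (\<forall>D. D \<subset> C \<longrightarrow> D \<in> I)}"

definition cocircuits :: "'x set \<Rightarrow> 'x set set \<Rightarrow> 'x set set" where
  "cocircuits E I = circuits E (dual_indeps E I)"

definition facets :: "'x based_complex \<Rightarrow> int \<Rightarrow> 'x set" where
  "facets K d = cells_of_deg K (bc_cells K) d"

text \<open>
  The cellular matroid: sets of facets indexing linearly independent families of columns of
  the real matrix of \<open>\<partial>\<^sub>d\<close>. Equal columns are distinct elements of the matroid.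
\<close>

definition cellular_indeps :: "'x based_complex \<Rightarrow> int \<Rightarrow> 'x set set" where
  "cellular_indeps K d =
     {A. A \<subseteq> facets K d \<and>
        (\<forall>c :: 'x \<Rightarrow> real.
           (\<forall>f \<in> cells_of_deg K (bc_cells K) (d - 1).
              (\<Sum>e\<in>A. c e * real_of_int (Poly_Mapping.lookup (bc_bd K e) f)) = 0)
           \<longrightarrow> (\<forall>e\<in>A. c e = 0))}"

definition boundary_rank :: "'x based_complex \<Rightarrow> int \<Rightarrow> nat" where
  "boundary_rank K d = Max (card ` cellular_indeps K d)"

text \<open>Meaningful only if the matroid has a circuit, respectively a cocircuit.\<close>

definition girth :: "'x based_complex \<Rightarrow> int \<Rightarrow> nat" where
  "girth K d = Min (card ` circuits (facets K d) (cellular_indeps K d))"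

definition connectivity :: "'x based_complex \<Rightarrow> int \<Rightarrow> nat" where
  "connectivity K d = Min (card ` cocircuits (facets K d) (cellular_indeps K d))"


section \<open>Spanning forests and their weighted counts\<close>

definition spanning_forests :: "'x based_complex \<Rightarrow> int \<Rightarrow> 'x set set" where
  "spanning_forests K d =
     {U. U \<subseteq> bc_cells K \<and> {x \<in> bc_cells K. bc_deg K x \<le> d - 1} \<subseteq> U \<and>
         cells_of_deg K U d \<in> matroid_bases (cellular_indeps K d) \<and>
         (\<forall>x\<in>U. bc_deg K x \<le> d)}"

definition torsion_order :: "'x based_complex \<Rightarrow> 'x set \<Rightarrow> int \<Rightarrow> nat" where
  "torsion_order K A i = card (torsion_part (bc_homology K A i))"

definition tau :: "'x based_complex \<Rightarrow> int \<Rightarrow> nat" where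
  "tau K d = (\<Sum>U\<in>spanning_forests K d. (torsion_order K U (d - 1))\<^sup>2)"

text \<open>
  As in the description of an acyclization as an integral basis of \<open>ker \<partial>\<^sub>d\<close>, the complex \<open>\<Omega>\<close>
  is only required to be a based chain complex. This covers the cellular chain complex of
  every CW complex with \<open>d\<close>-skeleton \<open>\<Sigma>\<close>; such a CW complex that is acyclic in degrees \<open>d\<close>
  and \<open>d + 1\<close> need not exist (a torus has no spherical class in degree 2), whereas a based
  chain complex \<open>\<Omega>\<close> does, once the type \<open>'x\<close> has enough elements outside \<open>bc_cells K\<close>
  to name a basis of \<open>ker \<partial>\<^sub>d\<close>.
\<close>

definition acyclization :: "'x based_complex \<Rightarrow> int \<Rightarrow> 'x based_complex \<Rightarrow> bool" where
  "acyclization K d \<Omega> \<longleftrightarrow>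
     based_complex \<Omega> \<and>
     (\<forall>x\<in>bc_cells \<Omega>. bc_deg \<Omega> x \<le> d + 1) \<and>
     {x \<in> bc_cells \<Omega>. bc_deg \<Omega> x \<le> d} = bc_cells K \<and>
     (\<forall>x\<in>bc_cells K. bc_deg \<Omega> x = bc_deg K x \<and> bc_bd \<Omega> x = bc_bd K x) \<and>
     trivial_group (bc_homology \<Omega> (bc_cells \<Omega>) (d + 1)) \<and>
     trivial_group (bc_homology \<Omega> (bc_cells \<Omega>) d)"

definition tau_star :: "'x based_complex \<Rightarrow> int \<Rightarrow> 'x based_complex \<Rightarrow> nat" where
  "tau_star K d \<Omega> =
     (\<Sum>U\<in>spanning_forests K d. (card (carrier (bc_rel_homology \<Omega> (bc_cells \<Omega>) U d)))\<^sup>2)"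


section \<open>Hermite's constant\<close>

definition lattice_basis :: "nat \<Rightarrow> nat \<Rightarrow> real mat \<Rightarrow> bool" where
  "lattice_basis n m M \<longleftrightarrow>
     M \<in> carrier_mat n m \<and> (\<forall>v \<in> carrier_vec m. M *\<^sub>v v = 0\<^sub>v n \<longrightarrow> v = 0\<^sub>v m)"

definition lattice_of :: "real mat \<Rightarrow> real vec set" where
  "lattice_of M = {M *\<^sub>v v | v. v \<in> carrier_vec (dim_col M) \<and> (\<forall>i<dim_col M. v $ i \<in> \<int>)}"

definition lattice_min :: "nat \<Rightarrow> real vec set \<Rightarrow> real" where
  "lattice_min n L = Inf ((\<lambda>x. scalar_prod x x) ` (L - {0\<^sub>v n}))"

text \<open>The supremum is finite and attained, that is, a maximum.\<close>

definition hermite_constant :: "nat \<Rightarrow> real" where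
  "hermite_constant m =
     Sup {lattice_min n (lattice_of M) *
            Determinant.det (transpose_mat M * M) powr (- 1 / real m) | n M.
          lattice_basis n m M}"

end

theory Submission
  imports Defs
begin

text \<open>
  Both inequalities evaluate Hermite's constant at one lattice. For the first, let \<open>p\<close> be an integral
  basis of the saturation of \<open>im \<partial>\<^sub>d\<close> in the group of \<open>(d - 1)\<close>-chains and let row \<open>e\<close> of \<open>N\<close> list
  the coordinates of \<open>\<partial>\<^sub>d e\<close>; the columns of \<open>N\<close> then span the cut lattice. For the second, the columns
  of \<open>N\<close> are those of \<open>\<partial>\<^sub>d\<^sub>+\<^sub>1\<close> of an acyclization, a basis of the flow lattice. The support of a nonzero
  lattice vector is dependent in the dual matroid, respectively in the matroid, so it contains a
  cocircuit, respectively a circuit, and the squared norm is at least \<open>k\<close>, respectively \<open>g\<close>. By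
  Cauchy-Binet the Gram determinant is the sum of the squared maximal minors of \<open>N\<close>, and each nonzero
  minor is bounded by the order of the cokernel of the corresponding square block, which is the torsion
  of \<open>H\<^sub>d\<^sub>-\<^sub>1(\<Upsilon>)\<close>, respectively the group \<open>H\<^sub>d(\<Omega>, \<Upsilon>)\<close>. Finally, since Hermite's constant is a
  supremum of reals, the lattice invariant must be shown to be bounded; a Cholesky decomposition and
  the pigeonhole principle give the bound \<open>9m\<close>.
\<close>

unbundle no vec_syntax
unbundle no inner_syntax

section \<open>Determinants and the Cauchy-Binet formula\<close>

text \<open>The exponent \<open>- 1 / m\<close> is negative, so a lower bound on the norms and an
  upper bound on the Gram determinant push in the same direction. Hence it suffices to bound each
  minor by the order of a cokernel, which takes an adjugate and a triangular matrix instead of a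
  Smith normal form. The saturation has two uses. It is a direct summand of the chain group, so
  integral functionals on it extend and the columns of \<open>N\<close> generate exactly the image
  of the transposed boundary map. Moreover its quotient by the image of a forest is the whole
  torsion in degree \<open>d - 1\<close>, with the same numerator for all forests. Facets carry no
  linear order, so minors are indexed by maps from \<open>{..<m}\<close> to facets, and determinants
  are taken of functions of two indices: choosing rows is then composition of functions. Dependence
  must be moved between real coefficients (matroid, lattices) and integral ones (chains, homology).
  The Gram determinant of an integer matrix does this, being the same number over both
  rings.\<close>

definition fdet :: "nat \<Rightarrow> (nat \<Rightarrow> nat \<Rightarrow> 'r) \<Rightarrow> 'r::comm_ring_1" where
  "fdet m a = Determinant.det (Matrix.mat m m (\<lambda>(i, j). a i j))"

lemma fdet_cong:
  "(\<And>i j. i < m \<Longrightarrow> j < m \<Longrightarrow> a i j = b i j) \<Longrightarrow> fdet m a = fdet m b"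
  unfolding fdet_def by (intro arg_cong[where f = Determinant.det] eq_matI) auto

lemma fdet_expand:
  "fdet m a = (\<Sum>p | p permutes {..<m}. signof p * (\<Prod>i<m. a i (p i)))"
proof -
  have "fdet m a = (\<Sum>p | p permutes {0..<m}. signof p *
      (\<Prod>i = 0..<m. Matrix.mat m m (\<lambda>(i, j). a i j) $$ (i, p i)))"
    unfolding fdet_def by (rule det_def') simp
  also have "\<dots> = (\<Sum>p | p permutes {0..<m}. signof p * (\<Prod>i = 0..<m. a i (p i)))"
  proof (intro sum.cong refl arg_cong2[where f = "(*)"] prod.cong)
    fix p i assume "p \<in> {p. p permutes {0..<m}}" "i \<in> {0..<m}"
    then show "Matrix.mat m m (\<lambda>(i, j). a i j) $$ (i, p i) = a i (p i)"
      using permutes_in_image[of p "{0..<m}" i] by simp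
  qed
  finally show ?thesis by (simp add: atLeast0LessThan)
qed

lemma fdet_transpose: "fdet m (\<lambda>i j. a j i) = fdet m a"
proof -
  have "Matrix.mat m m (\<lambda>(i, j). a j i) = transpose_mat (Matrix.mat m m (\<lambda>(i, j). a i j))"
    by (intro eq_matI) auto
  then show ?thesis unfolding fdet_def by (metis det_transpose mat_carrier)
qed

lemma fdet_mult: "fdet m (\<lambda>i j. \<Sum>k<m. a i k * b k j) = fdet m a * fdet m b"
proof -
  have "Matrix.mat m m (\<lambda>(i, j). \<Sum>k<m. a i k * b k j)
      = Matrix.mat m m (\<lambda>(i, j). a i j) * Matrix.mat m m (\<lambda>(i, j). b i j)"
    by (intro eq_matI) (auto simp: scalar_prod_def lessThan_atLeast0)
  then show ?thesis unfolding fdet_def by (simp add: det_mult[OF mat_carrier mat_carrier])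
qed

lemma of_int_fdet: "of_int (fdet m a) = fdet m (\<lambda>i j. of_int (a i j))"
  unfolding fdet_expand by (simp add: sign_def)

lemma fdet_eq_0_iff:
  fixes a :: "nat \<Rightarrow> nat \<Rightarrow> 'r::idom"
  shows "fdet m a = 0 \<longleftrightarrow> (\<exists>v. (\<exists>i<m. v i \<noteq> 0) \<and> (\<forall>i<m. (\<Sum>j<m. a i j * v j) = 0))"
proof -
  let ?A = "Matrix.mat m m (\<lambda>(i, j). a i j)"
  have eq: "?A *\<^sub>v v = 0\<^sub>v m \<longleftrightarrow> (\<forall>i<m. (\<Sum>j<m. a i j * v $ j) = 0)" if "v \<in> carrier_vec m" for v
    using that by (auto simp: vec_eq_iff scalar_prod_def lessThan_atLeast0)
  have "fdet m a = 0 \<longleftrightarrow> (\<exists>v. v \<in> carrier_vec m \<and> v \<noteq> 0\<^sub>v m \<and> ?A *\<^sub>v v = 0\<^sub>v m)"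
    unfolding fdet_def by (rule det_0_iff_vec_prod_zero) simp
  also have "\<dots> \<longleftrightarrow> (\<exists>v. (\<exists>i<m. v i \<noteq> 0) \<and> (\<forall>i<m. (\<Sum>j<m. a i j * v j) = 0))"
  proof safe
    fix v assume v: "v \<in> carrier_vec m" "v \<noteq> 0\<^sub>v m" "?A *\<^sub>v v = 0\<^sub>v m"
    then show "\<exists>v. (\<exists>i<m. v i \<noteq> 0) \<and> (\<forall>i<m. (\<Sum>j<m. a i j * v j) = 0)"
      using eq[OF v(1)] by (intro exI[of _ "\<lambda>i. v $ i"]) (auto simp: vec_eq_iff)
  next
    fix v i assume v: "i < m" "v i \<noteq> (0::'r)" "\<forall>i<m. (\<Sum>j<m. a i j * v j) = 0"
    then show "\<exists>v. v \<in> carrier_vec m \<and> v \<noteq> 0\<^sub>v m \<and> ?A *\<^sub>v v = 0\<^sub>v m"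
      by (intro exI[of _ "Matrix.vec m v"]) (auto simp: vec_eq_iff scalar_prod_def lessThan_atLeast0)
  qed
  finally show ?thesis .
qed

text \<open>Over the integers the adjugate stands in for the inverse: a vector whose entries are all
  divisible by the determinant is an integral combination of the columns.\<close>

lemma fdet_adjugate:
  obtains b where "\<And>i j. i < m \<Longrightarrow> j < m \<Longrightarrow>
    (\<Sum>k<m. a i k * b k j) = (if i = j then fdet m a else 0)"
proof
  let ?A = "Matrix.mat m m (\<lambda>(i, j). a i j)"
  fix i j assume ij: "i < m" "j < m"
  have A: "?A \<in> carrier_mat m m" by simp
  have "(?A * adj_mat ?A) $$ (i, j) = (fdet m a \<cdot>\<^sub>m 1\<^sub>m m) $$ (i, j)"
    unfolding adj_mat(2)[OF A] fdet_def ..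
  then show "(\<Sum>k<m. a i k * adj_mat ?A $$ (k, j)) = (if i = j then fdet m a else 0)"
    using ij adj_mat(1)[OF A] by (auto simp: scalar_prod_def lessThan_atLeast0)
qed

lemma fdet_upper_triangular:
  assumes "\<And>i j. j < i \<Longrightarrow> i < m \<Longrightarrow> a i j = 0"
  shows "fdet m a = (\<Prod>i<m. a i i)"
proof -
  have "fdet m a = prod_list (diag_mat (Matrix.mat m m (\<lambda>(i, j). a i j)))"
    unfolding fdet_def by (rule det_upper_triangular) (auto simp: assms)
  also have "\<dots> = (\<Prod>i<m. a i i)"
    by (auto simp: prod_list_diag_prod lessThan_atLeast0)
  finally show ?thesis .
qed

lemma fdet_permute_rows:
  assumes "p permutes {..<m}"
  shows "fdet m (\<lambda>i. a (p i)) = signof p * fdet m a"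
proof -
  have "Matrix.mat m m (\<lambda>(i, j). a (p i) j)
      = Matrix.mat m m (\<lambda>(i, j). Matrix.mat m m (\<lambda>(i, j). a i j) $$ (p i, j))"
    using permutes_in_image[OF assms] by (intro eq_matI) auto
  then show ?thesis
    unfolding fdet_def using assms
    by (simp add: det_permute_rows[OF mat_carrier] lessThan_atLeast0)
qed

lemma fdet_identical_rows:
  assumes "i < m" "j < m" "i \<noteq> j" "a i = a j"
  shows "fdet m a = 0"
  unfolding fdet_def
  by (rule det_identical_rows[of _ m i j]) (use assms in auto)

lemma fdet_rows_inj:
  assumes "fdet m (\<lambda>i. a (f i)) \<noteq> 0"
  shows "inj_on f {..<m}"
proof (rule inj_onI, rule ccontr)
  fix i j assume "i \<in> {..<m}" "j \<in> {..<m}" "f i = f j" "i \<noteq> j"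
  then have "fdet m (\<lambda>i. a (f i)) = 0" by (intro fdet_identical_rows[of i m j]) auto
  with assms show False by simp
qed

text \<open>
  Summing over all maps \<open>{..<m} \<rightarrow> E\<close> counts each maximal minor \<open>m!\<close> times, but needs no order on \<open>E\<close>.
\<close>

lemma cauchy_binet_symmetric:
  fixes a :: "'x \<Rightarrow> nat \<Rightarrow> 'r::comm_ring_1"
  assumes "finite E"
  shows "of_nat (fact m) * fdet m (\<lambda>i j. \<Sum>e\<in>E. a e i * a e j)
       = (\<Sum>f \<in> {..<m} \<rightarrow>\<^sub>E E. (fdet m (\<lambda>i. a (f i)))\<^sup>2)"
proof -
  let ?D = "\<lambda>f. fdet m (\<lambda>i. a (f i))" and ?F = "\<lambda>f. \<Prod>i<m. a (f i) i"
  let ?X = "{..<m} \<rightarrow>\<^sub>E E" and ?P = "{p. p permutes {..<m}}"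
  \<comment> \<open>Multilinearity in the rows: a product of sums over \<open>E\<close> is a sum
    over maps that choose one summand per row.\<close>
  have G: "fdet m (\<lambda>i j. \<Sum>e\<in>E. a e i * a e j) = (\<Sum>f\<in>?X. ?F f * ?D f)"
  proof -
    have "fdet m (\<lambda>i j. \<Sum>e\<in>E. a e i * a e j)
        = (\<Sum>p\<in>?P. signof p * (\<Prod>i<m. \<Sum>e\<in>E. a e i * a e (p i)))"
      by (rule fdet_expand)
    also have "\<dots> = (\<Sum>p\<in>?P. signof p * (\<Sum>f\<in>?X. \<Prod>i<m. a (f i) i * a (f i) (p i)))"
      by (intro sum.cong refl arg_cong2[where f = "(*)"] prod_sum_PiE) (auto simp: assms)
    also have "\<dots> = (\<Sum>f\<in>?X. ?F f * ?D f)"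
      unfolding fdet_expand sum_distrib_left
      by (subst sum.swap) (auto intro!: sum.cong simp: prod.distrib mult_ac)
    finally show ?thesis .
  qed
  \<comment> \<open>Composing \<open>f\<close> with \<open>p\<close> permutes the rows of its minor
    and costs a sign. Summing over all \<open>p\<close> turns the diagonal product \<open>?F\<close>
    into a second copy of the determinant, which produces the square.\<close>
  have perm: "(\<Sum>f\<in>?X. ?F f * ?D f) = (\<Sum>f\<in>?X. signof p * ?F (f \<circ> p) * ?D f)" if p: "p permutes {..<m}" for p
  proof -
    have "(\<Sum>f\<in>?X. ?F f * ?D f) = (\<Sum>f\<in>?X. ?F (f \<circ> p) * ?D (f \<circ> p))"
    proof (rule sum.reindex_bij_witness[of _ "\<lambda>f. f \<circ> p" "\<lambda>f. f \<circ> Hilbert_Choice.inv p"])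
      show "f \<circ> p \<in> ?X" "f \<circ> Hilbert_Choice.inv p \<in> ?X" if "f \<in> ?X" for f
        using that p permutes_inv[OF p] by (auto simp: PiE_iff extensional_def permutes_in_image
          permutes_not_in lessThan_iff[symmetric] simp del: lessThan_iff)
    qed (use p in \<open>auto simp: o_def permutes_inverses\<close>)
    also have "\<dots> = (\<Sum>f\<in>?X. signof p * ?F (f \<circ> p) * ?D f)"
      by (intro sum.cong refl)
        (simp add: fdet_permute_rows[OF p, of "\<lambda>i. a (f i)" for f] mult_ac)
    finally show ?thesis .
  qed
  have "of_nat (fact m) * (\<Sum>f\<in>?X. ?F f * ?D f) = (\<Sum>p\<in>?P. \<Sum>f\<in>?X. ?F f * ?D f)"
    by (simp add: card_permutations[OF refl])
  also have "\<dots> = (\<Sum>p\<in>?P. \<Sum>f\<in>?X. signof p * ?F (f \<circ> p) * ?D f)"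
    by (intro sum.cong refl perm) simp
  also have "\<dots> = (\<Sum>f\<in>?X. (\<Sum>p\<in>?P. signof p * ?F (f \<circ> p)) * ?D f)"
    by (subst sum.swap) (simp add: sum_distrib_right)
  also have "\<dots> = (\<Sum>f\<in>?X. (?D f)\<^sup>2)"
  proof (intro sum.cong refl)
    fix f
    have "(\<Sum>p\<in>?P. signof p * ?F (f \<circ> p)) = fdet m (\<lambda>i j. a (f j) i)"
      unfolding fdet_expand by simp
    then show "(\<Sum>p\<in>?P. signof p * ?F (f \<circ> p)) * ?D f = (?D f)\<^sup>2"
      using fdet_transpose[of m "\<lambda>i. a (f i)"] by (simp add: power2_eq_square)
  qed
  finally show ?thesis unfolding G .
qed

text \<open>Every map with nonzero minor enumerates a member of \<open>BB\<close>, and a given set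
  has at most \<open>m!\<close> enumerations. This factor is the one that the symmetric Cauchy-Binet
  formula carries on its other side.\<close>

lemma sum_sq_minors_le:
  fixes D :: "(nat \<Rightarrow> 'x) \<Rightarrow> int" and t :: "'x set \<Rightarrow> nat"
  assumes "finite E" "finite BB"
    and bound: "\<And>f. f \<in> {..<m} \<rightarrow>\<^sub>E E \<Longrightarrow> D f \<noteq> 0 \<Longrightarrow>
       inj_on f {..<m} \<and> f ` {..<m} \<in> BB \<and> \<bar>D f\<bar> \<le> int (t (f ` {..<m}))"
  shows "(\<Sum>f \<in> {..<m} \<rightarrow>\<^sub>E E. (D f)\<^sup>2) \<le> fact m * (\<Sum>B\<in>BB. (int (t B))\<^sup>2)"
proof -
  let ?X = "{..<m} \<rightarrow>\<^sub>E E"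
  let ?Y = "{f \<in> ?X. D f \<noteq> 0}"
  have finX: "finite ?X" using assms by (auto intro: finite_PiE)
  have "(\<Sum>f\<in>?X. (D f)\<^sup>2) = (\<Sum>f\<in>?Y. (D f)\<^sup>2)"
    by (rule sum.mono_neutral_right) (use finX in auto)
  also have "\<dots> \<le> (\<Sum>f\<in>?Y. (int (t (f ` {..<m})))\<^sup>2)"
  proof (rule sum_mono)
    fix f assume "f \<in> ?Y"
    then have "\<bar>D f\<bar> \<le> \<bar>int (t (f ` {..<m}))\<bar>"
      using bound[of f] by simp
    then show "(D f)\<^sup>2 \<le> (int (t (f ` {..<m})))\<^sup>2"
      by (simp only: abs_le_square_iff)
  qed
  also have "\<dots> = (\<Sum>B\<in>BB. \<Sum>f\<in>{f\<in>?Y. f ` {..<m} = B}. (int (t (f ` {..<m})))\<^sup>2)"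
    by (rule sum.group[symmetric]) (use finX assms bound in auto)
  also have "\<dots> \<le> (\<Sum>B\<in>BB. fact m * (int (t B))\<^sup>2)"
  proof (rule sum_mono)
    fix B
    let ?Z = "{f\<in>?Y. f ` {..<m} = B}"
    have "card ?Z \<le> fact m"
    proof (cases "?Z = {}")
      case False
      then obtain f0 where f0: "f0 \<in> ?Z" by blast
      with bound[of f0] have inj0: "inj_on f0 {..<m}" by auto
      \<comment> \<open>Any enumeration of \<open>B\<close> is the fixed one \<open>f0\<close>
        preceded by a permutation; \<open>undefined\<close> is the value of an extensional map
        outside its domain.\<close>
      have "?Z \<subseteq> (\<lambda>p i. if i < m then f0 (p i) else undefined) ` {p. p permutes {..<m}}"
      proof
        fix f assume f: "f \<in> ?Z"
        then have inj: "inj_on f {..<m}" and E: "f \<in> ?X" using bound[of f] by auto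
        define p where "p = (\<lambda>i. if i < m then inv_into {..<m} f0 (f i) else i)"
        have "bij_betw f {..<m} B" "bij_betw f0 {..<m} B"
          using f f0 inj inj0 by (auto simp: bij_betw_def)
        then have "bij_betw (inv_into {..<m} f0 \<circ> f) {..<m} {..<m}"
          by (blast intro: bij_betw_trans bij_betw_inv_into)
        then have "bij_betw p {..<m} {..<m}"
          by (subst bij_betw_cong[of _ _ "inv_into {..<m} f0 \<circ> f"]) (simp_all add: p_def)
        then have "p permutes {..<m}"
          by (rule bij_imp_permutes) (auto simp: p_def)
        moreover have "f = (\<lambda>i. if i < m then f0 (p i) else undefined)"
        proof
          fix i
          have "f i \<in> f0 ` {..<m}" if "i < m" using that f f0 by blast
          then show "f i = (if i < m then f0 (p i) else undefined)"
            using PiE_arb[OF E, of i] by (simp add: p_def f_inv_into_f)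
        qed
        ultimately show "f \<in> (\<lambda>p i. if i < m then f0 (p i) else undefined) ` {p. p permutes {..<m}}"
          by blast
      qed
      then have "card ?Z \<le> card {p. p permutes {..<m}}"
        by (rule surj_card_le[rotated]) (simp add: finite_permutations)
      then show ?thesis by (simp add: card_permutations[of _ m])
    next
      case True
      show ?thesis unfolding True by simp
    qed
    then have "int (card ?Z) \<le> int (fact m)" by (simp only: of_nat_le_iff)
    then have "int (card ?Z) \<le> fact m" by simp
    moreover have "(\<Sum>f\<in>?Z. (int (t (f ` {..<m})))\<^sup>2) = int (card ?Z) * (int (t B))\<^sup>2"
    proof -
      have "(\<Sum>f\<in>?Z. (int (t (f ` {..<m})))\<^sup>2) = (\<Sum>f\<in>?Z. (int (t B))\<^sup>2)"
        by (rule sum.cong) auto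
      then show ?thesis by simp
    qed
    ultimately show "(\<Sum>f\<in>?Z. (int (t (f ` {..<m})))\<^sup>2) \<le> fact m * (int (t B))\<^sup>2"
      by (simp only:) (rule mult_right_mono[OF _ zero_le_power2])
  qed
  finally show ?thesis by (simp add: sum_distrib_left)
qed

section \<open>Integer matrices and the index of their column lattice\<close>

text \<open>Zero columns pad the matrix to a square one, whose determinant vanishes because a unit
  vector at a padded column lies in the kernel. Transposing gives the row relation, with
  coefficients in the ring itself rather than in its fraction field.\<close>

lemma rows_dependent:
  fixes a :: "nat \<Rightarrow> nat \<Rightarrow> 'r::idom"
  assumes "m < q"
  obtains c where "\<exists>i<q. c i \<noteq> 0" "\<And>j. j < m \<Longrightarrow> (\<Sum>i<q. c i * a i j) = 0"
proof -
  let ?b = "\<lambda>i j. if j < m then a i j else 0"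
  have "(\<exists>i<q. (if i = m then 1 else 0 :: 'r) \<noteq> 0)" using assms by auto
  moreover have "(\<Sum>j<q. ?b i j * (if j = m then 1 else 0)) = 0" for i
    by (intro sum.neutral) auto
  ultimately have "fdet q ?b = 0" unfolding fdet_eq_0_iff
    by (intro exI[of _ "\<lambda>j. if j = m then 1 else 0"] conjI allI impI)
  then have "fdet q (\<lambda>j i. ?b i j) = 0" by (rule trans[OF fdet_transpose])
  then obtain c where c: "\<exists>i<q. c i \<noteq> 0" "\<forall>j<q. (\<Sum>i<q. ?b i j * c i) = 0"
    unfolding fdet_eq_0_iff by blast
  show thesis
  proof (rule that[OF c(1)])
    fix j assume "j < m"
    then show "(\<Sum>i<q. c i * a i j) = 0"
      using c(2)[rule_format, of j] assms by (simp add: mult.commute)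
  qed
qed

section \<open>Gram determinants over the integers and over the reals\<close>

lemma gram_mult:
  fixes a :: "'x \<Rightarrow> nat \<Rightarrow> 'r::comm_ring_1"
  shows "(\<Sum>j<m. (\<Sum>e\<in>E. a e i * a e j) * v j) = (\<Sum>e\<in>E. a e i * (\<Sum>j<m. a e j * v j))"
proof -
  have "(\<Sum>j<m. (\<Sum>e\<in>E. a e i * a e j) * v j) = (\<Sum>j<m. \<Sum>e\<in>E. a e i * (a e j * v j))"
    by (simp add: sum_distrib_right mult.assoc)
  also have "\<dots> = (\<Sum>e\<in>E. \<Sum>j<m. a e i * (a e j * v j))" by (rule sum.swap)
  finally show ?thesis by (simp add: sum_distrib_left)
qed

text \<open>If the Gram matrix kills \<open>v\<close>, pairing with \<open>v\<close> gives a sum of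
  squares equal to zero; the order on the ring makes each square vanish.\<close>

lemma gram_det_eq_0_iff:
  fixes a :: "'x \<Rightarrow> nat \<Rightarrow> 'r::linordered_idom"
  assumes "finite E"
  shows "fdet m (\<lambda>i j. \<Sum>e\<in>E. a e i * a e j) = 0
    \<longleftrightarrow> (\<exists>v. (\<exists>i<m. v i \<noteq> 0) \<and> (\<forall>e\<in>E. (\<Sum>j<m. a e j * v j) = 0))"
proof -
  have "(\<forall>i<m. (\<Sum>e\<in>E. a e i * (\<Sum>j<m. a e j * v j)) = 0)
      \<longleftrightarrow> (\<forall>e\<in>E. (\<Sum>j<m. a e j * v j) = 0)" for v
  proof
    assume 0: "\<forall>i<m. (\<Sum>e\<in>E. a e i * (\<Sum>j<m. a e j * v j)) = 0"
    have "(\<Sum>e\<in>E. (\<Sum>j<m. a e j * v j) * (\<Sum>j<m. a e j * v j))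
        = (\<Sum>e\<in>E. \<Sum>i<m. v i * (a e i * (\<Sum>j<m. a e j * v j)))"
      by (intro sum.cong refl) (simp add: sum_distrib_right mult_ac)
    also have "\<dots> = (\<Sum>i<m. v i * (\<Sum>e\<in>E. a e i * (\<Sum>j<m. a e j * v j)))"
      by (subst sum.swap) (simp add: sum_distrib_left)
    also have "\<dots> = 0" using 0 by (intro sum.neutral) simp
    finally show "\<forall>e\<in>E. (\<Sum>j<m. a e j * v j) = 0"
      by (subst (asm) sum_nonneg_eq_0_iff) (use assms in auto)
  qed simp
  then show ?thesis by (simp only: fdet_eq_0_iff gram_mult)
qed

text \<open>Both sides say that the same integer, the Gram determinant, is zero. A real solution may
  be irrational, so denominators could not simply be cleared.\<close>

lemma gram_det_real:
  fixes a :: "'x \<Rightarrow> nat \<Rightarrow> int"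
  assumes "finite E"
  shows "(\<exists>v::nat\<Rightarrow>real. (\<exists>i<m. v i \<noteq> 0) \<and> (\<forall>e\<in>E. (\<Sum>j<m. real_of_int (a e j) * v j) = 0))
     \<longleftrightarrow> (\<exists>v::nat\<Rightarrow>int. (\<exists>i<m. v i \<noteq> 0) \<and> (\<forall>e\<in>E. (\<Sum>j<m. a e j * v j) = 0))"
proof -
  have eq: "fdet m (\<lambda>i j. \<Sum>e\<in>E. real_of_int (a e i) * real_of_int (a e j))
      = real_of_int (fdet m (\<lambda>i j. \<Sum>e\<in>E. a e i * a e j))"
    by (simp add: of_int_fdet)
  show ?thesis
    unfolding gram_det_eq_0_iff[OF assms, of m a, symmetric]
      gram_det_eq_0_iff[OF assms, of m "\<lambda>e i. real_of_int (a e i)", symmetric] eq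
    by (rule of_int_eq_0_iff)
qed

text \<open>
  Let \<open>t j\<close> be the least positive \<open>j\<close>-th entry of a vector of the column lattice that vanishes beyond
  \<open>j\<close>. Distinct points of the box with side lengths \<open>t j\<close> are incongruent, by looking at the last index
  where they differ, and the minimizing vectors form a triangular matrix of determinant \<open>\<Prod>t j\<close> that is
  a multiple of \<open>A\<close>.
\<close>

lemma abs_fdet_le_card_quotient:
  fixes A :: "nat \<Rightarrow> nat \<Rightarrow> int" and \<phi> :: "(nat \<Rightarrow> int) \<Rightarrow> 'q"
  assumes nz: "fdet r A \<noteq> 0"
    and \<phi>: "\<And>x y. \<phi> x = \<phi> y \<longleftrightarrow> (\<exists>z. \<forall>i<r. x i - y i = (\<Sum>j<r. A i j * z j))"
  shows "finite (range \<phi>)" and "\<bar>fdet r A\<bar> \<le> int (card (range \<phi>))"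
proof -
  let ?D = "fdet r A"
  obtain b where b: "\<And>i j. i < r \<Longrightarrow> j < r \<Longrightarrow> (\<Sum>k<r. A i k * b k j) = (if i = j then ?D else 0)"
    using fdet_adjugate[of r A] by blast
  \<comment> \<open>By the adjugate, changing coordinates by multiples of the determinant stays
    within a class, so the residues meet every class and there are finitely many classes.\<close>
  let ?Y = "{..<r} \<rightarrow>\<^sub>E {0..<\<bar>?D\<bar>}"
  have "range \<phi> \<subseteq> \<phi> ` ?Y"
  proof clarify
    fix x :: "nat \<Rightarrow> int"
    define y where "y = (\<lambda>i. if i < r then x i mod \<bar>?D\<bar> else undefined)"
    have "y \<in> ?Y" using nz by (auto simp: y_def PiE_iff extensional_def)
    \<comment> \<open>The sign factor converts the determinant, which the adjugate produces, into
      its absolute value, the modulus used in \<open>y\<close>.\<close>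
    have "x i - y i = (\<Sum>k<r. A i k * (\<Sum>j<r. b k j * (sgn ?D * (x j div \<bar>?D\<bar>))))" if "i < r" for i
    proof -
      have "(\<Sum>k<r. A i k * (\<Sum>j<r. b k j * (sgn ?D * (x j div \<bar>?D\<bar>))))
          = (\<Sum>k<r. \<Sum>j<r. A i k * b k j * (sgn ?D * (x j div \<bar>?D\<bar>)))"
        by (simp add: sum_distrib_left mult.assoc)
      also have "\<dots> = (\<Sum>j<r. (\<Sum>k<r. A i k * b k j) * (sgn ?D * (x j div \<bar>?D\<bar>)))"
        by (subst sum.swap) (simp add: sum_distrib_right)
      also have "\<dots> = (\<Sum>j<r. if i = j then ?D * (sgn ?D * (x j div \<bar>?D\<bar>)) else 0)"
        by (intro sum.cong refl) (simp add: b that)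
      also have "\<dots> = \<bar>?D\<bar> * (x i div \<bar>?D\<bar>)"
        using that by (simp add: abs_sgn mult.assoc)
      also have "\<dots> = x i - y i" using that by (simp add: y_def minus_mod_eq_mult_div)
      finally show ?thesis ..
    qed
    then have "\<phi> x = \<phi> y" unfolding \<phi> by (intro exI allI impI)
    with \<open>y \<in> ?Y\<close> show "\<phi> x \<in> \<phi> ` ?Y" by blast
  qed
  then show fin: "finite (range \<phi>)"
    by (rule finite_subset) (auto intro: finite_PiE)

  let ?Az = "\<lambda>z i. \<Sum>j<r. A i j * z j"
  define P where "P = (\<lambda>j n. 0 < n \<and> (\<exists>z. (\<forall>i<r. j < i \<longrightarrow> ?Az z i = 0) \<and> ?Az z j = int n))"
  have P_abs: "P j (nat \<bar>?Az z j\<bar>)" if "\<forall>i<r. j < i \<longrightarrow> ?Az z i = 0" "?Az z j \<noteq> 0" for j z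
  proof -
    have neg: "?Az (\<lambda>i. - z i) i = - ?Az z i" for i by (simp add: sum_negf)
    show ?thesis
    proof (cases "?Az z j > 0")
      case True
      then show ?thesis unfolding P_def using that by (intro conjI exI[of _ z]) auto
    next
      case False
      then show ?thesis unfolding P_def using that by (intro conjI exI[of _ "\<lambda>i. - z i"]) (auto simp only: neg)
    qed
  qed
  define t where "t = (\<lambda>j. LEAST n. P j n)"
  \<comment> \<open>A least value exists because there is some value: the matrix sends column
    \<open>j\<close> of the adjugate to \<open>?D\<close> times the \<open>j\<close>-th unit
    vector.\<close>
  have "P j (t j)" if "j < r" for j
    unfolding t_def by (rule LeastI) (rule P_abs[where z = "\<lambda>k. b k j"], use b that nz in auto)
  then have ex: "\<forall>j\<in>{..<r}. \<exists>z. (\<forall>i<r. j < i \<longrightarrow> ?Az z i = 0) \<and> ?Az z j = int (t j)" and tpos: "\<And>j. j < r \<Longrightarrow> 0 < t j"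
    unfolding P_def by auto
  from bchoice[OF ex] obtain Z where
    "\<forall>j\<in>{..<r}. (\<forall>i<r. j < i \<longrightarrow> ?Az (Z j) i = 0) \<and> ?Az (Z j) j = int (t j)" ..
  then have Z: "\<And>i j. j < r \<Longrightarrow> i < r \<Longrightarrow> j < i \<Longrightarrow> ?Az (Z j) i = 0"
      "\<And>j. j < r \<Longrightarrow> ?Az (Z j) j = int (t j)"
    by auto
  have "?D * fdet r (\<lambda>i j. Z j i) = fdet r (\<lambda>i j. ?Az (Z j) i)"
    by (rule fdet_mult[symmetric])
  also have "\<dots> = (\<Prod>i<r. ?Az (Z i) i)" by (rule fdet_upper_triangular) (auto simp: Z)
  also have "\<dots> = int (\<Prod>i<r. t i)" by (simp add: Z)
  finally have prod: "?D * fdet r (\<lambda>i j. Z j i) = int (\<Prod>i<r. t i)" .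
  have "0 < (\<Prod>i<r. t i)" using tpos by (intro prod_pos) auto
  then have "int (\<Prod>i<r. t i) \<noteq> 0" by simp
  moreover have "?D dvd int (\<Prod>i<r. t i)" unfolding prod[symmetric] by (rule dvd_triv_left)
  ultimately have "\<bar>?D\<bar> \<le> \<bar>int (\<Prod>i<r. t i)\<bar>" by (rule dvd_imp_le_int)
  also have "\<dots> = int (\<Prod>i<r. t i)" by (rule abs_of_nat)
  also have "(\<Prod>i<r. t i) = card (Pi\<^sub>E {..<r} (\<lambda>i. {0..<int (t i)}))"
    by (simp add: card_PiE)
  also have "\<dots> \<le> card (range \<phi>)"
  proof (rule card_inj_on_le[OF _ _ fin])
    show "inj_on \<phi> (Pi\<^sub>E {..<r} (\<lambda>i. {0..<int (t i)}))"
    proof (rule inj_onI, rule ccontr)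
      fix x y assume x: "x \<in> Pi\<^sub>E {..<r} (\<lambda>i. {0..<int (t i)})"
        and y: "y \<in> Pi\<^sub>E {..<r} (\<lambda>i. {0..<int (t i)})" and "\<phi> x = \<phi> y" "x \<noteq> y"
      then obtain z where z: "\<And>i. i < r \<Longrightarrow> x i - y i = ?Az z i" unfolding \<phi> by blast
      define J where "J = {i. i < r \<and> x i \<noteq> y i}"
      have "finite J" by (simp add: J_def)
      have "J \<noteq> {}"
        using PiE_ext[OF x y] \<open>x \<noteq> y\<close> by (auto simp: J_def)
      define j where "j = Max J"
      have "j \<in> J" unfolding j_def using \<open>finite J\<close> \<open>J \<noteq> {}\<close> by (rule Max_in)
      have "?Az z i = 0" if "i < r" "j < i" for i
      proof -
        have "i \<notin> J" using that Max_ge[OF \<open>finite J\<close>, of i] by (auto simp: j_def)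
        then show ?thesis using z[of i] that by (auto simp: J_def)
      qed
      moreover have "?Az z j \<noteq> 0" using \<open>j \<in> J\<close> z[of j] by (auto simp: J_def)
      ultimately have "P j (nat \<bar>?Az z j\<bar>)" by (intro P_abs) auto
      then have "t j \<le> nat \<bar>?Az z j\<bar>" unfolding t_def by (rule Least_le)
      moreover have "x j \<in> {0..<int (t j)}" "y j \<in> {0..<int (t j)}" "?Az z j = x j - y j"
        using x y \<open>j \<in> J\<close> z[of j] by (auto simp: J_def PiE_iff)
      ultimately show False by auto
    qed
  qed auto
  finally show "\<bar>?D\<bar> \<le> int (card (range \<phi>))" by simp
qed

section \<open>Finiteness of Hermite's constant\<close>

lemma gram_form:
  fixes a :: "'x \<Rightarrow> nat \<Rightarrow> 'r::comm_ring_1"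
  shows "(\<Sum>i<m. \<Sum>j<m. v i * (\<Sum>e\<in>E. a e i * a e j) * v j) = (\<Sum>e\<in>E. (\<Sum>j<m. a e j * v j)\<^sup>2)"
proof -
  have "(\<Sum>i<m. \<Sum>j<m. v i * (\<Sum>e\<in>E. a e i * a e j) * v j)
      = (\<Sum>i<m. \<Sum>j<m. \<Sum>e\<in>E. (a e i * v i) * (a e j * v j))"
    unfolding sum_distrib_left sum_distrib_right by (simp add: mult_ac)
  also have "\<dots> = (\<Sum>i<m. \<Sum>e\<in>E. \<Sum>j<m. (a e i * v i) * (a e j * v j))"
    by (intro sum.cong refl sum.swap)
  also have "\<dots> = (\<Sum>e\<in>E. \<Sum>i<m. \<Sum>j<m. (a e i * v i) * (a e j * v j))"
    by (rule sum.swap)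
  finally show ?thesis by (simp add: power2_eq_square sum_product)
qed

section \<open>Positive definite forms and short integral vectors\<close>

definition pos_def_form :: "nat \<Rightarrow> (nat \<Rightarrow> nat \<Rightarrow> real) \<Rightarrow> bool" where
  "pos_def_form m G \<longleftrightarrow> (\<forall>i j. G i j = G j i) \<and>
     (\<forall>v. (\<exists>i<m. v i \<noteq> 0) \<longrightarrow> 0 < (\<Sum>i<m. \<Sum>j<m. v i * G i j * v j))"

text \<open>The induction removes the last variable, so row \<open>k\<close> of \<open>R\<close>
  involves only the variables up to \<open>k\<close>. With this orientation the form is a sum of
  squares of linear forms in successively more variables, and integer points can be chosen one
  coordinate at a time.\<close>

lemma cholesky:
  assumes "pos_def_form m G"
  shows "\<exists>R. (\<forall>k<m. 0 < R k k) \<and> (\<forall>k j. k < j \<longrightarrow> R k j = 0) \<and>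
      (\<forall>i<m. \<forall>j<m. G i j = (\<Sum>k<m. R k i * R k j))"
  using assms
proof (induction m arbitrary: G)
  case 0
  show ?case by (rule exI[of _ "\<lambda>_ _. 0"]) simp
next
  case (Suc m)
  have sym: "G i j = G j i" for i j using Suc.prems by (simp add: pos_def_form_def)
  have pos: "0 < (\<Sum>i<Suc m. \<Sum>j<Suc m. v i * G i j * v j)" if "\<exists>i<Suc m. v i \<noteq> 0" for v
    using Suc.prems that unfolding pos_def_form_def by blast
  define a where "a = G m m"
  have "0 < a"
    using pos[of "\<lambda>i. if i = m then 1 else 0"] by (auto simp: a_def)
  define H where "H = (\<lambda>i j. G i j - G m i * G m j / a)"
  have "pos_def_form m H"
    unfolding pos_def_form_def
  proof (intro conjI allI impI)
    show "H i j = H j i" for i j by (simp add: H_def sym[of i j] mult.commute)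
    fix v :: "nat \<Rightarrow> real" assume v: "\<exists>i<m. v i \<noteq> 0"
    define w where "w = (\<Sum>j<m. G m j * v j)"
    \<comment> \<open>The value of the last variable that minimizes the form when the others are
      fixed. Substituting it leaves the form of the Schur complement \<open>H\<close>.\<close>
    define x where "x = - w / a"
    define u where "u = v(m := x)"
    have "\<exists>i<Suc m. u i \<noteq> 0" using v by (auto simp: u_def)
    from pos[OF this] have "0 < (\<Sum>i<m. (\<Sum>j<m. u i * G i j * u j) + u i * G i m * u m)
        + ((\<Sum>j<m. u m * G m j * u j) + u m * G m m * u m)"
      by simp
    also have "\<dots> = (\<Sum>i<m. \<Sum>j<m. v i * G i j * v j) + (\<Sum>i<m. v i * G i m * x)
        + ((\<Sum>j<m. x * G m j * v j) + x * a * x)"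
      by (simp add: u_def a_def sum.distrib)
    also have "(\<Sum>i<m. v i * G i m * x) = w * x"
      unfolding w_def sum_distrib_right by (intro sum.cong refl) (simp add: sym[of m])
    also have "(\<Sum>j<m. x * G m j * v j) = x * w"
      unfolding w_def sum_distrib_left by (simp add: mult.assoc)
    also have "(\<Sum>i<m. \<Sum>j<m. v i * G i j * v j) + w * x + (x * w + x * a * x)
        = (\<Sum>i<m. \<Sum>j<m. v i * G i j * v j) - w * w / a"
      using \<open>0 < a\<close> by (simp add: x_def field_simps)
    also have "w * w = (\<Sum>i<m. \<Sum>j<m. v i * (G m i * G m j) * v j)"
      unfolding w_def sum_product by (intro sum.cong refl) (simp add: mult_ac)
    also have "(\<Sum>i<m. \<Sum>j<m. v i * G i j * v j) - \<dots> / a = (\<Sum>i<m. \<Sum>j<m. v i * H i j * v j)"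
      unfolding H_def
      by (simp add: sum_subtractf sum_divide_distrib algebra_simps)
    finally show "0 < (\<Sum>i<m. \<Sum>j<m. v i * H i j * v j)" .
  qed
  from Suc.IH[OF this] obtain R where R: "\<forall>k<m. 0 < R k k" "\<forall>k j. k < j \<longrightarrow> R k j = 0"
    "\<forall>i<m. \<forall>j<m. H i j = (\<Sum>k<m. R k i * R k j)" by blast
  \<comment> \<open>Row \<open>m\<close> is the linear form whose square was split off: the last row
    of \<open>G\<close> divided by \<open>sqrt a\<close>, with diagonal entry
    \<open>sqrt a\<close>.\<close>
  define R' where "R' = (\<lambda>k j. if k = m then (if j \<le> m then G m j / sqrt a else 0) else R k j)"
  have sq: "sqrt a * sqrt a = a" using \<open>0 < a\<close> by simp
  show ?case
  proof (intro exI[of _ R'] conjI allI impI)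
    show "0 < R' k k" if "k < Suc m" for k
      using that R(1) \<open>0 < a\<close> by (auto simp: R'_def a_def less_Suc_eq)
    show "R' k j = 0" if "k < j" for k j using that R(2) by (auto simp: R'_def)
    fix i j assume ij: "i < Suc m" "j < Suc m"
    have "(\<Sum>k<Suc m. R' k i * R' k j) = (\<Sum>k<m. R k i * R k j) + G m i * G m j / a"
      using ij \<open>0 < a\<close> by (simp add: R'_def sq)
    also have "\<dots> = G i j"
    proof (cases "i < m \<and> j < m")
      case True
      then have "(\<Sum>k<m. R k i * R k j) = H i j" using R(3) by simp
      then show ?thesis by (simp add: H_def)
    next
      case False
      with ij have "i = m \<or> j = m" by auto
      then have "(\<Sum>k<m. R k i * R k j) = 0" using R(2) by (intro sum.neutral) auto
      then show ?thesis using \<open>i = m \<or> j = m\<close> \<open>0 < a\<close> sym[of i m] by (auto simp: a_def)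
    qed
    finally show "G i j = (\<Sum>k<Suc m. R' k i * R' k j)" ..
  qed
qed

text \<open>Once the earlier coordinates are chosen, the linear form \<open>k\<close> moves in steps
  of \<open>R k k\<close> as coordinate \<open>k\<close> runs through the integers, so a half-open
  interval of length \<open>Q\<close> catches at least the integer part of \<open>Q / R k k\<close>
  values. Extensional functions ensure that distinct points differ in a coordinate below
  \<open>m\<close>.\<close>

lemma triangular_box_points:
  fixes R :: "nat \<Rightarrow> nat \<Rightarrow> real"
  assumes "\<And>k. k < m \<Longrightarrow> 0 < R k k"
  shows "\<exists>V. finite V \<and> V \<subseteq> {..<m} \<rightarrow>\<^sub>E (UNIV :: int set) \<and>
      (\<Prod>k<m. nat \<lfloor>Q / R k k\<rfloor>) \<le> card V \<and>
      (\<forall>v\<in>V. \<forall>k<m. (\<Sum>j\<le>k. R k j * of_int (v j)) \<in> {0..<Q})"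
  using assms
proof (induction m)
  case 0
  \<comment> \<open>With no coordinates there is one point, the extensional function that is
    \<open>undefined\<close> everywhere, matching the empty product.\<close>
  show ?case by (rule exI[of _ "{\<lambda>_. undefined}"]) simp
next
  case (Suc m)
  then obtain V where V: "finite V" "V \<subseteq> {..<m} \<rightarrow>\<^sub>E UNIV"
      "(\<Prod>k<m. nat \<lfloor>Q / R k k\<rfloor>) \<le> card V"
      "\<forall>v\<in>V. \<forall>k<m. (\<Sum>j\<le>k. R k j * of_int (v j)) \<in> {0..<Q}" by auto
  let ?F = "nat \<lfloor>Q / R m m\<rfloor>"
  define c where "c = (\<lambda>v::nat\<Rightarrow>int. \<Sum>j<m. R m j * of_int (v j))"
  \<comment> \<open>The ceiling is the least integer that makes the new linear form nonnegative;
    \<open>n\<close> counts further steps of length \<open>R m m\<close>.\<close>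
  define g where "g = (\<lambda>(v, n). v(m := int n + \<lceil>- c v / R m m\<rceil>))"
  have r: "0 < R m m" using Suc.prems by simp
  have "inj_on g (V \<times> {..<?F})"
  proof (rule inj_onI, clarsimp)
    fix u v n n' assume uv: "u \<in> V" "v \<in> V" and eq: "g (u, n) = g (v, n')"
    have "u i = v i" for i
    proof (cases "i < m")
      case True
      then show ?thesis using fun_cong[OF eq, of i] by (simp add: g_def)
    next
      case False
      moreover have "u \<in> {..<m} \<rightarrow>\<^sub>E UNIV" "v \<in> {..<m} \<rightarrow>\<^sub>E UNIV" using uv V(2) by auto
      ultimately show ?thesis by (metis PiE_arb lessThan_iff)
    qed
    then have "u = v" ..
    then show "u = v \<and> n = n'" using fun_cong[OF eq, of m] by (simp add: g_def)
  qed
  then have "card (g ` (V \<times> {..<?F})) = card V * ?F"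
    by (simp add: card_image card_cartesian_product)
  moreover have "(\<Sum>j\<le>k. R k j * of_int (w j)) \<in> {0..<Q}" if "w \<in> g ` (V \<times> {..<?F})" "k < Suc m" for w k
  proof -
    from that obtain v n where v: "v \<in> V" "n < ?F" and w: "w = v(m := int n + \<lceil>- c v / R m m\<rceil>)"
      by (auto simp: g_def)
    show ?thesis
    proof (cases "k = m")
      case False
      with that have "k < m" by simp
      then have "(\<Sum>j\<le>k. R k j * of_int (w j)) = (\<Sum>j\<le>k. R k j * of_int (v j))"
        by (intro sum.cong) (auto simp: w)
      then show ?thesis using V(4) v \<open>k < m\<close> by auto
    next
      case True
      define y where "y = \<lceil>- c v / R m m\<rceil>"
      have "- c v / R m m \<le> y" "y - 1 < - c v / R m m"
        using ceiling_correct[of "- c v / R m m"] by (auto simp: y_def)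
      then have "- c v \<le> y * R m m" "(y - 1) * R m m < - c v"
        using r by (simp_all only: pos_divide_le_eq pos_less_divide_eq)
      then have y: "- c v \<le> y * R m m" "y * R m m - R m m < - c v"
        by (simp_all add: left_diff_distrib)
      have "(\<Sum>j\<le>m. R m j * of_int (w j)) = c v + (n * R m m + y * R m m)"
        unfolding lessThan_Suc_atMost[symmetric] by (simp add: w c_def y_def algebra_simps)
      moreover have "real n + 1 \<le> Q / R m m"
      proof -
        have "int n + 1 \<le> \<lfloor>Q / R m m\<rfloor>" using v(2) by linarith
        then have "real_of_int (int n + 1) \<le> Q / R m m" by (simp only: le_floor_iff)
        then show ?thesis by simp
      qed
      then have "n * R m m + R m m \<le> Q" using r by (simp add: field_simps)
      moreover have "0 \<le> n * R m m" using r by simp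
      ultimately show ?thesis using y unfolding True atLeastLessThan_iff by linarith
    qed
  qed
  moreover have "g ` (V \<times> {..<?F}) \<subseteq> {..<Suc m} \<rightarrow>\<^sub>E UNIV"
  proof clarify
    fix v n assume "v \<in> V"
    then have "v \<in> {..<m} \<rightarrow>\<^sub>E UNIV" using V(2) by blast
    then show "g (v, n) \<in> {..<Suc m} \<rightarrow>\<^sub>E UNIV"
      unfolding g_def lessThan_Suc prod.case by (intro PiE_fun_upd UNIV_I)
  qed
  ultimately show ?case
    using V(1,3) by (intro exI[of _ "g ` (V \<times> {..<?F})"]) auto
qed

text \<open>A cube of side \<open>Q = N * s\<close> is cut into \<open>N ^ m\<close> cells of side
  \<open>s\<close>. The factor \<open>2 ^ m\<close> pays for rounding each \<open>Q / R k k\<close>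
  down, and the hypothesis then leaves more points than cells. Two points in one cell differ by the
  required vector.\<close>

lemma small_integer_point:
  fixes R :: "nat \<Rightarrow> nat \<Rightarrow> real"
  assumes pos: "\<And>k. k < m \<Longrightarrow> 0 < R k k" and "0 < s" and s: "2 ^ m * (\<Prod>k<m. R k k) < s ^ m"
  shows "\<exists>v :: nat \<Rightarrow> int. (\<exists>i<m. v i \<noteq> 0) \<and> (\<forall>k<m. \<bar>\<Sum>j\<le>k. R k j * of_int (v j)\<bar> < s)"
proof -
  \<comment> \<open>Large enough that \<open>Q\<close> is at least every diagonal entry, so the
    quotients are at least 1 and rounding down costs at most a factor 2; \<open>Suc\<close> keeps
    \<open>N\<close> positive.\<close>
  define N where "N = Suc (\<Sum>k<m. nat \<lceil>R k k / s\<rceil>)"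
  define Q where "Q = real N * s"
  have Q: "R k k \<le> Q" if "k < m" for k
  proof -
    have "nat \<lceil>R k k / s\<rceil> \<le> (\<Sum>k<m. nat \<lceil>R k k / s\<rceil>)"
      by (rule member_le_sum) (use that in auto)
    then have "real (nat \<lceil>R k k / s\<rceil>) \<le> real N" unfolding N_def by linarith
    then have "R k k / s \<le> real N" using real_nat_ceiling_ge[of "R k k / s"] by linarith
    then show ?thesis using \<open>0 < s\<close> by (simp add: Q_def field_simps)
  qed
  obtain V where V: "finite V" "V \<subseteq> {..<m} \<rightarrow>\<^sub>E (UNIV :: int set)"
      "(\<Prod>k<m. nat \<lfloor>Q / R k k\<rfloor>) \<le> card V"
      "\<forall>v\<in>V. \<forall>k<m. (\<Sum>j\<le>k. R k j * of_int (v j)) \<in> {0..<Q}"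
    using triangular_box_points[of m R Q] pos by blast
  let ?P = "\<Prod>k<m. R k k"
  have "?P > 0" using pos by (intro prod_pos) auto
  have "0 < N" by (simp add: N_def)
  then have "real (N ^ m) * (2 ^ m * ?P) < real (N ^ m) * s ^ m"
    using s by (intro mult_strict_left_mono) auto
  then have "real (N ^ m) < Q ^ m / (2 ^ m * ?P)"
    using \<open>?P > 0\<close> by (simp add: Q_def power_mult_distrib pos_less_divide_eq)
  also have "\<dots> = (\<Prod>k<m. Q / R k k / 2)"
    by (simp add: prod_dividef prod.distrib mult.commute)
  also have "\<dots> \<le> (\<Prod>k<m. real (nat \<lfloor>Q / R k k\<rfloor>))"
  proof (intro prod_mono conjI)
    fix k assume "k \<in> {..<m}"
    then have "1 \<le> Q / R k k" using Q[of k] pos[of k] by auto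
    moreover have "x / 2 \<le> real (nat \<lfloor>x\<rfloor>)" if "1 \<le> x" for x :: real
    proof -
      have "1 \<le> \<lfloor>x\<rfloor>" using that by simp
      then have "real (nat \<lfloor>x\<rfloor>) = \<lfloor>x\<rfloor>" "(1::real) \<le> \<lfloor>x\<rfloor>" by simp_all
      then show ?thesis using floor_correct[of x] by linarith
    qed
    ultimately show "Q / R k k / 2 \<le> real (nat \<lfloor>Q / R k k\<rfloor>)" by blast
    have "0 \<le> Q / R k k" using \<open>1 \<le> Q / R k k\<close> by (rule order_trans[rotated]) simp
    then show "0 \<le> Q / R k k / 2" by (rule divide_nonneg_nonneg) simp
  qed
  also have "\<dots> \<le> real (card V)" using V(3) by (simp flip: of_nat_prod)
  finally have "N ^ m < card V" by simp
  define box where "box = (\<lambda>v. \<lambda>k\<in>{..<m}. \<lfloor>(\<Sum>j\<le>k. R k j * of_int (v j)) / s\<rfloor>)"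
  have "box ` V \<subseteq> {..<m} \<rightarrow>\<^sub>E {0..<int N}"
  proof clarify
    fix v assume "v \<in> V"
    have "\<lfloor>(\<Sum>j\<le>k. R k j * of_int (v j)) / s\<rfloor> \<in> {0..<int N}" if "k < m" for k
    proof -
      let ?x = "\<Sum>j\<le>k. R k j * of_int (v j)"
      have "0 \<le> ?x" "?x < Q" using V(4) that \<open>v \<in> V\<close> by auto
      then have "0 \<le> ?x / s" "?x / s < of_int (int N)"
        using \<open>0 < s\<close> by (auto simp: Q_def field_simps)
      then show ?thesis by (simp add: floor_less_iff)
    qed
    then show "box v \<in> {..<m} \<rightarrow>\<^sub>E {0..<int N}" by (auto simp: box_def)
  qed
  then have "card (box ` V) \<le> card ({..<m} \<rightarrow>\<^sub>E {0..<int N})"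
    by (intro card_mono finite_PiE) auto
  also have "\<dots> = N ^ m" by (simp add: card_PiE)
  also note \<open>N ^ m < card V\<close>
  finally have "\<not> inj_on box V" by (rule pigeonhole)
  then obtain u v where uv: "u \<in> V" "v \<in> V" "u \<noteq> v" "box u = box v" by (auto simp: inj_on_def)
  show ?thesis
  proof (intro exI[of _ "\<lambda>i. u i - v i"] conjI allI impI)
    obtain i where "i < m" "u i \<noteq> v i"
      using PiE_ext[of u "{..<m}" _ v] uv V(2) by blast
    then show "\<exists>i<m. u i - v i \<noteq> 0" by auto
    fix k assume "k < m"
    then have "\<lfloor>(\<Sum>j\<le>k. R k j * of_int (u j)) / s\<rfloor> = \<lfloor>(\<Sum>j\<le>k. R k j * of_int (v j)) / s\<rfloor>"
      using fun_cong[OF uv(4), of k] by (simp add: box_def)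
    then have "\<bar>(\<Sum>j\<le>k. R k j * of_int (u j)) / s - (\<Sum>j\<le>k. R k j * of_int (v j)) / s\<bar> < 1"
      by linarith
    then have "\<bar>((\<Sum>j\<le>k. R k j * of_int (u j)) - (\<Sum>j\<le>k. R k j * of_int (v j))) / s\<bar> < 1"
      by (simp add: diff_divide_distrib)
    then have "\<bar>(\<Sum>j\<le>k. R k j * of_int (u j)) - (\<Sum>j\<le>k. R k j * of_int (v j))\<bar> < s"
      using \<open>0 < s\<close> by (simp add: abs_divide)
    then show "\<bar>\<Sum>j\<le>k. R k j * of_int (u j - v j)\<bar> < s"
      by (simp add: right_diff_distrib sum_subtractf)
  qed
qed

section \<open>Lattices given by matrices\<close>

lemma lattice_of_eq:
  assumes "M \<in> carrier_mat n m"
  shows "lattice_of M = {M *\<^sub>v Matrix.vec m (\<lambda>i. of_int (v i)) | v :: nat \<Rightarrow> int. True}"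
proof (intro equalityI subsetI)
  fix x assume "x \<in> lattice_of M"
  then obtain w where w: "x = M *\<^sub>v w" "w \<in> carrier_vec m" "\<forall>i<m. w $ i \<in> \<int>"
    using assms by (auto simp: lattice_of_def)
  then have "w = Matrix.vec m (\<lambda>i. of_int \<lfloor>w $ i\<rfloor>)"
    by (intro eq_vecI) (auto simp: of_int_floor_cancel)
  with w(1) have "x = M *\<^sub>v Matrix.vec m (\<lambda>i. of_int \<lfloor>w $ i\<rfloor>)" by simp
  then show "x \<in> {M *\<^sub>v Matrix.vec m (\<lambda>i. of_int (v i)) | v :: nat \<Rightarrow> int. True}"
    by (intro CollectI exI[of _ "\<lambda>i. \<lfloor>w $ i\<rfloor>"] conjI TrueI)
next
  fix x assume "x \<in> {M *\<^sub>v Matrix.vec m (\<lambda>i. of_int (v i)) | v :: nat \<Rightarrow> int. True}"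
  then show "x \<in> lattice_of M"
    using assms unfolding lattice_of_def by force
qed

lemma mult_mat_vec_norm:
  fixes M :: "real mat"
  assumes "M \<in> carrier_mat n m" "v \<in> carrier_vec m"
  shows "(M *\<^sub>v v) \<bullet> (M *\<^sub>v v) = (\<Sum>e<n. (\<Sum>j<m. M $$ (e, j) * v $ j)\<^sup>2)"
  using assms by (simp add: scalar_prod_def lessThan_atLeast0 power2_eq_square)

lemma det_gram_fdet:
  fixes M :: "real mat"
  assumes "M \<in> carrier_mat n m"
  shows "Determinant.det (transpose_mat M * M) = fdet m (\<lambda>i j. \<Sum>e<n. M $$ (e, i) * M $$ (e, j))"
proof -
  have "transpose_mat M * M = Matrix.mat m m (\<lambda>(i, j). \<Sum>e<n. M $$ (e, i) * M $$ (e, j))"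
    using assms by (intro eq_matI) (auto simp: scalar_prod_def lessThan_atLeast0)
  then show ?thesis by (simp add: fdet_def)
qed

lemma lattice_vector_neq_0:
  assumes M: "lattice_basis n m M" and v: "\<exists>i<m. v i \<noteq> (0::int)"
  shows "M *\<^sub>v Matrix.vec m (\<lambda>i. of_int (v i)) \<noteq> 0\<^sub>v n"
proof
  assume "M *\<^sub>v Matrix.vec m (\<lambda>i. of_int (v i)) = 0\<^sub>v n"
  with M have "Matrix.vec m (\<lambda>i. real_of_int (v i)) = 0\<^sub>v m" by (auto simp: lattice_basis_def)
  then have "real_of_int (v i) = 0" if "i < m" for i using that by (auto simp: vec_eq_iff)
  with v show False by auto
qed

lemma lattice_min_le:
  assumes "x \<in> L" "x \<noteq> 0\<^sub>v n"
  shows "lattice_min n L \<le> x \<bullet> x"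
  unfolding lattice_min_def
  by (rule cInf_lower)
    (use assms in \<open>auto intro!: bdd_belowI[of _ 0] sum_nonneg simp: scalar_prod_def\<close>)

text \<open>A vector whose \<open>m\<close> triangular forms all stay below \<open>s\<close> in
  absolute value has squared norm at most \<open>m\<close> times the square of \<open>s\<close>. The
  Gram determinant is \<open>P * P\<close>, so the square of \<open>s\<close> is 9 times its
  \<open>m\<close>-th root.\<close>

lemma lattice_min_bound:
  assumes M: "lattice_basis n m M" and m: "m \<ge> 1"
  shows "lattice_min n (lattice_of M) * Determinant.det (transpose_mat M * M) powr (- 1 / real m)
    \<le> 9 * real m"
proof -
  have Mc: "M \<in> carrier_mat n m" using M by (simp add: lattice_basis_def)
  define G where "G = (\<lambda>i j. \<Sum>e<n. M $$ (e, i) * M $$ (e, j))"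
  have form: "(\<Sum>i<m. \<Sum>j<m. v i * G i j * v j) = (\<Sum>e<n. (\<Sum>j<m. M $$ (e, j) * v j)\<^sup>2)" for v
    unfolding G_def by (rule gram_form)
  have "pos_def_form m G"
    unfolding pos_def_form_def
  proof (intro conjI allI impI)
    show "G i j = G j i" for i j by (simp add: G_def mult.commute)
    fix v :: "nat \<Rightarrow> real" assume v: "\<exists>i<m. v i \<noteq> 0"
    then have "Matrix.vec m v \<noteq> 0\<^sub>v m" by (auto simp: vec_eq_iff)
    with M have "M *\<^sub>v Matrix.vec m v \<noteq> 0\<^sub>v n" by (auto simp: lattice_basis_def)
    then obtain e where "e < n" "(\<Sum>j<m. M $$ (e, j) * v j) \<noteq> 0"
      using Mc by (auto simp: vec_eq_iff scalar_prod_def lessThan_atLeast0)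
    then show "0 < (\<Sum>i<m. \<Sum>j<m. v i * G i j * v j)"
      unfolding form by (intro sum_pos2[of _ e]) auto
  qed
  from cholesky[OF this] obtain R where "\<forall>k<m. 0 < R k k" "\<forall>k j. k < j \<longrightarrow> R k j = 0"
    "\<forall>i<m. \<forall>j<m. G i j = (\<Sum>k<m. R k i * R k j)" by (elim exE conjE)
  then have R: "\<And>k. k < m \<Longrightarrow> 0 < R k k" "\<And>j k. k < j \<Longrightarrow> R k j = 0"
    "\<And>i j. i < m \<Longrightarrow> j < m \<Longrightarrow> G i j = (\<Sum>k<m. R k i * R k j)" by simp_all
  define P where "P = (\<Prod>k<m. R k k)"
  have "P > 0" unfolding P_def using R(1) by (intro prod_pos) auto
  have "fdet m (\<lambda>i j. R j i) = P"
    unfolding P_def by (rule fdet_upper_triangular) (simp add: R)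
  then have "fdet m R = P" using fdet_transpose[of m R] by simp
  have "fdet m G = fdet m (\<lambda>i j. \<Sum>k<m. R k i * R k j)" by (rule fdet_cong) (simp add: R)
  also have "\<dots> = P * P"
    using fdet_mult[of m "\<lambda>i k. R k i" R] \<open>fdet m R = P\<close> \<open>fdet m (\<lambda>i j. R j i) = P\<close> by simp
  finally have det: "Determinant.det (transpose_mat M * M) = P * P"
    using det_gram_fdet[OF Mc] by (simp add: G_def)
  \<comment> \<open>Any factor greater than 2 satisfies the strict inequality of the pigeonhole
    argument; the choice 3 is the source of the 9.\<close>
  define s where "s = 3 * P powr (1 / m)"
  have "s > 0" using \<open>P > 0\<close> by (simp add: s_def)
  have "(P powr (1 / m)) ^ m = P"
    using \<open>P > 0\<close> m by (simp add: powr_powr flip: powr_realpow)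
  then have "s ^ m = 3 ^ m * P" by (simp add: s_def power_mult_distrib)
  moreover have "(2::real) ^ m < 3 ^ m" using m by (intro power_strict_mono) auto
  ultimately have "2 ^ m * (\<Prod>k<m. R k k) < s ^ m" using \<open>P > 0\<close> by (simp add: P_def)
  with R(1) \<open>s > 0\<close> have "\<exists>v :: nat \<Rightarrow> int. (\<exists>i<m. v i \<noteq> 0) \<and>
      (\<forall>k<m. \<bar>\<Sum>j\<le>k. R k j * of_int (v j)\<bar> < s)"
    by (rule small_integer_point)
  then obtain v :: "nat \<Rightarrow> int" where
    "(\<exists>i<m. v i \<noteq> 0) \<and> (\<forall>k<m. \<bar>\<Sum>j\<le>k. R k j * of_int (v j)\<bar> < s)" ..
  then have v: "\<exists>i<m. v i \<noteq> 0" "\<forall>k<m. \<bar>\<Sum>j\<le>k. R k j * of_int (v j)\<bar> < s" by simp_all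
  define x where "x = M *\<^sub>v Matrix.vec m (\<lambda>i. of_int (v i))"
  have "lattice_min n (lattice_of M) \<le> x \<bullet> x"
    by (rule lattice_min_le)
      (use lattice_vector_neq_0[OF M v(1)] in \<open>auto simp: x_def lattice_of_eq[OF Mc]\<close>)
  also have "x \<bullet> x = (\<Sum>i<m. \<Sum>j<m. of_int (v i) * G i j * of_int (v j))"
    unfolding form x_def by (subst mult_mat_vec_norm[OF Mc]) auto
  also have "\<dots> = (\<Sum>i<m. \<Sum>j<m. of_int (v i) * (\<Sum>k<m. R k i * R k j) * of_int (v j))"
    by (simp add: R(3))
  also have "\<dots> = (\<Sum>k<m. (\<Sum>j<m. R k j * of_int (v j))\<^sup>2)"
    by (rule gram_form)
  also have "\<dots> \<le> (\<Sum>k<m. s\<^sup>2)"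
  proof (rule sum_mono)
    fix k assume "k \<in> {..<m}"
    then have "(\<Sum>j<m. R k j * of_int (v j)) = (\<Sum>j\<le>k. R k j * of_int (v j))"
      by (intro sum.mono_neutral_right) (auto simp: R(2))
    moreover have "\<bar>\<Sum>j\<le>k. R k j * of_int (v j)\<bar> < s" using v(2) \<open>k \<in> {..<m}\<close> by simp
    ultimately have "\<bar>\<Sum>j<m. R k j * of_int (v j)\<bar> \<le> \<bar>s\<bar>" by linarith
    then show "(\<Sum>j<m. R k j * of_int (v j))\<^sup>2 \<le> s\<^sup>2"
      by (simp only: abs_le_square_iff)
  qed
  finally have "lattice_min n (lattice_of M) \<le> m * s\<^sup>2" by simp
  then have "lattice_min n (lattice_of M) * (P * P) powr (- 1 / m) \<le> m * s\<^sup>2 * (P * P) powr (- 1 / m)"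
    by (rule mult_right_mono) simp
  also have "s\<^sup>2 = 9 * (P * P) powr (1 / m)"
    using \<open>P > 0\<close> by (simp add: s_def power2_eq_square powr_mult)
  also have "m * (9 * (P * P) powr (1 / m)) * (P * P) powr (- 1 / m)
      = 9 * m * ((P * P) powr (1 / m) * (P * P) powr (- 1 / m))" by (simp only: mult_ac)
  also have "(P * P) powr (1 / m) * (P * P) powr (- 1 / m) = 1"
    using \<open>P > 0\<close> by (simp flip: powr_add)
  finally show ?thesis by (simp add: det)
qed

lemma le_hermite_constant:
  assumes "lattice_basis n m M" "m \<ge> 1"
  shows "lattice_min n (lattice_of M) * Determinant.det (transpose_mat M * M) powr (- 1 / real m)
    \<le> hermite_constant m"
  unfolding hermite_constant_def
proof (rule cSup_upper)
  show "bdd_above {lattice_min n (lattice_of M) *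
      Determinant.det (transpose_mat M * M) powr (- 1 / real m) | n M. lattice_basis n m M}"
    using lattice_min_bound[OF _ assms(2)] by (intro bdd_aboveI[of _ "9 * real m"]) auto
qed (rule CollectI, rule exI[of _ n], rule exI[of _ M], intro conjI refl assms(1))

section \<open>Integral lattices and their Gram determinants\<close>

text \<open>The frame common to both inequalities. The coordinates of a lattice vector are integers,
  so the squared norm is at least the size of the support. \<open>BB\<close> is abstract because it
  holds bases for the cut lattice but complements of bases for the flow lattice.\<close>

lemma hermite_lower_bound:
  fixes N :: "'x \<Rightarrow> nat \<Rightarrow> int" and t :: "'x set \<Rightarrow> nat"
  assumes finE: "finite E" and m: "m \<ge> 1" and finBB: "finite BB"
    and inj: "\<And>v i. i < m \<Longrightarrow> v i \<noteq> 0 \<Longrightarrow> \<exists>e\<in>E. (\<Sum>j<m. N e j * v j) \<noteq> 0"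
    and supp: "\<And>v i. i < m \<Longrightarrow> v i \<noteq> 0 \<Longrightarrow> k \<le> card {e\<in>E. (\<Sum>j<m. N e j * v j) \<noteq> 0}"
    and bound: "\<And>f. f \<in> {..<m} \<rightarrow>\<^sub>E E \<Longrightarrow> fdet m (\<lambda>i. N (f i)) \<noteq> 0 \<Longrightarrow> inj_on f {..<m} \<Longrightarrow>
       f ` {..<m} \<in> BB \<and> \<bar>fdet m (\<lambda>i. N (f i))\<bar> \<le> int (t (f ` {..<m}))"
  shows "real k * real (\<Sum>B\<in>BB. (t B)\<^sup>2) powr (- 1 / real m) \<le> hermite_constant m"
proof -
  let ?n = "card E" and ?T = "\<Sum>B\<in>BB. (t B)\<^sup>2"
  obtain h where h: "bij_betw h {..<?n} E"
    using ex_bij_betw_nat_finite[OF finE] by (auto simp: lessThan_atLeast0)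
  have reindex: "(\<Sum>e<?n. F (h e)) = (\<Sum>e\<in>E. F e)" for F :: "'x \<Rightarrow> real"
    by (rule sum.reindex_bij_betw[OF h])
  define M where "M = Matrix.mat ?n m (\<lambda>(e, j). real_of_int (N (h e) j))"
  have Mc: "M \<in> carrier_mat ?n m" by (simp add: M_def)
  define D where "D = fdet m (\<lambda>i j. \<Sum>e\<in>E. N e i * N e j)"
  have "D \<noteq> 0"
    unfolding D_def gram_det_eq_0_iff[OF finE] using inj by blast
  have "int (fact m) * D = (\<Sum>f \<in> {..<m} \<rightarrow>\<^sub>E E. (fdet m (\<lambda>i. N (f i)))\<^sup>2)"
    unfolding D_def by (rule cauchy_binet_symmetric[OF finE])
  moreover have "\<dots> \<le> fact m * (\<Sum>B\<in>BB. (int (t B))\<^sup>2)"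
  proof (rule sum_sq_minors_le[OF finE finBB])
    fix f assume f: "f \<in> {..<m} \<rightarrow>\<^sub>E E" "fdet m (\<lambda>i. N (f i)) \<noteq> 0"
    have "inj_on f {..<m}" using f(2) by (rule fdet_rows_inj)
    with bound[OF f] show "inj_on f {..<m} \<and> f ` {..<m} \<in> BB \<and>
        \<bar>fdet m (\<lambda>i. N (f i))\<bar> \<le> int (t (f ` {..<m}))" by simp
  qed
  moreover have "0 \<le> (\<Sum>f \<in> {..<m} \<rightarrow>\<^sub>E E. (fdet m (\<lambda>i. N (f i)))\<^sup>2)"
    by (intro sum_nonneg) simp
  ultimately have "0 \<le> int (fact m) * D" "int (fact m) * D \<le> int (fact m) * int ?T"
    by simp_all
  moreover have "0 < int (fact m)" by simp
  \<comment> \<open>The factor \<open>m!\<close> cancels. As a sum of squares up to this factor,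
    \<open>D\<close> is nonnegative; being nonzero, it is positive, as the power estimate below
    demands.\<close>
  ultimately have "0 \<le> D" "D \<le> int ?T"
    by (simp_all only: zero_le_mult_iff mult_le_cancel_left_pos) (auto simp: not_le[symmetric])
  with \<open>D \<noteq> 0\<close> have "0 < D" by simp
  have det: "Determinant.det (transpose_mat M * M) = real_of_int D"
  proof -
    have "Determinant.det (transpose_mat M * M)
        = fdet m (\<lambda>i j. \<Sum>e<?n. real_of_int (N (h e) i) * real_of_int (N (h e) j))"
      unfolding det_gram_fdet[OF Mc] by (rule fdet_cong) (simp add: M_def)
    also have "\<dots> = real_of_int D"
      unfolding D_def of_int_fdet by (rule fdet_cong) (simp add: reindex[of "\<lambda>e. real_of_int (N e i) * real_of_int (N e j)" for i j])
    finally show ?thesis .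
  qed
  have basis: "lattice_basis ?n m M"
    unfolding lattice_basis_def
  proof (intro conjI ballI impI Mc)
    fix v assume v: "v \<in> carrier_vec m" "M *\<^sub>v v = 0\<^sub>v ?n"
    have zero: "(\<Sum>j<m. real_of_int (N e j) * v $ j) = 0" if "e \<in> E" for e
    proof -
      from that have "e \<in> h ` {..<?n}" by (simp only: bij_betw_imp_surj_on[OF h])
      then obtain i where "i < ?n" "e = h i" by auto
      moreover have "(M *\<^sub>v v) $ i = 0" using v \<open>i < ?n\<close> by simp
      ultimately show ?thesis using v(1) by (simp add: M_def scalar_prod_def lessThan_atLeast0)
    qed
    \<comment> \<open>Injectivity is given on integer vectors, whereas a lattice basis must be
      independent over the reals.\<close>
    have "\<not> (\<exists>v::nat\<Rightarrow>real. (\<exists>i<m. v i \<noteq> 0) \<and>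
        (\<forall>e\<in>E. (\<Sum>j<m. real_of_int (N e j) * v j) = 0))"
      unfolding gram_det_real[OF finE] using inj by blast
    from this[unfolded not_ex, rule_format, of "\<lambda>j. v $ j"] zero
    have "\<forall>i<m. v $ i = 0" by simp
    with v(1) show "v = 0\<^sub>v m" by (intro eq_vecI) auto
  qed
  have "real k \<le> lattice_min ?n (lattice_of M)"
    unfolding lattice_min_def
  proof (rule cInf_greatest)
    \<comment> \<open>The infimum must be over a nonempty set; since \<open>m\<close> is positive,
      the all-ones coefficients give a nonzero lattice vector.\<close>
    let ?x = "M *\<^sub>v Matrix.vec m (\<lambda>i. of_int 1)"
    have "?x \<in> lattice_of M" unfolding lattice_of_eq[OF Mc] by (intro CollectI exI[of _ "\<lambda>_. 1"] conjI refl TrueI)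
    moreover have "?x \<noteq> 0\<^sub>v ?n"
      by (rule lattice_vector_neq_0[OF basis]) (use m in \<open>auto intro!: exI[of _ 0]\<close>)
    ultimately show "(\<lambda>x. x \<bullet> x) ` (lattice_of M - {0\<^sub>v ?n}) \<noteq> {}" by blast
    fix y assume "y \<in> (\<lambda>x. x \<bullet> x) ` (lattice_of M - {0\<^sub>v ?n})"
    then obtain x where x: "y = x \<bullet> x" "x \<in> lattice_of M" "x \<noteq> 0\<^sub>v ?n" by blast
    from x(2) obtain v :: "nat \<Rightarrow> int" where xv: "x = M *\<^sub>v Matrix.vec m (\<lambda>i. of_int (v i))"
      by (auto simp: lattice_of_eq[OF Mc])
    note v = x(1)[unfolded xv] x(3)[unfolded xv]
    have "\<exists>i<m. v i \<noteq> 0"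
    proof (rule ccontr)
      assume "\<not> ?thesis"
      then have "Matrix.vec m (\<lambda>i. real_of_int (v i)) = 0\<^sub>v m" by (intro eq_vecI) auto
      with v(2) Mc show False by auto
    qed
    then obtain i where "i < m" "v i \<noteq> 0" by blast
    let ?c = "\<lambda>e. \<Sum>j<m. N e j * v j"
    have "y = (\<Sum>e<?n. (\<Sum>j<m. M $$ (e, j) * Matrix.vec m (\<lambda>i. of_int (v i)) $ j)\<^sup>2)"
      unfolding v(1) by (rule mult_mat_vec_norm[OF Mc]) simp
    also have "\<dots> = (\<Sum>e<?n. real_of_int ((?c (h e))\<^sup>2))"
      by (intro sum.cong refl) (simp add: M_def)
    also have "\<dots> = (\<Sum>e\<in>E. real_of_int ((?c e)\<^sup>2))" by (rule reindex)
    finally have y: "y = (\<Sum>e\<in>E. real_of_int ((?c e)\<^sup>2))" .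
    have "real k \<le> real (card {e\<in>E. ?c e \<noteq> 0})" using supp[of i v] \<open>i < m\<close> \<open>v i \<noteq> 0\<close> by simp
    also have "\<dots> = (\<Sum>e\<in>E. if ?c e \<noteq> 0 then 1 else 0)"
      using finE by (simp add: sum.If_cases Int_def)
    also have "\<dots> \<le> y"
      unfolding y
    proof (rule sum_mono)
      fix e
      have "1 \<le> (?c e)\<^sup>2" if "?c e \<noteq> 0"
        using that zero_less_power2[of "?c e"] by linarith
      then have "1 \<le> real_of_int ((?c e)\<^sup>2)" if "?c e \<noteq> 0" using that by linarith
      then show "(if ?c e \<noteq> 0 then 1 else 0) \<le> real_of_int ((?c e)\<^sup>2)" by simp
    qed
    finally show "real k \<le> y" .
  qed
  moreover have "real ?T powr (- 1 / m) \<le> real_of_int D powr (- 1 / m)"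
  proof (rule powr_mono2')
    show "real_of_int D \<le> real ?T" using \<open>D \<le> int ?T\<close> by linarith
  qed (use \<open>0 < D\<close> in auto)
  ultimately have "real k * real ?T powr (- 1 / m)
      \<le> lattice_min ?n (lattice_of M) * real_of_int D powr (- 1 / m)"
    by (intro mult_mono) auto
  also have "\<dots> \<le> hermite_constant m"
    using le_hermite_constant[OF basis m] by (simp only: det)
  finally show ?thesis .
qed

section \<open>Integral combinations of chains and matroids\<close>

text \<open>Coefficients are attached to indices rather than to chains, so facets with equal
  boundaries remain different elements.\<close>

definition fcomb :: "'i set \<Rightarrow> ('i \<Rightarrow> ('y \<Rightarrow>\<^sub>0 int)) \<Rightarrow> ('i \<Rightarrow> int) \<Rightarrow> ('y \<Rightarrow>\<^sub>0 int)" where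
  "fcomb A g c = (\<Sum>i\<in>A. frag_cmul (c i) (g i))"

definition zindep :: "'i set \<Rightarrow> ('i \<Rightarrow> ('y \<Rightarrow>\<^sub>0 int)) \<Rightarrow> bool" where
  "zindep A g \<longleftrightarrow> (\<forall>c. fcomb A g c = 0 \<longrightarrow> (\<forall>i\<in>A. c i = 0))"

lemma zindepD: "zindep A g \<Longrightarrow> fcomb A g c = 0 \<Longrightarrow> i \<in> A \<Longrightarrow> c i = 0"
  by (simp add: zindep_def)

lemma lookup_fcomb: "poly_mapping.lookup (fcomb A g c) y = (\<Sum>i\<in>A. c i * poly_mapping.lookup (g i) y)"
  by (simp add: fcomb_def lookup_sum)

lemma fcomb_cong:
  "(\<And>i. i \<in> A \<Longrightarrow> c i = c' i) \<Longrightarrow> (\<And>i. i \<in> A \<Longrightarrow> g i = g' i) \<Longrightarrow> fcomb A g c = fcomb A g' c'"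
  unfolding fcomb_def by (rule sum.cong) auto

lemma fcomb_zero [simp]: "fcomb A g (\<lambda>_. 0) = 0"
  by (simp add: fcomb_def)

lemma fcomb_diff: "fcomb A g (\<lambda>i. c i - c' i) = fcomb A g c - fcomb A g c'"
  by (simp add: fcomb_def frag_cmul_diff_distrib sum_subtractf)

lemma fcomb_add: "fcomb A g (\<lambda>i. c i + c' i) = fcomb A g c + fcomb A g c'"
  by (simp add: fcomb_def frag_cmul_distrib sum.distrib)

lemma fcomb_uminus: "fcomb A g (\<lambda>i. - c i) = - fcomb A g c"
  by (simp add: fcomb_def sum_negf flip: minus_frag_cmul)

lemma fcomb_cmul: "fcomb A g (\<lambda>i. n * c i) = frag_cmul n (fcomb A g c)"
  by (simp add: fcomb_def frag_cmul_sum)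

lemma fcomb_fcomb:
  "fcomb A (\<lambda>i. fcomb B p (N i)) c = fcomb B p (\<lambda>j. \<Sum>i\<in>A. c i * N i j)"
proof (rule poly_mapping_eqI)
  fix y
  have "poly_mapping.lookup (fcomb A (\<lambda>i. fcomb B p (N i)) c) y
      = (\<Sum>i\<in>A. \<Sum>j\<in>B. c i * N i j * poly_mapping.lookup (p j) y)"
    by (simp add: lookup_fcomb sum_distrib_left mult.assoc)
  also have "\<dots> = (\<Sum>j\<in>B. \<Sum>i\<in>A. c i * N i j * poly_mapping.lookup (p j) y)" by (rule sum.swap)
  finally show "poly_mapping.lookup (fcomb A (\<lambda>i. fcomb B p (N i)) c) y
      = poly_mapping.lookup (fcomb B p (\<lambda>j. \<Sum>i\<in>A. c i * N i j)) y"
    by (simp add: lookup_fcomb sum_distrib_right)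
qed

lemma fcomb_mono_neutral:
  assumes "finite B" "A \<subseteq> B" "\<And>i. i \<in> B - A \<Longrightarrow> c i = 0"
  shows "fcomb B g c = fcomb A g c"
  unfolding fcomb_def by (rule sum.mono_neutral_right) (use assms in auto)

lemma fcomb_restrict:
  assumes "finite B" "A \<subseteq> B"
  shows "fcomb B g (\<lambda>i. if i \<in> A then c i else 0) = fcomb A g c"
proof -
  have "fcomb B g (\<lambda>i. if i \<in> A then c i else 0) = fcomb A g (\<lambda>i. if i \<in> A then c i else 0)"
    by (rule fcomb_mono_neutral) (use assms in auto)
  also have "\<dots> = fcomb A g c" by (rule fcomb_cong) auto
  finally show ?thesis .
qed

lemma fcomb_single:
  assumes "finite A" "i \<in> A"
  shows "fcomb A g (\<lambda>j. if j = i then n else 0) = frag_cmul n (g i)"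
proof -
  have "fcomb A g (\<lambda>j. if j = i then n else 0) = fcomb {i} g (\<lambda>j. if j = i then n else 0)"
    by (rule fcomb_mono_neutral) (use assms in auto)
  then show ?thesis by (simp add: fcomb_def)
qed

lemma fcomb_image:
  assumes "inj_on f A"
  shows "fcomb (f ` A) g c = fcomb A (\<lambda>i. g (f i)) (\<lambda>i. c (f i))"
  unfolding fcomb_def by (simp add: sum.reindex[OF assms])

lemma keys_fcomb: "(\<And>i. i \<in> A \<Longrightarrow> Poly_Mapping.keys (g i) \<subseteq> F) \<Longrightarrow> Poly_Mapping.keys (fcomb A g c) \<subseteq> F"
  unfolding fcomb_def by (rule order_trans[OF keys_sum]) auto

lemma zindep_eqD:
  assumes "zindep A g" "fcomb A g c = fcomb A g c'" "i \<in> A"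
  shows "c i = c' i"
  using zindepD[OF assms(1), of "\<lambda>i. c i - c' i"] assms(2,3) by (simp add: fcomb_diff)

text \<open>A subgroup of a finitely generated free abelian group is free. Splitting off one
  coordinate leaves the subgroup on which it vanishes, together with the multiples of an element
  whose value there is the least positive one.\<close>

lemma subgroup_basis:
  fixes H :: "('y \<Rightarrow>\<^sub>0 int) set"
  assumes "finite F" "\<And>h. h \<in> H \<Longrightarrow> Poly_Mapping.keys h \<subseteq> F"
    and "0 \<in> H" "\<And>x y. x \<in> H \<Longrightarrow> y \<in> H \<Longrightarrow> x - y \<in> H"
  shows "\<exists>(m::nat) p. p ` {..<m} \<subseteq> H \<and> zindep {..<m} p \<and> (\<forall>h\<in>H. \<exists>v. h = fcomb {..<m} p v)"
  using assms
proof (induction F arbitrary: H rule: finite_induct)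
  case empty
  then have "h = 0" if "h \<in> H" for h using that by (metis keys_eq_empty subset_empty)
  then show ?case
    by (intro exI[of _ 0] exI[of _ "\<lambda>_. 0"]) (auto simp: zindep_def fcomb_def)
next
  case (insert x F)
  note sub = insert.prems(3)
  have neg: "- h \<in> H" if "h \<in> H" for h using sub[OF insert.prems(2) that] by simp
  have add: "h + h' \<in> H" if "h \<in> H" "h' \<in> H" for h h' using sub[OF that(1) neg[OF that(2)]] by simp
  have cmul: "frag_cmul k h \<in> H" if "h \<in> H" for k h
  proof (rule frag_closure_minus_cmul[of "\<lambda>h. h \<in> H"])
  qed (use that sub insert.prems(2) in auto)
  define H' where "H' = {h \<in> H. poly_mapping.lookup h x = 0}"
  have "\<exists>(m::nat) p. p ` {..<m} \<subseteq> H' \<and> zindep {..<m} p \<and> (\<forall>h\<in>H'. \<exists>v. h = fcomb {..<m} p v)"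
  proof (rule insert.IH)
    show "Poly_Mapping.keys h \<subseteq> F" if "h \<in> H'" for h
    proof -
      have "x \<notin> Poly_Mapping.keys h" using that by (simp add: H'_def in_keys_iff)
      then show ?thesis using insert.prems(1)[of h] that by (auto simp: H'_def)
    qed
  qed (use insert.prems in \<open>auto simp: H'_def lookup_minus\<close>)
  then obtain m :: nat and p where p: "p ` {..<m} \<subseteq> H'" "zindep {..<m} p"
    "\<forall>h\<in>H'. \<exists>v. h = fcomb {..<m} p v" by blast
  have pH: "p i \<in> H" "poly_mapping.lookup (p i) x = 0" if "i < m" for i
    using p(1) that by (auto simp: H'_def image_subset_iff)
  show ?case
  proof (cases "H' = H")
    case True
    with p show ?thesis by (intro exI[of _ m] exI[of _ p]) simp
  next
    case False
    define P where "P = (\<lambda>n. 0 < n \<and> (\<exists>h\<in>H. poly_mapping.lookup h x = int n))"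
    from False obtain h where h: "h \<in> H" "poly_mapping.lookup h x \<noteq> 0" by (auto simp: H'_def)
    have "P (nat \<bar>poly_mapping.lookup h x\<bar>)"
    proof (cases "0 < poly_mapping.lookup h x")
      case True
      with h show ?thesis unfolding P_def by (intro conjI bexI[of _ h]) auto
    next
      case False
      with h neg[OF h(1)] show ?thesis unfolding P_def by (intro conjI bexI[of _ "- h"]) auto
    qed
    define t where "t = (LEAST n. P n)"
    have "P t" unfolding t_def by (rule LeastI) fact
    then obtain h0 where h0: "0 < t" "h0 \<in> H" "poly_mapping.lookup h0 x = int t"
      by (auto simp: P_def)
    \<comment> \<open>Division with remainder: a nonzero remainder would be a positive value smaller
      than \<open>t\<close>.\<close>
    have red: "h - frag_cmul (poly_mapping.lookup h x div int t) h0 \<in> H'" if "h \<in> H" for h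
    proof -
      let ?r = "h - frag_cmul (poly_mapping.lookup h x div int t) h0"
      have "?r \<in> H" by (intro sub that cmul h0(2))
      have l: "poly_mapping.lookup ?r x = poly_mapping.lookup h x mod int t"
        by (simp add: lookup_minus h0(3) minus_div_mult_eq_mod)
      have "poly_mapping.lookup ?r x = 0"
      proof (rule ccontr)
        assume nz: "poly_mapping.lookup ?r x \<noteq> 0"
        have "0 \<le> poly_mapping.lookup ?r x" "poly_mapping.lookup ?r x < int t"
          unfolding l using h0(1) by simp_all
        with nz have "P (nat (poly_mapping.lookup ?r x))"
          unfolding P_def using \<open>?r \<in> H\<close> by (intro conjI bexI[of _ ?r]) auto
        then have "t \<le> nat (poly_mapping.lookup ?r x)" unfolding t_def by (rule Least_le)
        with \<open>poly_mapping.lookup ?r x < int t\<close> \<open>0 \<le> poly_mapping.lookup ?r x\<close>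
        show False by linarith
      qed
      with \<open>?r \<in> H\<close> show ?thesis by (simp add: H'_def)
    qed
    define p' where "p' = p(m := h0)"
    have p'_comb: "fcomb {..<Suc m} p' v = frag_cmul (v m) h0 + fcomb {..<m} p v" for v
      by (simp add: fcomb_def p'_def lessThan_Suc)
    show ?thesis
    proof (intro exI[of _ "Suc m"] exI[of _ p'] conjI ballI)
      show "p' ` {..<Suc m} \<subseteq> H" using pH(1) h0(2) by (auto simp: p'_def less_Suc_eq)
      show "zindep {..<Suc m} p'"
        unfolding zindep_def
      proof (intro allI impI ballI)
        fix c i assume c: "fcomb {..<Suc m} p' c = 0" and i: "i \<in> {..<Suc m}"
        have "poly_mapping.lookup (fcomb {..<m} p c) x = 0"
          unfolding lookup_fcomb using pH(2) by (intro sum.neutral) auto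
        moreover have "poly_mapping.lookup (fcomb {..<Suc m} p' c) x = 0" by (simp add: c)
        ultimately have "c m * int t = 0" by (simp add: p'_comb lookup_add h0(3))
        with h0(1) have "c m = 0" by simp
        with c have "fcomb {..<m} p c = 0" by (simp add: p'_comb)
        then show "c i = 0" using zindepD[OF p(2)] i \<open>c m = 0\<close> by (auto simp: less_Suc_eq)
      qed
      fix h assume "h \<in> H"
      let ?q = "poly_mapping.lookup h x div int t"
      from p(3) red[OF \<open>h \<in> H\<close>] obtain v where v: "h - frag_cmul ?q h0 = fcomb {..<m} p v" by blast
      have "fcomb {..<m} p (v(m := ?q)) = fcomb {..<m} p v" by (rule fcomb_cong) auto
      then have "h = fcomb {..<Suc m} p' (v(m := ?q))"
        by (simp add: p'_comb flip: v)
      then show "\<exists>v. h = fcomb {..<Suc m} p' v" by (rule exI[of _ "v(m := ?q)"])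
    qed
  qed
qed

section \<open>The matroid of a family of chains\<close>

definition frag_indeps :: "'x set \<Rightarrow> ('x \<Rightarrow> ('y \<Rightarrow>\<^sub>0 int)) \<Rightarrow> 'x set set" where
  "frag_indeps E g = {A. A \<subseteq> E \<and> zindep A g}"

text \<open>By maximality, adding \<open>e\<close> to the basis creates a relation, and independence
  of the basis forces a nonzero coefficient at \<open>e\<close>. Over the integers it cannot be
  divided out, hence the multiplier \<open>n\<close>.\<close>

lemma matroid_basis_spans:
  assumes "finite E" "B \<in> matroid_bases (frag_indeps E g)" "e \<in> E"
  shows "\<exists>n c. n \<noteq> 0 \<and> frag_cmul n (g e) = fcomb B g c"
proof -
  have B: "B \<subseteq> E" "zindep B g" and max: "\<And>A. A \<in> frag_indeps E g \<Longrightarrow> B \<subseteq> A \<Longrightarrow> A = B"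
    using assms(2) by (auto simp: matroid_bases_def frag_indeps_def)
  have "finite B" using B(1) assms(1) finite_subset by blast
  show ?thesis
  proof (cases "e \<in> B")
    case True
    have "fcomb B g (\<lambda>j. if j = e then 1 else 0) = frag_cmul 1 (g e)"
      by (rule fcomb_single) fact+
    then show ?thesis by (intro exI[of _ 1] exI[of _ "\<lambda>j. if j = e then 1 else 0"]) simp
  next
    case False
    then have "insert e B \<notin> frag_indeps E g" using max[of "insert e B"] by auto
    then have "\<not> zindep (insert e B) g" using assms(3) B(1) by (auto simp: frag_indeps_def)
    then obtain c i where c: "fcomb (insert e B) g c = 0" "i \<in> insert e B" "c i \<noteq> 0"
      unfolding zindep_def by blast
    have split: "frag_cmul (c e) (g e) + fcomb B g c = 0"
      using c(1) False \<open>finite B\<close> by (simp add: fcomb_def)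
    have "c e \<noteq> 0"
    proof
      assume "c e = 0"
      with split have "fcomb B g c = 0" by simp
      with zindepD[OF B(2)] have "\<forall>i\<in>B. c i = 0" by blast
      with \<open>c e = 0\<close> c(2,3) show False by auto
    qed
    moreover have "frag_cmul (c e) (g e) = fcomb B g (\<lambda>i. - c i)"
      using split by (simp add: fcomb_uminus eq_neg_iff_add_eq_0)
    ultimately show ?thesis by blast
  qed
qed

text \<open>A minimal dependent subset of \<open>W\<close> is a circuit, so the minimum is over a
  nonempty finite set. The family \<open>J\<close> is the matroid itself for the girth and its dual
  for the connectivity.\<close>

lemma circuit_card_le:
  assumes "finite E" "W \<subseteq> E" "W \<notin> J"
  shows "Min (card ` circuits E J) \<le> card W"
proof -
  let ?D = "{C. C \<subseteq> W \<and> C \<notin> J}"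
  have "finite W" using assms finite_subset by blast
  then have "finite ?D" by simp
  moreover have "W \<in> ?D" using assms by simp
  ultimately obtain C where C: "C \<in> ?D" "\<forall>D\<in>?D. D \<le> C \<longrightarrow> C = D"
    using finite_has_minimal2[of ?D W] by blast
  then have "C \<in> circuits E J" using assms(2) unfolding circuits_def by blast
  moreover have "finite (circuits E J)"
    by (rule finite_subset[of _ "Pow E"]) (use assms(1) in \<open>auto simp: circuits_def\<close>)
  ultimately have "Min (card ` circuits E J) \<le> card C" by (intro Min_le) auto
  also have "\<dots> \<le> card W" using C(1) \<open>finite W\<close> by (intro card_mono) auto
  finally show ?thesis .
qed

lemma fcomb_closed:
  assumes "0 \<in> H" "\<And>x y. x \<in> H \<Longrightarrow> y \<in> H \<Longrightarrow> x - y \<in> H"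
    and "finite A" "\<And>i. i \<in> A \<Longrightarrow> q i \<in> H"
  shows "fcomb A q c \<in> H"
proof -
  have add: "x + y \<in> H" if "x \<in> H" "y \<in> H" for x y
    using assms(2)[OF that(1) assms(2)[OF assms(1) that(2)]] by simp
  have cmul: "frag_cmul n x \<in> H" if "x \<in> H" for n x
    by (rule frag_closure_minus_cmul[of "\<lambda>z. z \<in> H"]) (auto intro: assms that)
  show ?thesis
    using assms(3,4)
    by (induction A rule: finite_induct) (auto simp: fcomb_def assms(1) intro: add cmul)
qed

lemma matroid_basis_spans_fcomb:
  assumes "finite E" "B \<in> matroid_bases (frag_indeps E g)" "A \<subseteq> E"
  shows "\<exists>n c'. n \<noteq> 0 \<and> frag_cmul n (fcomb A g c) = fcomb B g c'"
proof -
  have "finite A" using assms finite_subset by blast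
  then show ?thesis
    using assms(3)
  proof (induction A rule: finite_induct)
    case empty
    show ?case by (intro exI[of _ 1] exI[of _ "\<lambda>_. 0"]) (simp add: fcomb_def)
  next
    case (insert e A)
    then obtain n1 c1 where 1: "n1 \<noteq> 0" "frag_cmul n1 (fcomb A g c) = fcomb B g c1" by auto
    from matroid_basis_spans[OF assms(1,2), of e] insert.prems
    obtain n2 c2 where 2: "n2 \<noteq> 0" "frag_cmul n2 (g e) = fcomb B g c2" by auto
    have "frag_cmul (n1 * n2) (fcomb (insert e A) g c)
        = frag_cmul (n1 * c e) (frag_cmul n2 (g e)) + frag_cmul n2 (frag_cmul n1 (fcomb A g c))"
      using insert.hyps by (simp add: fcomb_def frag_cmul_distrib2 mult_ac)
    also have "\<dots> = fcomb B g (\<lambda>i. (n1 * c e) * c2 i + n2 * c1 i)"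
      unfolding 1(2) 2(2) fcomb_add fcomb_cmul ..
    finally show ?case using 1(1) 2(1)
      by (intro exI[of _ "n1 * n2"] exI[of _ "\<lambda>i. (n1 * c e) * c2 i + n2 * c1 i"]) simp
  qed
qed

text \<open>The setting of the cut lattice. \<open>p\<close> is a basis of a group between the span
  of the columns and its saturation: \<open>coords\<close> puts the columns inside, and
  \<open>p_torsion\<close> keeps the group from being larger, so that \<open>N\<close> has full
  column rank and \<open>m\<close> is the rank of the matroid.\<close>

locale column_coordinates =
  fixes E :: "'x set" and g :: "'x \<Rightarrow> ('y \<Rightarrow>\<^sub>0 int)" and m :: nat
    and p :: "nat \<Rightarrow> ('y \<Rightarrow>\<^sub>0 int)" and N :: "'x \<Rightarrow> nat \<Rightarrow> int"
  assumes finE: "finite E"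
    and p_indep: "zindep {..<m} p"
    and coords: "\<And>e. e \<in> E \<Longrightarrow> g e = fcomb {..<m} p (N e)"
    and p_torsion: "\<And>j. j < m \<Longrightarrow> \<exists>n c. n \<noteq> 0 \<and> frag_cmul n (p j) = fcomb E g c"
begin

lemma fcomb_coords:
  assumes "A \<subseteq> E"
  shows "fcomb A g c = fcomb {..<m} p (\<lambda>j. \<Sum>e\<in>A. c e * N e j)"
proof -
  have "fcomb A g c = fcomb A (\<lambda>i. fcomb {..<m} p (N i)) c"
    by (rule fcomb_cong) (use assms in \<open>simp_all add: coords subsetD\<close>)
  also have "\<dots> = fcomb {..<m} p (\<lambda>j. \<Sum>e\<in>A. c e * N e j)" by (rule fcomb_fcomb)
  finally show ?thesis .
qed

lemma fcomb_eq_0_iff: "A \<subseteq> E \<Longrightarrow> fcomb A g c = 0 \<longleftrightarrow> (\<forall>j<m. (\<Sum>e\<in>A. c e * N e j) = 0)"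
  unfolding fcomb_coords
proof
  assume "fcomb {..<m} p (\<lambda>j. \<Sum>e\<in>A. c e * N e j) = 0"
  from zindepD[OF p_indep this] show "\<forall>j<m. (\<Sum>e\<in>A. c e * N e j) = 0" by simp
next
  assume 0: "\<forall>j<m. (\<Sum>e\<in>A. c e * N e j) = 0"
  have "fcomb {..<m} p (\<lambda>j. \<Sum>e\<in>A. c e * N e j) = fcomb {..<m} p (\<lambda>j. 0)"
    by (rule fcomb_cong) (use 0 in auto)
  then show "fcomb {..<m} p (\<lambda>j. \<Sum>e\<in>A. c e * N e j) = 0" by simp
qed

text \<open>A multiple \<open>n\<close> of \<open>p i\<close> is a combination of the columns; in
  coordinates, a combination of rows of \<open>N\<close> is \<open>n\<close> times a unit vector.
  Pairing with \<open>v\<close> gives \<open>n * v i\<close>, which would be zero if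
  \<open>N\<close> killed \<open>v\<close>.\<close>

lemma coords_injective:
  assumes "i < m" "v i \<noteq> 0"
  shows "\<exists>e\<in>E. (\<Sum>j<m. N e j * v j) \<noteq> 0"
proof (rule ccontr)
  assume "\<not> ?thesis"
  then have 0: "(\<Sum>j<m. N e j * v j) = 0" if "e \<in> E" for e using that by blast
  from p_torsion[OF assms(1)] obtain n c where nc: "n \<noteq> 0" "frag_cmul n (p i) = fcomb E g c"
    by blast
  have "fcomb {..<m} p (\<lambda>j. if j = i then n else 0) = frag_cmul n (p i)"
    by (rule fcomb_single) (use assms in auto)
  also have "\<dots> = fcomb {..<m} p (\<lambda>j. \<Sum>e\<in>E. c e * N e j)"
    unfolding nc(2) by (rule fcomb_coords) simp
  finally have eq: "fcomb {..<m} p (\<lambda>j. if j = i then n else 0)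
      = fcomb {..<m} p (\<lambda>j. \<Sum>e\<in>E. c e * N e j)" .
  have col: "(\<Sum>e\<in>E. c e * N e j) = (if j = i then n else 0)" if "j < m" for j
    using zindep_eqD[OF p_indep eq, of j] that by simp
  have "n * v i = (\<Sum>j<m. (if j = i then n else 0) * v j)"
  proof -
    have "(\<Sum>j<m. (if j = i then n else 0) * v j) = (\<Sum>j<m. if j = i then n * v j else 0)"
      by (intro sum.cong refl) simp
    then show ?thesis using assms by simp
  qed
  also have "\<dots> = (\<Sum>j<m. (\<Sum>e\<in>E. c e * N e j) * v j)"
    by (intro sum.cong refl) (simp add: col)
  also have "\<dots> = (\<Sum>j<m. \<Sum>e\<in>E. c e * (N e j * v j))"
    by (simp add: sum_distrib_right mult.assoc)
  also have "\<dots> = (\<Sum>e\<in>E. c e * (\<Sum>j<m. N e j * v j))"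
    by (subst sum.swap) (simp add: sum_distrib_left)
  also have "\<dots> = 0" by (intro sum.neutral) (simp add: 0)
  finally show False using assms(2) nc(1) by simp
qed

lemma card_indep_le:
  assumes "A \<in> frag_indeps E g"
  shows "card A \<le> m"
proof (rule ccontr)
  assume "\<not> ?thesis"
  then have lt: "m < card A" by simp
  have A: "A \<subseteq> E" "zindep A g" using assms by (auto simp: frag_indeps_def)
  then have "finite A" using finE finite_subset by blast
  then obtain h where h: "bij_betw h {..<card A} A"
    using ex_bij_betw_nat_finite by (auto simp: lessThan_atLeast0)
  from rows_dependent[OF lt, of "\<lambda>i. N (h i)"] obtain c
    where c: "\<exists>i<card A. c i \<noteq> 0" "\<And>j. j < m \<Longrightarrow> (\<Sum>i<card A. c i * N (h i) j) = 0" by metis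
  define c' where "c' = (\<lambda>e. c (the_inv_into {..<card A} h e))"
  have c': "c' (h i) = c i" if "i < card A" for i
    using that bij_betw_imp_inj_on[OF h] by (simp add: c'_def the_inv_into_f_f)
  have "(\<Sum>e\<in>A. c' e * N e j) = 0" if "j < m" for j
  proof -
    have "(\<Sum>e\<in>A. c' e * N e j) = (\<Sum>i<card A. c' (h i) * N (h i) j)"
      by (rule sum.reindex_bij_betw[OF h, symmetric])
    also have "\<dots> = (\<Sum>i<card A. c i * N (h i) j)" by (intro sum.cong refl) (simp add: c')
    finally show ?thesis using c(2)[OF that] by simp
  qed
  then have "fcomb A g c' = 0" using A(1) by (simp add: fcomb_eq_0_iff)
  from zindepD[OF A(2) this] have "c' (h i) = 0" if "i < card A" for i
    using that bij_betw_apply[OF h] by auto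
  with c(1) c' show False by auto
qed

lemma minor_indep:
  assumes f: "f \<in> {..<m} \<rightarrow>\<^sub>E E" "inj_on f {..<m}" and nz: "fdet m (\<lambda>i. N (f i)) \<noteq> 0"
  shows "f ` {..<m} \<in> frag_indeps E g"
proof -
  have sub: "f ` {..<m} \<subseteq> E" using f(1) by auto
  have "c (f i) = 0" if c: "fcomb (f ` {..<m}) g c = 0" and "i < m" for c i
  proof (rule ccontr)
    assume "c (f i) \<noteq> 0"
    have "\<forall>j<m. (\<Sum>i<m. N (f i) j * c (f i)) = 0"
      using c unfolding fcomb_eq_0_iff[OF sub] by (simp add: sum.reindex[OF f(2)] mult.commute)
    then have "fdet m (\<lambda>j i. N (f i) j) = 0"
      unfolding fdet_eq_0_iff using \<open>c (f i) \<noteq> 0\<close> \<open>i < m\<close>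
      by (intro exI[of _ "\<lambda>i. c (f i)"] conjI) auto
    with nz fdet_transpose[of m "\<lambda>i. N (f i)"] show False by simp
  qed
  then show ?thesis using sub by (auto simp: frag_indeps_def zindep_def)
qed

lemma minor_basis:
  assumes f: "f \<in> {..<m} \<rightarrow>\<^sub>E E" "inj_on f {..<m}" and nz: "fdet m (\<lambda>i. N (f i)) \<noteq> 0"
  shows "f ` {..<m} \<in> matroid_bases (frag_indeps E g)"
  unfolding matroid_bases_def
proof (intro CollectI conjI ballI impI minor_indep[OF assms])
  fix A assume A: "A \<in> frag_indeps E g" "f ` {..<m} \<subseteq> A"
  then have "finite A" using finE finite_subset by (auto simp: frag_indeps_def)
  moreover have "card A \<le> card (f ` {..<m})"
    using card_indep_le[OF A(1)] f(2) by (simp add: card_image)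
  ultimately show "A = f ` {..<m}" using A(2) card_seteq by metis
qed

text \<open>The number of coordinates bounds the size of an independent set. One of size
  \<open>m\<close> exists because the Gram determinant is nonzero, so by Cauchy-Binet some maximal
  minor is nonzero.\<close>

lemma rank_eq: "Max (card ` frag_indeps E g) = m"
proof (rule Max_eqI)
  have "finite (frag_indeps E g)"
    by (rule finite_subset[of _ "Pow E"]) (use finE in \<open>auto simp: frag_indeps_def\<close>)
  then show "finite (card ` frag_indeps E g)" by simp
  show "y \<le> m" if "y \<in> card ` frag_indeps E g" for y using that card_indep_le by auto
  have "fdet m (\<lambda>i j. \<Sum>e\<in>E. N e i * N e j) \<noteq> 0"
    unfolding gram_det_eq_0_iff[OF finE] using coords_injective by blast
  then have "(\<Sum>f \<in> {..<m} \<rightarrow>\<^sub>E E. (fdet m (\<lambda>i. N (f i)))\<^sup>2) \<noteq> 0"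
    unfolding cauchy_binet_symmetric[OF finE, symmetric] by simp
  then obtain f where f: "f \<in> {..<m} \<rightarrow>\<^sub>E E" "(fdet m (\<lambda>i. N (f i)))\<^sup>2 \<noteq> 0"
    by (rule sum.not_neutral_contains_not_neutral)
  have "inj_on f {..<m}" by (rule fdet_rows_inj[of m N]) (use f(2) in simp)
  with f have "f ` {..<m} \<in> frag_indeps E g" "card (f ` {..<m}) = m"
    by (auto intro: minor_indep simp: card_image)
  then show "m \<in> card ` frag_indeps E g" by (metis image_eqI)
qed

text \<open>The lattice vector is a linear functional evaluated on the columns. If it vanished on a
  basis it would vanish on every column, since a multiple of each column lies in the span of the
  basis; this contradicts injectivity. So its support meets every basis.\<close>

lemma row_support_codependent:
  assumes "i < m" "v i \<noteq> 0"
  shows "{e\<in>E. (\<Sum>j<m. N e j * v j) \<noteq> 0} \<notin> dual_indeps E (frag_indeps E g)"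
proof
  let ?w = "\<lambda>e. \<Sum>j<m. N e j * v j"
  assume "{e\<in>E. ?w e \<noteq> 0} \<in> dual_indeps E (frag_indeps E g)"
  then obtain B where B: "B \<in> matroid_bases (frag_indeps E g)" "{e\<in>E. ?w e \<noteq> 0} \<inter> B = {}"
    by (auto simp: dual_indeps_def)
  have BE: "B \<subseteq> E" using B(1) by (auto simp: matroid_bases_def frag_indeps_def)
  then have wB: "?w b = 0" if "b \<in> B" for b using B(2) that by auto
  have "?w e = 0" if "e \<in> E" for e
  proof -
    obtain n c where nc: "n \<noteq> 0" "frag_cmul n (g e) = fcomb B g c"
      using matroid_basis_spans[OF finE B(1) \<open>e \<in> E\<close>] by blast
    have "fcomb {..<m} p (\<lambda>j. n * N e j) = fcomb {..<m} p (\<lambda>j. \<Sum>b\<in>B. c b * N b j)"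
      using nc(2) by (simp add: coords[OF that] fcomb_cmul fcomb_coords[OF BE])
    from zindep_eqD[OF p_indep this]
    have "n * ?w e = (\<Sum>j<m. (\<Sum>b\<in>B. c b * N b j) * v j)"
      by (simp add: sum_distrib_left flip: mult.assoc)
    also have "\<dots> = (\<Sum>j<m. \<Sum>b\<in>B. c b * (N b j * v j))"
      by (simp add: sum_distrib_right mult.assoc)
    also have "\<dots> = (\<Sum>b\<in>B. c b * ?w b)"
      by (subst sum.swap) (simp add: sum_distrib_left)
    also have "\<dots> = 0" by (intro sum.neutral) (simp add: wB)
    finally show ?thesis using nc(1) by simp
  qed
  with coords_injective[of i v] assms show False by blast
qed

text \<open>The chosen rows of \<open>N\<close> express the columns \<open>g (f i)\<close> through
  \<open>p\<close>, so the minor is the determinant of a sublattice whose cosets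
  \<open>\<phi>\<close> separates. Leaving \<open>\<phi>\<close> abstract lets it take values in
  homology classes. A transpose appears because the generators of the sublattice are rows of
  \<open>N\<close>.\<close>

lemma abs_minor_le_index:
  fixes \<phi> :: "(nat \<Rightarrow> int) \<Rightarrow> 'q"
  assumes f: "f \<in> {..<m} \<rightarrow>\<^sub>E E" "inj_on f {..<m}" and nz: "fdet m (\<lambda>i. N (f i)) \<noteq> 0"
    and \<phi>: "\<And>x y. \<phi> x = \<phi> y \<longleftrightarrow> (\<exists>c. fcomb {..<m} p x - fcomb {..<m} p y = fcomb (f ` {..<m}) g c)"
  shows "\<bar>fdet m (\<lambda>i. N (f i))\<bar> \<le> int (card (range \<phi>))"
proof -
  have tr: "fdet m (\<lambda>j i. N (f i) j) = fdet m (\<lambda>i. N (f i))"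
    using fdet_transpose[of m "\<lambda>i. N (f i)"] by simp
  have sub: "f ` {..<m} \<subseteq> E" using f(1) by auto
  have im: "fcomb (f ` {..<m}) g c = fcomb {..<m} p (\<lambda>j. \<Sum>i<m. N (f i) j * c (f i))" for c
    unfolding fcomb_coords[OF sub] by (simp add: sum.reindex[OF f(2)] mult.commute)
  have *: "\<phi> x = \<phi> y \<longleftrightarrow> (\<exists>z. \<forall>j<m. x j - y j = (\<Sum>i<m. N (f i) j * z i))" for x y
  proof
    assume "\<phi> x = \<phi> y"
    then obtain c where "fcomb {..<m} p x - fcomb {..<m} p y = fcomb (f ` {..<m}) g c"
      unfolding \<phi> by blast
    then have "fcomb {..<m} p (\<lambda>j. x j - y j) = fcomb {..<m} p (\<lambda>j. \<Sum>i<m. N (f i) j * c (f i))"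
      by (simp add: fcomb_diff im)
    from zindep_eqD[OF p_indep this]
    show "\<exists>z. \<forall>j<m. x j - y j = (\<Sum>i<m. N (f i) j * z i)"
      by (intro exI[of _ "\<lambda>i. c (f i)"]) simp
  next
    assume "\<exists>z. \<forall>j<m. x j - y j = (\<Sum>i<m. N (f i) j * z i)"
    then obtain z where z: "\<forall>j<m. x j - y j = (\<Sum>i<m. N (f i) j * z i)" ..
    define c where "c = (\<lambda>e. z (the_inv_into {..<m} f e))"
    have "c (f i) = z i" if "i < m" for i
      using that f(2) by (simp add: c_def the_inv_into_f_f)
    then have "fcomb {..<m} p (\<lambda>j. x j - y j) = fcomb {..<m} p (\<lambda>j. \<Sum>i<m. N (f i) j * c (f i))"
      by (intro fcomb_cong refl) (simp add: z)
    then show "\<phi> x = \<phi> y"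
      unfolding \<phi> by (intro exI[of _ c]) (simp add: fcomb_diff im)
  qed
  show ?thesis
    using abs_fdet_le_card_quotient(2)[OF _ *] nz unfolding tr by blast
qed

end

text \<open>The setting of the flow lattice: the columns of \<open>N\<close> are a basis of the
  relations among the chains \<open>g e\<close>. \<open>injective\<close> makes them independent,
  and \<open>cycles\<close> makes them generate over the integers, not merely over the
  rationals.\<close>

locale cycle_coordinates =
  fixes E :: "'x set" and g :: "'x \<Rightarrow> ('y \<Rightarrow>\<^sub>0 int)" and m :: nat
    and N :: "'x \<Rightarrow> nat \<Rightarrow> int"
  assumes finE: "finite E"
    and injective: "\<And>i v. i < m \<Longrightarrow> v i \<noteq> 0 \<Longrightarrow> \<exists>e\<in>E. (\<Sum>j<m. N e j * v j) \<noteq> 0"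
    and cycles: "\<And>c. fcomb E g c = 0 \<longleftrightarrow> (\<exists>v. \<forall>e\<in>E. c e = (\<Sum>j<m. N e j * v j))"
begin

lemma cycle: "fcomb E g (\<lambda>e. \<Sum>j<m. N e j * v j) = 0"
  unfolding cycles by (rule exI[of _ v]) simp

text \<open>The entries of the lattice vector are themselves the coefficients of a relation.\<close>

lemma cycle_support_dependent:
  assumes "i < m" "v i \<noteq> 0"
  shows "{e\<in>E. (\<Sum>j<m. N e j * v j) \<noteq> 0} \<notin> frag_indeps E g"
proof
  let ?w = "\<lambda>e. \<Sum>j<m. N e j * v j" and ?W = "{e\<in>E. (\<Sum>j<m. N e j * v j) \<noteq> 0}"
  assume "?W \<in> frag_indeps E g"
  then have "zindep ?W g" by (simp add: frag_indeps_def)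
  moreover have "fcomb E g ?w = fcomb ?W g ?w"
    by (rule fcomb_mono_neutral) (use finE in auto)
  then have "fcomb ?W g ?w = 0" by (simp only: cycle)
  ultimately have "?w e = 0" if "e \<in> ?W" for e
    using zindepD[of ?W g ?w e] that by blast
  with injective[of i v] assms show False by blast
qed

text \<open>Matroid duality in coordinates. A relation avoiding the facets \<open>f i\<close> comes
  from a vector killed by the nonsingular minor, so it is zero. Conversely, restoring one facet
  \<open>f i\<close> creates a relation.\<close>

lemma complement_minor_basis:
  assumes f: "f \<in> {..<m} \<rightarrow>\<^sub>E E" and nz: "fdet m (\<lambda>i. N (f i)) \<noteq> 0"
  shows "E - f ` {..<m} \<in> matroid_bases (frag_indeps E g)"
  unfolding matroid_bases_def
proof (intro CollectI conjI ballI impI)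
  let ?B = "E - f ` {..<m}"
  have fE: "f i \<in> E" if "i < m" for i using f that by auto
  have "zindep ?B g"
    unfolding zindep_def
  proof (intro allI impI ballI)
    fix c e assume c: "fcomb ?B g c = 0" and e: "e \<in> ?B"
    then have "fcomb E g (\<lambda>e. if e \<in> ?B then c e else 0) = 0"
      by (subst fcomb_restrict) (use finE in auto)
    then obtain v where v: "\<forall>e\<in>E. (if e \<in> ?B then c e else 0) = (\<Sum>j<m. N e j * v j)"
      unfolding cycles by blast
    have "\<forall>i<m. v i = 0"
    proof (rule ccontr)
      assume "\<not> ?thesis"
      moreover have "\<forall>i<m. (\<Sum>j<m. N (f i) j * v j) = 0"
      proof (intro allI impI)
        fix i assume "i < m"
        then show "(\<Sum>j<m. N (f i) j * v j) = 0"
          using v[rule_format, OF fE[OF \<open>i < m\<close>]] by simp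
      qed
      ultimately have "fdet m (\<lambda>i. N (f i)) = 0"
        unfolding fdet_eq_0_iff by (intro exI[of _ v]) auto
      with nz show False by simp
    qed
    then show "c e = 0" using v e by auto
  qed
  then show "?B \<in> frag_indeps E g" by (simp add: frag_indeps_def)
  fix A assume A: "A \<in> frag_indeps E g" "?B \<subseteq> A"
  show "A = ?B"
  proof (rule ccontr)
    assume "A \<noteq> ?B"
    with A obtain i where i: "i < m" "f i \<in> A" by (auto simp: frag_indeps_def)
    obtain b where b: "\<And>k j. k < m \<Longrightarrow> j < m \<Longrightarrow>
        (\<Sum>l<m. N (f k) l * b l j) = (if k = j then fdet m (\<lambda>i. N (f i)) else 0)"
      using fdet_adjugate[of m "\<lambda>i. N (f i)"] by blast
    \<comment> \<open>Column \<open>i\<close> of the adjugate gives a cycle that vanishes at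
      \<open>f k\<close> for \<open>k \<noteq> i\<close> and equals the minor at \<open>f i\<close>;
      it is therefore supported in \<open>A\<close>.\<close>
    define w where "w = (\<lambda>e. \<Sum>l<m. N e l * b l i)"
    have w: "w (f k) = (if k = i then fdet m (\<lambda>i. N (f i)) else 0)" if "k < m" for k
      using b[OF that i(1)] by (simp add: w_def)
    have "w e = 0" if "e \<in> E - A" for e
    proof -
      from that A(2) obtain k where "k < m" "e = f k" by auto
      with that i(2) w[of k] show ?thesis by auto
    qed
    moreover have "A \<subseteq> E" using A(1) by (simp add: frag_indeps_def)
    ultimately have "fcomb E g w = fcomb A g w" using finE by (intro fcomb_mono_neutral) auto
    moreover have "fcomb E g w = 0" unfolding w_def by (rule cycle)
    ultimately have "fcomb A g w = 0" by simp
    from zindepD[OF _ this i(2)] A(1) have "w (f i) = 0" by (simp add: frag_indeps_def)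
    with w[OF i(1)] nz show False by simp
  qed
qed

end

section \<open>Homology as a quotient of chain groups\<close>

text \<open>Absolute and relative homology are both quotients of a group of chains, so classes,
  torsion and rank are computed here once. Closure under subtraction makes the subgroup generated by
  \<open>Z\<close> equal to \<open>Z\<close>.\<close>

locale frag_quotient =
  fixes S :: "'x set" and Z B :: "('x \<Rightarrow>\<^sub>0 int) set"
  assumes Z_keys: "\<And>z. z \<in> Z \<Longrightarrow> Poly_Mapping.keys z \<subseteq> S"
    and Z_diff: "\<And>x y. x \<in> Z \<Longrightarrow> y \<in> Z \<Longrightarrow> x - y \<in> Z"
    and B_zero: "0 \<in> B" and B_diff: "\<And>x y. x \<in> B \<Longrightarrow> y \<in> B \<Longrightarrow> x - y \<in> B"
    and B_sub: "B \<subseteq> Z"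
begin

definition cl :: "('x \<Rightarrow>\<^sub>0 int) \<Rightarrow> ('x \<Rightarrow>\<^sub>0 int) set" where
  "cl z = (\<lambda>b. b + z) ` B"

abbreviation "Cyc \<equiv> subgroup_generated (free_Abelian_group S) Z"
abbreviation "Quot \<equiv> Cyc Mod B"

lemma frag_subgroup:
  assumes "H \<subseteq> Z" "0 \<in> H" "\<And>x y. x \<in> H \<Longrightarrow> y \<in> H \<Longrightarrow> x - y \<in> H"
  shows "subgroup H (free_Abelian_group S)"
proof (rule group.subgroupI)
  have neg: "- x \<in> H" if "x \<in> H" for x using assms(3)[OF assms(2) that] by simp
  show "H \<subseteq> carrier (free_Abelian_group S)" using assms(1) Z_keys by auto
  show "inv\<^bsub>free_Abelian_group S\<^esub> x \<in> H" if "x \<in> H" for x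
    using neg[OF that] Z_keys[of x] that assms(1) by (simp add: subsetD)
  show "x \<otimes>\<^bsub>free_Abelian_group S\<^esub> y \<in> H" if "x \<in> H" "y \<in> H" for x y
    using assms(3)[OF that(1) neg[OF that(2)]] by simp
qed (use assms in auto)

lemma Z_zero: "0 \<in> Z" using B_zero B_sub by blast

lemma Z_cmul: "z \<in> Z \<Longrightarrow> frag_cmul n z \<in> Z"
  by (rule frag_closure_minus_cmul[of "\<lambda>z. z \<in> Z"]) (auto intro: Z_zero Z_diff)

lemma Z_fcomb: "finite A \<Longrightarrow> (\<And>i. i \<in> A \<Longrightarrow> q i \<in> Z) \<Longrightarrow> fcomb A q c \<in> Z"
  by (rule fcomb_closed[OF Z_zero Z_diff])

lemma carrier_Cyc: "carrier Cyc = Z"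
  by (rule subgroup.carrier_subgroup_generated_subgroup[OF frag_subgroup])
    (auto intro: Z_zero Z_diff)

lemma comm_group_Cyc: "comm_group Cyc"
  by (rule group.abelian_subgroup_generated) (simp_all add: abelian_free_Abelian_group)

lemma subgroup_B: "subgroup B Cyc"
  by (rule group.subgroup_of_subgroup_generated[OF group_free_Abelian_group B_sub])
    (rule frag_subgroup[OF B_sub B_zero B_diff])

lemma comm_group_Quot: "comm_group Quot"
  by (rule comm_group.abelian_FactGroup[OF comm_group_Cyc subgroup_B])

lemma group_Quot: "Group.group Quot"
  using comm_group_Quot by (simp add: comm_group_def)

lemma r_coset_eq: "B #>\<^bsub>Cyc\<^esub> z = cl z"
  by (auto simp: r_coset_def cl_def)

lemma cl_hom: "cl \<in> hom Cyc Quot"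
proof -
  have "B \<lhd> Cyc" by (rule comm_group.subgroup_imp_normal[OF comm_group_Cyc subgroup_B])
  from normal.r_coset_hom_Mod[OF this] show ?thesis
    by (simp add: r_coset_eq)
qed

lemma carrier_Quot: "carrier Quot = cl ` Z"
  by (simp add: carrier_FactGroup carrier_Cyc r_coset_eq)

lemma cl_eq_iff: "cl x = cl y \<longleftrightarrow> x - y \<in> B"
proof
  assume "cl x = cl y"
  moreover have "x \<in> cl x" unfolding cl_def by (rule image_eqI[of _ _ 0]) (use B_zero in auto)
  ultimately obtain b where "b \<in> B" "x = b + y" by (auto simp: cl_def)
  then show "x - y \<in> B" by simp
next
  assume xy: "x - y \<in> B"
  then have yx: "y - x \<in> B" using B_diff[OF B_zero xy] by simp
  have "cl u \<subseteq> cl v" if uv: "u - v \<in> B" and vu: "v - u \<in> B" for u v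
    unfolding cl_def
  proof clarify
    fix b assume "b \<in> B"
    then have "b - (v - u) \<in> B" using vu by (rule B_diff)
    then show "b + u \<in> (\<lambda>b. b + v) ` B" by (rule rev_image_eqI) simp
  qed
  from this[OF xy yx] this[OF yx xy] show "cl x = cl y" by blast
qed

lemma one_Quot: "\<one>\<^bsub>Quot\<^esub> = cl 0"
  by (simp add: FactGroup_def cl_def)

lemma cl_zero: "cl 0 = B"
  by (simp add: cl_def)

lemma cl_eq_one_iff: "cl z = \<one>\<^bsub>Quot\<^esub> \<longleftrightarrow> z \<in> B"
  unfolding one_Quot cl_eq_iff by simp

lemma cl_add: "x \<in> Z \<Longrightarrow> y \<in> Z \<Longrightarrow> cl x \<otimes>\<^bsub>Quot\<^esub> cl y = cl (x + y)"
  using hom_mult[OF cl_hom, of x y] by (simp add: carrier_Cyc)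

lemma cl_pow_nat:
  fixes n :: nat
  assumes "z \<in> Z"
  shows "cl z [^]\<^bsub>Quot\<^esub> n = cl (frag_cmul (int n) z)"
  using hom_nat_pow[OF cl_hom, of z n] assms group_Quot comm_group_Cyc
  by (simp add: carrier_Cyc pow_subgroup_generated comm_group_def)

lemma cl_pow_int:
  fixes n :: int
  assumes "z \<in> Z"
  shows "cl z [^]\<^bsub>Quot\<^esub> n = cl (frag_cmul n z)"
  using hom_int_pow[OF cl_hom, of z n] assms group_Quot comm_group_Cyc Z_keys[OF assms]
  by (simp add: carrier_Cyc group.int_pow_subgroup_generated comm_group_def)

lemma torsion_part_Quot:
  "torsion_part Quot = cl ` {z \<in> Z. \<exists>n. n \<noteq> 0 \<and> frag_cmul n z \<in> B}"
proof -
  have "(\<exists>n::nat. 0 < n \<and> frag_cmul (int n) z \<in> B) \<longleftrightarrow> (\<exists>n. n \<noteq> 0 \<and> frag_cmul n z \<in> B)" for z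
  proof
    assume "\<exists>n. n \<noteq> 0 \<and> frag_cmul n z \<in> B"
    then obtain n where n: "n \<noteq> 0" "frag_cmul n z \<in> B" by blast
    have "frag_cmul (- n) z \<in> B" using B_diff[OF B_zero n(2)] by simp
    then have "frag_cmul \<bar>n\<bar> z \<in> B" using n(2) by (cases "n < 0") simp_all
    with n(1) show "\<exists>n::nat. 0 < n \<and> frag_cmul (int n) z \<in> B"
      by (intro exI[of _ "nat \<bar>n\<bar>"]) simp
  qed (metis of_nat_0_less_iff order_less_irrefl)
  moreover have "(cl z [^]\<^bsub>Quot\<^esub> n = \<one>\<^bsub>Quot\<^esub>) = (frag_cmul (int n) z \<in> B)" if "z \<in> Z" for z and n :: nat
    unfolding cl_pow_nat[OF that] by (rule cl_eq_one_iff)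
  ultimately have "(\<exists>n::nat. 0 < n \<and> cl z [^]\<^bsub>Quot\<^esub> n = \<one>\<^bsub>Quot\<^esub>)
      \<longleftrightarrow> (\<exists>n. n \<noteq> 0 \<and> frag_cmul n z \<in> B)" if "z \<in> Z" for z
    using that by (simp only:)
  then have "{z \<in> Z. \<exists>n::nat. 0 < n \<and> cl z [^]\<^bsub>Quot\<^esub> n = \<one>\<^bsub>Quot\<^esub>}
      = {z \<in> Z. \<exists>n. n \<noteq> 0 \<and> frag_cmul n z \<in> B}"
    by (intro Collect_cong conj_cong refl)
  moreover have "torsion_part Quot
      = cl ` {z \<in> Z. \<exists>n::nat. 0 < n \<and> cl z [^]\<^bsub>Quot\<^esub> n = \<one>\<^bsub>Quot\<^esub>}"
    unfolding torsion_part_def carrier_Quot by (rule Compr_image_eq)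
  ultimately show ?thesis by (simp only:)
qed

lemma finprod_cl:
  assumes "finite A" "\<And>x. x \<in> A \<Longrightarrow> rep x \<in> Z \<and> x = cl (rep x)"
  shows "finprod Quot (\<lambda>x. x [^]\<^bsub>Quot\<^esub> (c x :: int)) A = cl (fcomb A rep c)"
proof -
  interpret Q: comm_group Quot by (rule comm_group_Quot)
  show ?thesis
    using assms
  proof (induction A rule: finite_induct)
    case empty
    then show ?case by (simp add: cl_zero fcomb_def)
  next
    case (insert x A)
    have pow: "y [^]\<^bsub>Quot\<^esub> c y = cl (frag_cmul (c y) (rep y))" if "y \<in> insert x A" for y
      using insert.prems[OF that] cl_pow_int[of "rep y" "c y"] by simp
    have in_carrier: "y [^]\<^bsub>Quot\<^esub> c y \<in> carrier Quot" if "y \<in> insert x A" for y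
      unfolding pow[OF that] carrier_Quot using insert.prems[OF that] by (blast intro: Z_cmul)
    have "finprod Quot (\<lambda>x. x [^]\<^bsub>Quot\<^esub> c x) (insert x A)
        = x [^]\<^bsub>Quot\<^esub> c x \<otimes>\<^bsub>Quot\<^esub> finprod Quot (\<lambda>x. x [^]\<^bsub>Quot\<^esub> c x) A"
      by (rule Q.finprod_insert) (use insert.hyps in_carrier in auto)
    also have "finprod Quot (\<lambda>x. x [^]\<^bsub>Quot\<^esub> c x) A = cl (fcomb A rep c)"
      by (rule insert.IH) (use insert.prems in blast)
    also have "x [^]\<^bsub>Quot\<^esub> c x = cl (frag_cmul (c x) (rep x))" by (rule pow) simp
    also have "cl (frag_cmul (c x) (rep x)) \<otimes>\<^bsub>Quot\<^esub> cl (fcomb A rep c)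
        = cl (frag_cmul (c x) (rep x) + fcomb A rep c)"
      by (rule cl_add) (use insert.prems insert.hyps in \<open>auto intro!: Z_cmul Z_fcomb\<close>)
    also have "frag_cmul (c x) (rep x) + fcomb A rep c = fcomb (insert x A) rep c"
      using insert.hyps by (simp add: fcomb_def)
    finally show ?case .
  qed
qed

text \<open>The hypotheses make the quotient free on the classes of \<open>q\<close>. The rank is a
  supremum, so it must be shown to be attained and any larger set must be refuted: written in
  \<open>m\<close> coordinates, more than \<open>m\<close> classes satisfy a nontrivial integral
  relation.\<close>

lemma abelian_rank_eq:
  fixes q :: "nat \<Rightarrow> ('x \<Rightarrow>\<^sub>0 int)"
  assumes q: "\<And>j. j < m \<Longrightarrow> q j \<in> Z"
    and gen: "\<And>z. z \<in> Z \<Longrightarrow> \<exists>v. z - fcomb {..<m} q v \<in> B"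
    and indep: "\<And>v j. fcomb {..<m} q v \<in> B \<Longrightarrow> j < m \<Longrightarrow> v j = 0"
  shows "abelian_rank Quot = m"
  unfolding abelian_rank_def
proof (rule cSup_eq_maximum)
  \<comment> \<open>Independence is a property of sets of classes, so the classes must be distinct
    for their set to have \<open>m\<close> elements.\<close>
  have inj: "inj_on (\<lambda>j. cl (q j)) {..<m}"
  proof (rule inj_onI, rule ccontr)
    fix i j assume ij: "i \<in> {..<m}" "j \<in> {..<m}" "cl (q i) = cl (q j)" "i \<noteq> j"
    have "fcomb {..<m} q (\<lambda>l. (if l = i then 1 else 0) - (if l = j then 1 else 0)) = q i - q j"
      unfolding fcomb_diff using ij by (simp add: fcomb_single)
    then have "fcomb {..<m} q (\<lambda>l. (if l = i then 1 else 0) - (if l = j then 1 else 0)) \<in> B"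
      using ij(3) by (simp add: cl_eq_iff)
    from indep[OF this, of i] ij show False by simp
  qed
  let ?A = "(\<lambda>j. cl (q j)) ` {..<m}"
  have "int_independent Quot ?A"
    unfolding int_independent_def
  proof (intro conjI allI impI ballI)
    show "?A \<subseteq> carrier Quot" unfolding carrier_Quot using q by auto
    fix c :: "('x \<Rightarrow>\<^sub>0 int) set \<Rightarrow> int" and x
    assume one: "finprod Quot (\<lambda>x. x [^]\<^bsub>Quot\<^esub> c x) ?A = \<one>\<^bsub>Quot\<^esub>" and x: "x \<in> ?A"
    define rep where "rep = (\<lambda>y. q (the_inv_into {..<m} (\<lambda>j. cl (q j)) y))"
    have rep: "rep (cl (q j)) = q j" if "j < m" for j
      using the_inv_into_f_f[OF inj, of j] that by (simp add: rep_def)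
    have "finprod Quot (\<lambda>x. x [^]\<^bsub>Quot\<^esub> c x) ?A = cl (fcomb ?A rep c)"
      by (rule finprod_cl) (auto simp: rep q)
    also have "fcomb ?A rep c = fcomb {..<m} q (\<lambda>j. c (cl (q j)))"
      unfolding fcomb_image[OF inj] by (rule fcomb_cong) (auto simp: rep)
    finally have "fcomb {..<m} q (\<lambda>j. c (cl (q j))) \<in> B"
      using one cl_eq_one_iff by metis
    from indep[OF this] x show "c x = 0" by auto
  qed simp
  moreover have "card ?A = m" using inj by (simp add: card_image)
  ultimately show "m \<in> card ` {A. int_independent Quot A}"
    by (intro rev_image_eqI[of ?A]) simp_all
  fix k assume "k \<in> card ` {A. int_independent Quot A}"
  then obtain A where A: "int_independent Quot A" and k: "k = card A" by blast
  show "k \<le> m"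
  proof (rule ccontr)
    assume "\<not> ?thesis"
    then have lt: "m < card A" by (simp add: k)
    have finA: "finite A" and "A \<subseteq> cl ` Z" using A by (auto simp: int_independent_def carrier_Quot)
    from ex_bij_betw_nat_finite[OF finA] obtain h where h: "bij_betw h {..<card A} A"
      unfolding lessThan_atLeast0 ..
    have "\<exists>v. x = cl (fcomb {..<m} q v)" if xA: "x \<in> A" for x
    proof -
      obtain z where z: "z \<in> Z" "x = cl z" using \<open>A \<subseteq> cl ` Z\<close> xA by blast
      obtain v where "z - fcomb {..<m} q v \<in> B" using gen[OF z(1)] by blast
      then have "x = cl (fcomb {..<m} q v)" unfolding z(2) cl_eq_iff .
      then show ?thesis by (rule exI[of _ v])
    qed
    then have "\<forall>x\<in>A. \<exists>v. x = cl (fcomb {..<m} q v)" by blast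
    from bchoice[OF this] obtain w where w: "\<forall>x\<in>A. x = cl (fcomb {..<m} q (w x))" ..
    from rows_dependent[OF lt, of "\<lambda>i. w (h i)"] obtain c
      where c: "\<exists>i<card A. c i \<noteq> 0" "\<And>j. j < m \<Longrightarrow> (\<Sum>i<card A. c i * w (h i) j) = 0" by metis
    define c' where "c' = (\<lambda>e. c (the_inv_into {..<card A} h e))"
    have c': "c' (h i) = c i" if "i < card A" for i
      using that bij_betw_imp_inj_on[OF h] by (simp add: c'_def the_inv_into_f_f)
    have "(\<Sum>x\<in>A. c' x * w x j) = 0" if "j < m" for j
    proof -
      have "(\<Sum>x\<in>A. c' x * w x j) = (\<Sum>i<card A. c' (h i) * w (h i) j)"
        by (rule sum.reindex_bij_betw[OF h, symmetric])
      also have "\<dots> = (\<Sum>i<card A. c i * w (h i) j)" by (intro sum.cong refl) (simp add: c')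
      finally show ?thesis using c(2)[OF that] by simp
    qed
    then have "fcomb {..<m} q (\<lambda>j. \<Sum>x\<in>A. c' x * w x j) = fcomb {..<m} q (\<lambda>_. 0)"
      by (intro fcomb_cong) auto
    then have "fcomb A (\<lambda>x. fcomb {..<m} q (w x)) c' = 0"
      unfolding fcomb_fcomb by simp
    moreover have "finprod Quot (\<lambda>x. x [^]\<^bsub>Quot\<^esub> c' x) A
        = cl (fcomb A (\<lambda>x. fcomb {..<m} q (w x)) c')"
    proof (rule finprod_cl[OF finA])
      fix x assume "x \<in> A"
      with w show "fcomb {..<m} q (w x) \<in> Z \<and> x = cl (fcomb {..<m} q (w x))"
        by (intro conjI Z_fcomb) (auto intro: q)
    qed
    ultimately have "finprod Quot (\<lambda>x. x [^]\<^bsub>Quot\<^esub> c' x) A = \<one>\<^bsub>Quot\<^esub>"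
      by (simp add: cl_zero)
    then have "\<forall>x\<in>A. c' x = 0" using A by (simp add: int_independent_def)
    then have "c i = 0" if "i < card A" for i
      using c'[OF that] bij_betw_apply[OF h, of i] that by simp
    with c(1) show False by blast
  qed
qed

end

section \<open>The cellular matroid over the reals and over the integers\<close>

lemma exists_reindex_iff:
  fixes b :: "'x \<Rightarrow> 'f \<Rightarrow> 'r::comm_ring_1"
  assumes h: "bij_betw h {..<q} A"
  shows "(\<exists>c. (\<exists>e\<in>A. c e \<noteq> 0) \<and> (\<forall>f\<in>F. (\<Sum>e\<in>A. c e * b e f) = 0))
     \<longleftrightarrow> (\<exists>v. (\<exists>i<q. v i \<noteq> 0) \<and> (\<forall>f\<in>F. (\<Sum>j<q. b (h j) f * v j) = 0))" (is "?L \<longleftrightarrow> ?R")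
proof
  assume ?L
  then obtain c where c: "\<exists>e\<in>A. c e \<noteq> 0" "\<forall>f\<in>F. (\<Sum>e\<in>A. c e * b e f) = 0" by blast
  have "(\<Sum>j<q. b (h j) f * c (h j)) = (\<Sum>e\<in>A. c e * b e f)" for f
    using sum.reindex_bij_betw[OF h, of "\<lambda>e. c e * b e f"] by (simp add: mult.commute)
  moreover have "\<exists>i<q. c (h i) \<noteq> 0"
    using c(1) unfolding bij_betw_imp_surj_on[OF h, symmetric] by auto
  ultimately show ?R using c(2) by (intro exI[of _ "\<lambda>i. c (h i)"]) simp
next
  assume ?R
  then obtain v where v: "\<exists>i<q. v i \<noteq> 0" "\<forall>f\<in>F. (\<Sum>j<q. b (h j) f * v j) = 0" by blast
  define c where "c = (\<lambda>e. v (the_inv_into {..<q} h e))"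
  have c: "c (h i) = v i" if "i < q" for i
    using that bij_betw_imp_inj_on[OF h] by (simp add: c_def the_inv_into_f_f)
  have "(\<Sum>e\<in>A. c e * b e f) = (\<Sum>j<q. b (h j) f * v j)" for f
  proof -
    have "(\<Sum>e\<in>A. c e * b e f) = (\<Sum>j<q. c (h j) * b (h j) f)"
      by (rule sum.reindex_bij_betw[OF h, symmetric])
    also have "\<dots> = (\<Sum>j<q. b (h j) f * v j)" by (intro sum.cong refl) (simp add: c mult.commute)
    finally show ?thesis .
  qed
  moreover have "\<exists>e\<in>A. c e \<noteq> 0"
    using v(1) c unfolding bij_betw_imp_surj_on[OF h, symmetric] by auto
  ultimately show ?L using v(2) by (intro exI[of _ c]) simp
qed

text \<open>The \<open>(d - 1)\<close>-cells carry the whole boundary of a facet, so testing them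
  tests the chain. The coefficients become integral through \<open>gram_det_real\<close>, with these
  cells as rows and an enumeration of \<open>A\<close> as columns.\<close>

lemma cellular_indeps_eq:
  assumes K: "based_complex K"
  shows "cellular_indeps K d = frag_indeps (facets K d) (bc_bd K)"
proof -
  let ?F = "cells_of_deg K (bc_cells K) (d - 1)"
  have fin: "finite (bc_cells K)" using K by (simp add: based_complex_def)
  then have finF: "finite ?F" by (simp add: cells_of_deg_def)
  have "(\<forall>c :: 'a \<Rightarrow> real. (\<forall>f\<in>?F. (\<Sum>e\<in>A. c e * real_of_int (poly_mapping.lookup (bc_bd K e) f)) = 0)
           \<longrightarrow> (\<forall>e\<in>A. c e = 0)) \<longleftrightarrow> zindep A (bc_bd K)" if A: "A \<subseteq> facets K d" for A
  proof -
    let ?b = "\<lambda>e f. poly_mapping.lookup (bc_bd K e) f"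
    have "finite A" using A fin finite_subset[of A "bc_cells K"] by (auto simp: facets_def cells_of_deg_def)
    then obtain h where h: "bij_betw h {..<card A} A"
      using ex_bij_betw_nat_finite by (auto simp: lessThan_atLeast0)
    have keys: "Poly_Mapping.keys (bc_bd K e) \<subseteq> ?F" if "e \<in> A" for e
      using that A K by (auto simp: based_complex_def facets_def cells_of_deg_def)
    have zero: "fcomb A (bc_bd K) c = 0 \<longleftrightarrow> (\<forall>f\<in>?F. (\<Sum>e\<in>A. c e * ?b e f) = 0)" for c
    proof
      assume "\<forall>f\<in>?F. (\<Sum>e\<in>A. c e * ?b e f) = 0"
      then have "poly_mapping.lookup (fcomb A (bc_bd K) c) f = 0" if "f \<in> ?F" for f
        using that by (simp add: lookup_fcomb)
      moreover have "Poly_Mapping.keys (fcomb A (bc_bd K) c) \<subseteq> ?F" by (rule keys_fcomb) (rule keys)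
      then have "poly_mapping.lookup (fcomb A (bc_bd K) c) f = 0" if "f \<notin> ?F" for f
        using that by (meson in_keys_iff subsetD)
      ultimately show "fcomb A (bc_bd K) c = 0" by (intro poly_mapping_eqI) (metis lookup_zero)
    next
      assume "fcomb A (bc_bd K) c = 0"
      then show "\<forall>f\<in>?F. (\<Sum>e\<in>A. c e * ?b e f) = 0" by (simp flip: lookup_fcomb)
    qed
    have "(\<exists>c :: 'a \<Rightarrow> real. (\<exists>e\<in>A. c e \<noteq> 0) \<and> (\<forall>f\<in>?F. (\<Sum>e\<in>A. c e * real_of_int (?b e f)) = 0))
      \<longleftrightarrow> (\<exists>c :: 'a \<Rightarrow> int. (\<exists>e\<in>A. c e \<noteq> 0) \<and> (\<forall>f\<in>?F. (\<Sum>e\<in>A. c e * ?b e f) = 0))"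
      unfolding exists_reindex_iff[OF h, of _ ?b]
        exists_reindex_iff[OF h, of _ "\<lambda>e f. real_of_int (?b e f)"]
      by (rule gram_det_real[OF finF])
    then show ?thesis unfolding zindep_def zero by blast
  qed
  then show ?thesis unfolding cellular_indeps_def frag_indeps_def by blast
qed

section \<open>Boundaries, cycles and homology of based complexes\<close>

lemma lookup_fcomb_frag_of:
  assumes "finite A"
  shows "poly_mapping.lookup (fcomb A frag_of c) x = (if x \<in> A then c x else 0)"
proof -
  have "poly_mapping.lookup (fcomb A frag_of c) x = (\<Sum>i\<in>A. if x = i then c i else 0)"
    unfolding lookup_fcomb by (intro sum.cong refl) auto
  then show ?thesis using assms by simp
qed

lemma keys_fcomb_frag_of: "Poly_Mapping.keys (fcomb A frag_of c) \<subseteq> A"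
  by (rule keys_fcomb) simp

lemma bc_boundary_eq_fcomb:
  assumes "finite A" "Poly_Mapping.keys c \<subseteq> A"
  shows "bc_boundary K c = fcomb A (bc_bd K) (poly_mapping.lookup c)"
proof -
  have "fcomb A (bc_bd K) (poly_mapping.lookup c)
      = fcomb (Poly_Mapping.keys c) (bc_bd K) (poly_mapping.lookup c)"
    by (rule fcomb_mono_neutral) (use assms in \<open>auto simp: in_keys_iff\<close>)
  then show ?thesis by (simp add: bc_boundary_def frag_extend_def fcomb_def)
qed

lemma bc_boundary_frag_of: "finite A \<Longrightarrow> bc_boundary K (fcomb A frag_of c) = fcomb A (bc_bd K) c"
  by (subst bc_boundary_eq_fcomb[OF _ keys_fcomb_frag_of])
    (auto intro: fcomb_cong simp: lookup_fcomb_frag_of)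

lemma bc_boundary_diff: "bc_boundary K (x - y) = bc_boundary K x - bc_boundary K y"
  by (simp add: bc_boundary_def frag_extend_diff)

lemma bc_boundary_add: "bc_boundary K (x + y) = bc_boundary K x + bc_boundary K y"
  by (simp add: bc_boundary_def frag_extend_add)

lemma bc_boundary_cmul: "bc_boundary K (frag_cmul n x) = frag_cmul n (bc_boundary K x)"
  by (simp add: bc_boundary_def frag_extend_cmul)

lemma bc_boundary_zero [simp]: "bc_boundary K 0 = 0"
  by (simp add: bc_boundary_def)

lemma bc_boundary_fcomb_eq_0:
  assumes "finite A" "\<And>i. i \<in> A \<Longrightarrow> bc_boundary K (q i) = 0"
  shows "bc_boundary K (fcomb A q c) = 0"
  using fcomb_closed[of "{z. bc_boundary K z = 0}" A q c] assms by (simp add: bc_boundary_diff)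

lemma bd_keys:
  assumes "based_complex K" "x \<in> cells_of_deg K (bc_cells K) i"
  shows "Poly_Mapping.keys (bc_bd K x) \<subseteq> cells_of_deg K (bc_cells K) (i - 1)"
  using assms by (auto simp: based_complex_def cells_of_deg_def)

lemma bd_bd:
  assumes "based_complex K" "x \<in> cells_of_deg K (bc_cells K) i"
  shows "bc_boundary K (bc_bd K x) = 0"
  using assms by (auto simp: based_complex_def cells_of_deg_def)

lemma finite_cells_of_deg: "based_complex K \<Longrightarrow> A \<subseteq> bc_cells K \<Longrightarrow> finite (cells_of_deg K A i)"
  by (rule finite_subset[of _ "bc_cells K"]) (auto simp: based_complex_def cells_of_deg_def)

lemma bc_boundary_keys:
  assumes K: "based_complex K" and c: "Poly_Mapping.keys c \<subseteq> cells_of_deg K (bc_cells K) i"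
  shows "Poly_Mapping.keys (bc_boundary K c) \<subseteq> cells_of_deg K (bc_cells K) (i - 1)"
  unfolding bc_boundary_eq_fcomb[OF finite_cells_of_deg[OF K order_refl] c]
  by (rule keys_fcomb) (rule bd_keys[OF K])

lemma bc_boundary_boundary:
  assumes K: "based_complex K" and c: "Poly_Mapping.keys c \<subseteq> cells_of_deg K (bc_cells K) i"
  shows "bc_boundary K (bc_boundary K c) = 0"
  unfolding bc_boundary_eq_fcomb[OF finite_cells_of_deg[OF K order_refl] c]
  by (rule bc_boundary_fcomb_eq_0[OF finite_cells_of_deg[OF K order_refl]]) (rule bd_bd[OF K])

text \<open>\<open>full\<close> and \<open>lower\<close> stand for closure under the boundary map in
  the degrees concerned: boundaries of \<open>(i + 1)\<close>-chains stay in \<open>A\<close>, and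
  those of \<open>i\<close>-chains of \<open>U\<close> stay in \<open>U\<close>. The first
  alternative of \<open>lower\<close> serves absolute homology, the second homology relative to a
  forest.\<close>

lemma frag_quotient_homology:
  assumes K: "based_complex K" and A: "A \<subseteq> bc_cells K" and U: "U \<subseteq> A"
    and full: "cells_of_deg K (bc_cells K) i \<subseteq> A"
    and lower: "cells_of_deg K U i = {} \<or> cells_of_deg K (bc_cells K) (i - 1) \<subseteq> U"
  shows "frag_quotient (cells_of_deg K A i) (bc_relcycles K A U i) (bc_relboundaries K A U i)"
proof
  have AK: "cells_of_deg K A j \<subseteq> cells_of_deg K (bc_cells K) j" for j
    using A by (auto simp: cells_of_deg_def)
  have UA: "cells_of_deg K U j \<subseteq> cells_of_deg K A j" for j
    using U by (auto simp: cells_of_deg_def)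
  have full': "cells_of_deg K (bc_cells K) i \<subseteq> cells_of_deg K A i"
    using full by (auto simp: cells_of_deg_def)
  have diff: "Poly_Mapping.keys (x - y) \<subseteq> T" if "Poly_Mapping.keys x \<subseteq> T" "Poly_Mapping.keys y \<subseteq> T"
    for x y :: "'a \<Rightarrow>\<^sub>0 int" and T
    using keys_diff[of x y] that by blast
  show "Poly_Mapping.keys z \<subseteq> cells_of_deg K A i" if "z \<in> bc_relcycles K A U i" for z
    using that by (simp add: bc_relcycles_def bc_chains_def)
  show "x - y \<in> bc_relcycles K A U i" if "x \<in> bc_relcycles K A U i" "y \<in> bc_relcycles K A U i" for x y
    using that by (simp add: bc_relcycles_def bc_chains_def bc_boundary_diff diff)
  show "0 \<in> bc_relboundaries K A U i"
    unfolding bc_relboundaries_def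
    by (rule CollectI, rule exI[of _ 0], rule exI[of _ 0]) (simp add: bc_chains_def)
  show "x - y \<in> bc_relboundaries K A U i"
    if "x \<in> bc_relboundaries K A U i" "y \<in> bc_relboundaries K A U i" for x y
  proof -
    from that obtain c u c' u' where *: "x = bc_boundary K c + u" "y = bc_boundary K c' + u'"
      "Poly_Mapping.keys c \<subseteq> cells_of_deg K A (i + 1)" "Poly_Mapping.keys c' \<subseteq> cells_of_deg K A (i + 1)"
      "Poly_Mapping.keys u \<subseteq> cells_of_deg K U i" "Poly_Mapping.keys u' \<subseteq> cells_of_deg K U i"
      by (auto simp: bc_relboundaries_def bc_chains_def)
    have "x - y = bc_boundary K (c - c') + (u - u')" by (simp add: * bc_boundary_diff)
    then show ?thesis
      unfolding bc_relboundaries_def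
      by (intro CollectI exI[of _ "c - c'"] exI[of _ "u - u'"]) (simp add: bc_chains_def * diff)
  qed
  show "bc_relboundaries K A U i \<subseteq> bc_relcycles K A U i"
  proof
    fix x assume "x \<in> bc_relboundaries K A U i"
    then obtain c u where *: "x = bc_boundary K c + u"
      "Poly_Mapping.keys c \<subseteq> cells_of_deg K A (i + 1)" "Poly_Mapping.keys u \<subseteq> cells_of_deg K U i"
      by (auto simp: bc_relboundaries_def bc_chains_def)
    have c: "Poly_Mapping.keys c \<subseteq> cells_of_deg K (bc_cells K) (i + 1)" using *(2) AK by blast
    have "Poly_Mapping.keys (bc_boundary K c) \<subseteq> cells_of_deg K (bc_cells K) i"
      using bc_boundary_keys[OF K c] by simp
    then have "Poly_Mapping.keys x \<subseteq> cells_of_deg K A i"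
      unfolding *(1) using keys_add[of "bc_boundary K c" u] full' UA[of i] *(3) by blast
    moreover have "bc_boundary K x = bc_boundary K u"
      unfolding *(1) bc_boundary_add by (simp add: bc_boundary_boundary[OF K c])
    moreover have "Poly_Mapping.keys (bc_boundary K u) \<subseteq> cells_of_deg K U (i - 1)"
      using lower
    proof
      assume "cells_of_deg K U i = {}"
      with *(3) show ?thesis by simp
    next
      assume "cells_of_deg K (bc_cells K) (i - 1) \<subseteq> U"
      then have "cells_of_deg K (bc_cells K) (i - 1) \<subseteq> cells_of_deg K U (i - 1)"
        by (auto simp: cells_of_deg_def)
      moreover have "Poly_Mapping.keys u \<subseteq> cells_of_deg K (bc_cells K) i" using *(3) UA AK by blast
      ultimately show ?thesis using bc_boundary_keys[OF K, of u i] by blast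
    qed
    ultimately show "x \<in> bc_relcycles K A U i" by (simp add: bc_relcycles_def bc_chains_def)
  qed
qed

lemma cells_of_deg_empty [simp]: "cells_of_deg K {} i = {}"
  by (simp add: cells_of_deg_def)

lemma relcycles_absolute:
  "bc_relcycles K A {} i = {z. Poly_Mapping.keys z \<subseteq> cells_of_deg K A i \<and> bc_boundary K z = 0}"
  by (simp add: bc_relcycles_def bc_chains_def)

lemma relboundaries_eq:
  assumes "finite (cells_of_deg K A (i + 1))"
  shows "bc_relboundaries K A U i = {fcomb (cells_of_deg K A (i + 1)) (bc_bd K) c + u | c u.
     Poly_Mapping.keys u \<subseteq> cells_of_deg K U i}" (is "_ = ?R")
proof (intro equalityI subsetI)
  fix x assume "x \<in> bc_relboundaries K A U i"
  then obtain c u where *: "x = bc_boundary K c + u"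
    "Poly_Mapping.keys c \<subseteq> cells_of_deg K A (i + 1)" "Poly_Mapping.keys u \<subseteq> cells_of_deg K U i"
    by (auto simp: bc_relboundaries_def bc_chains_def)
  then show "x \<in> ?R"
    by (intro CollectI exI[of _ "poly_mapping.lookup c"] exI[of _ u])
      (simp add: bc_boundary_eq_fcomb[OF assms])
next
  fix x assume "x \<in> ?R"
  then obtain c u where *: "x = fcomb (cells_of_deg K A (i + 1)) (bc_bd K) c + u"
    "Poly_Mapping.keys u \<subseteq> cells_of_deg K U i" by blast
  then show "x \<in> bc_relboundaries K A U i"
    unfolding bc_relboundaries_def
    by (intro CollectI exI[of _ "fcomb (cells_of_deg K A (i + 1)) frag_of c"] exI[of _ u])
      (simp add: bc_boundary_frag_of[OF assms] bc_chains_def keys_fcomb_frag_of)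
qed

section \<open>Spanning forests as bases of the cellular matroid\<close>

definition lower_cells :: "'x based_complex \<Rightarrow> int \<Rightarrow> 'x set" where
  "lower_cells K d = {x \<in> bc_cells K. bc_deg K x \<le> d - 1}"

lemma cells_of_deg_lower_Un:
  assumes "B \<subseteq> facets K d"
  shows "cells_of_deg K (lower_cells K d \<union> B) d = B"
    and "cells_of_deg K (lower_cells K d \<union> B) (d - 1) = cells_of_deg K (bc_cells K) (d - 1)"
  using assms by (auto simp: cells_of_deg_def lower_cells_def facets_def)

lemma sum_spanning_forests:
  "(\<Sum>U\<in>spanning_forests K d. F U)
     = (\<Sum>B\<in>matroid_bases (cellular_indeps K d). F (lower_cells K d \<union> B))"
proof (rule sum.reindex_bij_witness[of _ "\<lambda>B. lower_cells K d \<union> B" "\<lambda>U. cells_of_deg K U d"])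
  fix U assume U: "U \<in> spanning_forests K d"
  then show "lower_cells K d \<union> cells_of_deg K U d = U"
    by (force simp: spanning_forests_def lower_cells_def cells_of_deg_def)
  then show "F (lower_cells K d \<union> cells_of_deg K U d) = F U" by simp
  show "cells_of_deg K U d \<in> matroid_bases (cellular_indeps K d)"
    using U by (simp add: spanning_forests_def)
next
  fix B assume B: "B \<in> matroid_bases (cellular_indeps K d)"
  then have sub: "B \<subseteq> facets K d" by (auto simp: matroid_bases_def cellular_indeps_def)
  then show eq: "cells_of_deg K (lower_cells K d \<union> B) d = B" by (rule cells_of_deg_lower_Un)
  show "lower_cells K d \<union> B \<in> spanning_forests K d"
    using B sub eq by (auto simp: spanning_forests_def lower_cells_def facets_def cells_of_deg_def)
qed

lemma trivial_homology_relcycles: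
  assumes K: "based_complex K"
    and trivial: "trivial_group (bc_homology K (bc_cells K) i)"
  shows "bc_relcycles K (bc_cells K) {} i \<subseteq> bc_relboundaries K (bc_cells K) {} i"
proof
  interpret H: frag_quotient "cells_of_deg K (bc_cells K) i" "bc_relcycles K (bc_cells K) {} i"
      "bc_relboundaries K (bc_cells K) {} i"
    by (rule frag_quotient_homology[OF K]) (auto simp: cells_of_deg_def)
  fix z assume z: "z \<in> bc_relcycles K (bc_cells K) {} i"
  have "carrier H.Quot = {\<one>\<^bsub>H.Quot\<^esub>}"
    using trivial by (simp add: trivial_group_def bc_homology_def bc_rel_homology_def bc_chains_def)
  then have "H.cl z = \<one>\<^bsub>H.Quot\<^esub>" using z unfolding H.carrier_Quot by blast
  then show "z \<in> bc_relboundaries K (bc_cells K) {} i" by (simp only: H.cl_eq_one_iff)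
qed

lemma relboundaries_top:
  assumes "cells_of_deg K A (i + 1) = {}"
  shows "bc_relboundaries K A {} i = {0}"
proof -
  have "finite (cells_of_deg K A (i + 1))" unfolding assms by simp
  from relboundaries_eq[OF this, of "{}"] show ?thesis unfolding assms by (simp add: fcomb_def)
qed

section \<open>Cut and flow lattices\<close>

text \<open>For every forest, the quotient of the saturation \<open>S\<close> by the boundaries is
  the torsion of the homology in degree \<open>d - 1\<close>. The elements of \<open>S\<close> are
  cycles, because a multiple of each is a boundary and chain groups are torsion-free.\<close>

lemma cut_lattice_bound:
  assumes K: "based_complex K" and r: "boundary_rank K d \<ge> 1"
  shows "real (connectivity K d) * real (tau K d) powr (- 1 / real (boundary_rank K d))
    \<le> hermite_constant (boundary_rank K d)"
proof -
  let ?E = "facets K d" and ?g = "bc_bd K" and ?F = "cells_of_deg K (bc_cells K) (d - 1)"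
  let ?BB = "matroid_bases (frag_indeps ?E ?g)"
  have finE: "finite ?E" unfolding facets_def by (rule finite_cells_of_deg[OF K order_refl])
  have finF: "finite ?F" by (rule finite_cells_of_deg[OF K order_refl])
  have g_keys: "Poly_Mapping.keys (?g e) \<subseteq> ?F" and g_bd: "bc_boundary K (?g e) = 0" if "e \<in> ?E" for e
    using that bd_keys[OF K] bd_bd[OF K] unfolding facets_def by blast+
  define S where "S = {z. Poly_Mapping.keys z \<subseteq> ?F \<and>
    (\<exists>n c. n \<noteq> 0 \<and> frag_cmul n z = fcomb ?E ?g c)}"
  have S_zero: "0 \<in> S"
    unfolding S_def by (intro CollectI conjI exI[of _ 1] exI[of _ "\<lambda>_. 0"]) simp_all
  have S_diff: "x - y \<in> S" if xy: "x \<in> S" "y \<in> S" for x y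
  proof -
    from xy obtain n1 c1 n2 c2 where *: "n1 \<noteq> 0" "frag_cmul n1 x = fcomb ?E ?g c1"
      "n2 \<noteq> 0" "frag_cmul n2 y = fcomb ?E ?g c2" unfolding S_def by blast
    have "frag_cmul (n1 * n2) (x - y) = frag_cmul n2 (frag_cmul n1 x) - frag_cmul n1 (frag_cmul n2 y)"
      by (rule poly_mapping_eqI) (simp add: lookup_minus algebra_simps)
    also have "\<dots> = fcomb ?E ?g (\<lambda>i. n2 * c1 i - n1 * c2 i)"
      unfolding fcomb_diff fcomb_cmul *(2,4) ..
    finally have "frag_cmul (n1 * n2) (x - y) = fcomb ?E ?g (\<lambda>i. n2 * c1 i - n1 * c2 i)" .
    moreover have "Poly_Mapping.keys (x - y) \<subseteq> ?F"
      using xy keys_diff[of x y] unfolding S_def by blast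
    ultimately show ?thesis
      unfolding S_def using *(1,3)
      by (intro CollectI conjI exI[of _ "n1 * n2"] exI[of _ "\<lambda>i. n2 * c1 i - n1 * c2 i"]) simp_all
  qed
  have "\<exists>(m::nat) p. p ` {..<m} \<subseteq> S \<and> zindep {..<m} p \<and> (\<forall>h\<in>S. \<exists>v. h = fcomb {..<m} p v)"
    by (rule subgroup_basis[OF finF _ S_zero S_diff]) (auto simp: S_def)
  then obtain m :: nat and p where p: "p ` {..<m} \<subseteq> S" "zindep {..<m} p"
    "\<forall>h\<in>S. \<exists>v. h = fcomb {..<m} p v" by blast
  have g_S: "?g e \<in> S" if "e \<in> ?E" for e
  proof -
    have "frag_cmul 1 (?g e) = fcomb ?E ?g (\<lambda>j. if j = e then 1 else 0)"
      by (rule fcomb_single[OF finE that, symmetric])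
    then show ?thesis
      unfolding S_def using g_keys[OF that]
      by (intro CollectI conjI exI[of _ 1] exI[of _ "\<lambda>j. if j = e then 1 else 0"]) simp_all
  qed
  then have "\<forall>e\<in>?E. \<exists>v. ?g e = fcomb {..<m} p v" using p(3) by blast
  from bchoice[OF this] obtain N where N: "\<forall>e\<in>?E. ?g e = fcomb {..<m} p (N e)" ..
  interpret column_coordinates ?E ?g m p N
  proof
    show "\<exists>n c. n \<noteq> 0 \<and> frag_cmul n (p j) = fcomb ?E ?g c" if "j < m" for j
    proof -
      have "p j \<in> S" using p(1) that by auto
      then show ?thesis by (simp add: S_def)
    qed
  qed (use finE p(2) N in auto)
  have S_range: "S = range (fcomb {..<m} p)"
  proof
    show "S \<subseteq> range (fcomb {..<m} p)" using p(3) by blast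
    show "range (fcomb {..<m} p) \<subseteq> S"
      using fcomb_closed[OF S_zero S_diff finite_lessThan] p(1) by (auto simp: image_subset_iff)
  qed
  have rank: "boundary_rank K d = m"
    unfolding boundary_rank_def cellular_indeps_eq[OF K] by (rule rank_eq)
  define t where "t = (\<lambda>B. torsion_order K (lower_cells K d \<union> B) (d - 1))"
  have "real (connectivity K d) * real (\<Sum>B\<in>?BB. (t B)\<^sup>2) powr (- 1 / real m) \<le> hermite_constant m"
  proof (rule hermite_lower_bound[OF finE])
    show "1 \<le> m" using r rank by simp
    show "finite ?BB"
      by (rule finite_subset[of _ "Pow ?E"]) (use finE in \<open>auto simp: matroid_bases_def frag_indeps_def\<close>)
    show "\<exists>e\<in>?E. (\<Sum>j<m. N e j * v j) \<noteq> 0" if "i < m" "v i \<noteq> 0" for v i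
      using that by (rule coords_injective)
    show "connectivity K d \<le> card {e \<in> ?E. (\<Sum>j<m. N e j * v j) \<noteq> 0}" if "i < m" "v i \<noteq> 0" for v i
      unfolding connectivity_def cocircuits_def cellular_indeps_eq[OF K]
      by (rule circuit_card_le[OF finE _ row_support_codependent[of i v]]) (use that in auto)
    fix f assume f: "f \<in> {..<m} \<rightarrow>\<^sub>E ?E" "fdet m (\<lambda>i. N (f i)) \<noteq> 0" "inj_on f {..<m}"
    let ?B = "f ` {..<m}"
    have basis: "?B \<in> ?BB" by (rule minor_basis[OF f(1,3,2)])
    have BE: "?B \<subseteq> ?E" using f(1) by auto
    let ?U = "lower_cells K d \<union> ?B"
    have U: "?U \<subseteq> bc_cells K" using BE by (auto simp: lower_cells_def facets_def cells_of_deg_def)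
    let ?Bd = "bc_relboundaries K ?U {} (d - 1)"
    have Bd: "?Bd = range (fcomb ?B ?g)"
      using relboundaries_eq[where K = K and A = ?U and U = "{}" and i = "d - 1", OF finite_cells_of_deg[OF K U]]
      by (auto simp: cells_of_deg_lower_Un[OF BE])
    interpret H: frag_quotient "cells_of_deg K ?U (d - 1)" "bc_relcycles K ?U {} (d - 1)" ?Bd
      by (rule frag_quotient_homology[OF K U]) (auto simp: cells_of_deg_def lower_cells_def)
    have torsion: "{z \<in> bc_relcycles K ?U {} (d - 1). \<exists>n. n \<noteq> 0 \<and> frag_cmul n z \<in> ?Bd} = S"
    proof (intro equalityI subsetI)
      fix z assume "z \<in> {z \<in> bc_relcycles K ?U {} (d - 1). \<exists>n. n \<noteq> 0 \<and> frag_cmul n z \<in> ?Bd}"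
      then obtain n c where z: "Poly_Mapping.keys z \<subseteq> ?F" "n \<noteq> 0" "frag_cmul n z = fcomb ?B ?g c"
        unfolding Bd relcycles_absolute cells_of_deg_lower_Un(2)[OF BE] by blast
      have "frag_cmul n z = fcomb ?E ?g (\<lambda>i. if i \<in> ?B then c i else 0)"
        unfolding z(3) by (rule fcomb_restrict[OF finE BE, symmetric])
      with z(1,2) show "z \<in> S"
        unfolding S_def
        by (intro CollectI conjI exI[of _ n] exI[of _ "\<lambda>i. if i \<in> ?B then c i else 0"])
    next
      fix z assume "z \<in> S"
      then obtain n c where z: "Poly_Mapping.keys z \<subseteq> ?F" "n \<noteq> 0" "frag_cmul n z = fcomb ?E ?g c"
        unfolding S_def by blast
      \<comment> \<open>The combination at hand uses all facets; rewriting it in the facets of the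
        forest costs a further multiplier, which torsion absorbs.\<close>
      from matroid_basis_spans_fcomb[OF finE basis order_refl, of c]
      obtain n' c' where c': "n' \<noteq> 0" "frag_cmul n' (fcomb ?E ?g c) = fcomb ?B ?g c'" by blast
      have "frag_cmul (n' * n) z = fcomb ?B ?g c'"
        unfolding c'(2)[symmetric] z(3)[symmetric] by simp
      moreover have "frag_cmul n (bc_boundary K z) = 0"
        unfolding bc_boundary_cmul[symmetric] z(3) by (rule bc_boundary_fcomb_eq_0[OF finE g_bd])
      ultimately show "z \<in> {z \<in> bc_relcycles K ?U {} (d - 1). \<exists>n. n \<noteq> 0 \<and> frag_cmul n z \<in> ?Bd}"
        unfolding Bd relcycles_absolute cells_of_deg_lower_Un(2)[OF BE]
        using z(1,2) c'(1) by (intro CollectI conjI exI[of _ "n' * n"]) auto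
    qed
    have t: "t ?B = card (range (\<lambda>v. H.cl (fcomb {..<m} p v)))"
      unfolding t_def torsion_order_def bc_homology_def bc_rel_homology_def bc_chains_def
        H.torsion_part_Quot torsion S_range by (simp add: image_image)
    have "H.cl (fcomb {..<m} p x) = H.cl (fcomb {..<m} p y)
        \<longleftrightarrow> (\<exists>c. fcomb {..<m} p x - fcomb {..<m} p y = fcomb ?B ?g c)" for x y
      by (rule trans[OF H.cl_eq_iff]) (auto simp: Bd)
    from abs_minor_le_index[OF f(1,3,2), of "\<lambda>v. H.cl (fcomb {..<m} p v)", OF this] basis
    show "?B \<in> ?BB \<and> \<bar>fdet m (\<lambda>i. N (f i))\<bar> \<le> int (t ?B)" unfolding t by simp
  qed
  then show ?thesis
    unfolding rank tau_def sum_spanning_forests cellular_indeps_eq[OF K] t_def .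
qed

text \<open>Vanishing homology makes the boundaries of the top cells independent (degree
  \<open>d + 1\<close>) and makes them generate all \<open>d\<close>-cycles (degree
  \<open>d\<close>), so their number is \<open>b\<close>. A minor on the facets outside a forest
  presents the relative homology, in which the facets of the forest are zero.\<close>

lemma flow_lattice_bound:
  assumes K: "based_complex K" and dim: "\<And>x. x \<in> bc_cells K \<Longrightarrow> bc_deg K x \<le> d"
    and \<Omega>: "acyclization K d \<Omega>"
    and b: "b = abelian_rank (bc_homology K (bc_cells K) d)" "b \<ge> 1"
  shows "real (girth K d) * real (tau_star K d \<Omega>) powr (- 1 / real b) \<le> hermite_constant b"
proof -
  let ?E = "facets K d" and ?g = "bc_bd K"
  let ?BB = "matroid_bases (frag_indeps ?E ?g)"
  have \<Omega>K: "based_complex \<Omega>" using \<Omega> by (simp add: acyclization_def)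
  let ?C = "bc_cells \<Omega>"
  have K_sub: "bc_cells K \<subseteq> ?C" and deg: "\<And>x. x \<in> bc_cells K \<Longrightarrow> bc_deg \<Omega> x = bc_deg K x"
    and bd: "\<And>x. x \<in> bc_cells K \<Longrightarrow> bc_bd \<Omega> x = bc_bd K x"
    and low: "\<And>x. x \<in> ?C \<Longrightarrow> bc_deg \<Omega> x \<le> d \<Longrightarrow> x \<in> bc_cells K"
    and top: "\<And>x. x \<in> ?C \<Longrightarrow> bc_deg \<Omega> x \<le> d + 1"
    using \<Omega> unfolding acyclization_def by blast+
  have E_sub: "?E \<subseteq> bc_cells K" by (auto simp: facets_def cells_of_deg_def)
  have cells_d: "cells_of_deg \<Omega> ?C d = ?E"
  proof (intro equalityI subsetI)
    fix x assume "x \<in> cells_of_deg \<Omega> ?C d"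
    then have x: "x \<in> ?C" "bc_deg \<Omega> x = d" by (simp_all add: cells_of_deg_def)
    then have "x \<in> bc_cells K" using low[of x] by simp
    with x deg[of x] show "x \<in> ?E" by (simp add: facets_def cells_of_deg_def)
  next
    fix x assume "x \<in> ?E"
    then have "x \<in> bc_cells K" "bc_deg K x = d" by (simp_all add: facets_def cells_of_deg_def)
    then show "x \<in> cells_of_deg \<Omega> ?C d" using K_sub deg[of x] by (auto simp: cells_of_deg_def)
  qed
  have finE: "finite ?E" unfolding facets_def by (rule finite_cells_of_deg[OF K order_refl])
  let ?D = "cells_of_deg \<Omega> ?C (d + 1)"
  define m where "m = card ?D"
  have finD: "finite ?D" by (rule finite_cells_of_deg[OF \<Omega>K order_refl])
  from ex_bij_betw_nat_finite[OF finD] obtain h where h: "bij_betw h {..<m} ?D"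
    unfolding lessThan_atLeast0 m_def ..
  have hD: "h j \<in> ?D" if "j < m" for j using bij_betw_apply[OF h] that by simp
  define q where "q = (\<lambda>j. bc_bd \<Omega> (h j))"
  define N where "N = (\<lambda>e j. poly_mapping.lookup (q j) e)"
  have q_keys: "Poly_Mapping.keys (q j) \<subseteq> ?E" if "j < m" for j
    using bd_keys[OF \<Omega>K hD[OF that]] cells_d by (simp add: q_def)
  have q_bd: "bc_boundary \<Omega> (q j) = 0" if "j < m" for j
    using bd_bd[OF \<Omega>K hD[OF that]] by (simp add: q_def)
  have NN: "(\<Sum>j<m. N e j * v j) = poly_mapping.lookup (fcomb {..<m} q v) e" for e v
    by (simp add: N_def lookup_fcomb mult.commute)
  have fq_keys: "Poly_Mapping.keys (fcomb {..<m} q v) \<subseteq> ?E" for v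
    by (rule keys_fcomb) (use q_keys in auto)
  have D_fcomb: "fcomb ?D (bc_bd \<Omega>) c = fcomb {..<m} q (\<lambda>j. c (h j))" for c
    using fcomb_image[OF bij_betw_imp_inj_on[OF h], of "bc_bd \<Omega>" c]
    by (simp add: bij_betw_imp_surj_on[OF h] q_def)
  have top_empty: "cells_of_deg \<Omega> ?C (d + 1 + 1) = {}"
  proof (intro equals0I)
    fix x assume "x \<in> cells_of_deg \<Omega> ?C (d + 1 + 1)"
    then show False using top[of x] by (simp add: cells_of_deg_def)
  qed
  \<comment> \<open>There are no cells of degree \<open>d + 2\<close>, so the trivial homology group
    is the cycle group: a relation among the \<open>q j\<close> is a cycle and hence zero.\<close>
  have q_indep: "zindep {..<m} q"
    unfolding zindep_def
  proof (intro allI impI ballI)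
    fix c i assume c: "fcomb {..<m} q c = 0" and i: "i \<in> {..<m}"
    define c' where "c' = (\<lambda>e. c (the_inv_into {..<m} h e))"
    have c': "c' (h j) = c j" if "j < m" for j
      using that bij_betw_imp_inj_on[OF h] by (simp add: c'_def the_inv_into_f_f)
    have "bc_boundary \<Omega> (fcomb ?D frag_of c') = fcomb {..<m} q (\<lambda>j. c' (h j))"
      unfolding bc_boundary_frag_of[OF finD] by (rule D_fcomb)
    also have "\<dots> = fcomb {..<m} q c" by (rule fcomb_cong) (auto simp: c')
    finally have "fcomb ?D frag_of c' \<in> bc_relcycles \<Omega> ?C {} (d + 1)"
      unfolding relcycles_absolute c by (simp add: keys_fcomb_frag_of)
    then have "fcomb ?D frag_of c' \<in> bc_relboundaries \<Omega> ?C {} (d + 1)"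
      using trivial_homology_relcycles[OF \<Omega>K, of "d + 1"] \<Omega> by (auto simp: acyclization_def)
    moreover have "bc_relboundaries \<Omega> ?C {} (d + 1) = {0}"
      by (rule relboundaries_top[OF top_empty])
    ultimately have "fcomb ?D frag_of c' = 0" by simp
    then have "poly_mapping.lookup (fcomb ?D frag_of c') (h i) = 0" by simp
    then show "c i = 0" using hD[of i] i c'[of i] by (simp add: lookup_fcomb_frag_of[OF finD])
  qed
  have K_fcomb: "fcomb ?E ?g c = fcomb ?E (bc_bd \<Omega>) c" for c
    by (rule fcomb_cong) (use bd E_sub in auto)
  have lookup_E: "fcomb ?E (bc_bd \<Omega>) (poly_mapping.lookup z) = bc_boundary \<Omega> z"
    if "Poly_Mapping.keys z \<subseteq> ?E" for z
    by (rule bc_boundary_eq_fcomb[OF finE that, symmetric])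
  interpret cycle_coordinates ?E ?g m N
  proof
    show "\<exists>e\<in>?E. (\<Sum>j<m. N e j * v j) \<noteq> 0" if "i < m" "v i \<noteq> 0" for i v
    proof -
      have "fcomb {..<m} q v \<noteq> 0" using zindepD[OF q_indep, of v i] that by auto
      then obtain e where "e \<in> Poly_Mapping.keys (fcomb {..<m} q v)" by (metis keys_eq_empty equals0I)
      moreover from this have "e \<in> ?E" using fq_keys by blast
      ultimately show ?thesis unfolding NN in_keys_iff by (intro bexI[of _ e])
    qed
    fix c
    show "fcomb ?E ?g c = 0 \<longleftrightarrow> (\<exists>v. \<forall>e\<in>?E. c e = (\<Sum>j<m. N e j * v j))"
    proof
      assume "fcomb ?E ?g c = 0"
      then have "fcomb ?E frag_of c \<in> bc_relcycles \<Omega> ?C {} d"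
        unfolding relcycles_absolute cells_d K_fcomb
        by (simp add: keys_fcomb_frag_of bc_boundary_frag_of[OF finE])
      then have "fcomb ?E frag_of c \<in> bc_relboundaries \<Omega> ?C {} d"
        using trivial_homology_relcycles[OF \<Omega>K, of d] \<Omega> by (auto simp: acyclization_def)
      then obtain c' where "fcomb ?E frag_of c = fcomb ?D (bc_bd \<Omega>) c'"
        unfolding relboundaries_eq[OF finD] by auto
      then have eq: "fcomb ?E frag_of c = fcomb {..<m} q (\<lambda>j. c' (h j))" by (simp only: D_fcomb)
      show "\<exists>v. \<forall>e\<in>?E. c e = (\<Sum>j<m. N e j * v j)"
      proof (intro exI[of _ "\<lambda>j. c' (h j)"] ballI)
        fix e assume "e \<in> ?E"
        then show "c e = (\<Sum>j<m. N e j * c' (h j))"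
          unfolding NN eq[symmetric] lookup_fcomb_frag_of[OF finE] by simp
      qed
    next
      assume "\<exists>v. \<forall>e\<in>?E. c e = (\<Sum>j<m. N e j * v j)"
      then obtain v where v: "\<forall>e\<in>?E. c e = (\<Sum>j<m. N e j * v j)" ..
      have "fcomb ?E ?g c = fcomb ?E (bc_bd \<Omega>) (poly_mapping.lookup (fcomb {..<m} q v))"
        unfolding K_fcomb by (rule fcomb_cong) (use v in \<open>auto simp: NN\<close>)
      also have "\<dots> = bc_boundary \<Omega> (fcomb {..<m} q v)" by (rule lookup_E[OF fq_keys])
      also have "\<dots> = 0" by (rule bc_boundary_fcomb_eq_0) (use q_bd in auto)
      finally show "fcomb ?E ?g c = 0" .
    qed
  qed (rule finE)
  \<comment> \<open>\<open>K\<close> has no cells above degree \<open>d\<close>, so its homology in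
    this degree is the cycle group, with basis \<open>q\<close>.\<close>
  have rank: "b = m"
  proof -
    interpret H: frag_quotient ?E "bc_relcycles K (bc_cells K) {} d" "bc_relboundaries K (bc_cells K) {} d"
      unfolding facets_def
      by (rule frag_quotient_homology[OF K]) (auto simp: cells_of_deg_def)
    have "cells_of_deg K (bc_cells K) (d + 1) = {}"
    proof (intro equals0I)
      fix x assume "x \<in> cells_of_deg K (bc_cells K) (d + 1)"
      then show False using dim[of x] by (simp add: cells_of_deg_def)
    qed
    then have Bd: "bc_relboundaries K (bc_cells K) {} d = {0}" by (rule relboundaries_top)
    have Z: "bc_relcycles K (bc_cells K) {} d = {z. Poly_Mapping.keys z \<subseteq> ?E \<and> bc_boundary \<Omega> z = 0}"
    proof -
      have "bc_boundary K z = bc_boundary \<Omega> z" if "Poly_Mapping.keys z \<subseteq> ?E" for z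
        unfolding lookup_E[OF that, symmetric] K_fcomb[symmetric] by (rule bc_boundary_eq_fcomb[OF finE that])
      then show ?thesis
        unfolding relcycles_absolute facets_def[symmetric] by (intro Collect_cong conj_cong refl) simp
    qed
    have "abelian_rank H.Quot = m"
    proof (rule H.abelian_rank_eq)
      show "q j \<in> bc_relcycles K (bc_cells K) {} d" if "j < m" for j
        unfolding Z using q_keys q_bd that by simp
      show "v j = 0" if "fcomb {..<m} q v \<in> bc_relboundaries K (bc_cells K) {} d" "j < m" for v j
        using zindepD[OF q_indep, of v j] that by (simp add: Bd)
      fix z assume "z \<in> bc_relcycles K (bc_cells K) {} d"
      then have z: "Poly_Mapping.keys z \<subseteq> ?E" "bc_boundary \<Omega> z = 0" by (auto simp: Z)
      have "fcomb ?E ?g (poly_mapping.lookup z) = 0" unfolding K_fcomb lookup_E[OF z(1)] by (rule z(2))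
      then obtain v where v: "\<forall>e\<in>?E. poly_mapping.lookup z e = (\<Sum>j<m. N e j * v j)"
        unfolding cycles ..
      have "z = fcomb {..<m} q v"
      proof (rule poly_mapping_eqI)
        fix e
        show "poly_mapping.lookup z e = poly_mapping.lookup (fcomb {..<m} q v) e"
        proof (cases "e \<in> ?E")
          case True
          then show ?thesis using v by (simp add: NN)
        next
          case False
          then have "e \<notin> Poly_Mapping.keys z" "e \<notin> Poly_Mapping.keys (fcomb {..<m} q v)"
            using z(1) fq_keys[of v] by blast+
          then show ?thesis by (simp add: in_keys_iff)
        qed
      qed
      then show "\<exists>v. z - fcomb {..<m} q v \<in> bc_relboundaries K (bc_cells K) {} d"
        by (intro exI[of _ v]) (simp add: Bd)
    qed
    then show ?thesis
      unfolding b(1) bc_homology_def bc_rel_homology_def bc_chains_def facets_def .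
  qed
  define t where "t = (\<lambda>B. card (carrier (bc_rel_homology \<Omega> ?C (lower_cells K d \<union> B) d)))"
  have compl: "?E - (?E - T) = T" if "T \<subseteq> ?E" for T using that by blast
  have BB_sub: "B \<subseteq> ?E" if "B \<in> ?BB" for B using that by (auto simp: matroid_bases_def frag_indeps_def)
  \<comment> \<open>The minors select the facets left out of a forest, so the sum runs over
    complements; complementation is undone at the end.\<close>
  have "real (girth K d) * real (\<Sum>T\<in>(\<lambda>B. ?E - B) ` ?BB. (t (?E - T))\<^sup>2) powr (- 1 / real m)
      \<le> hermite_constant m"
  proof (rule hermite_lower_bound[OF finE])
    show "1 \<le> m" using b(2) rank by simp
    have "finite ?BB" by (rule finite_subset[of _ "Pow ?E"]) (use finE BB_sub in auto)
    then show "finite ((\<lambda>B. ?E - B) ` ?BB)" by simp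
    show "\<exists>e\<in>?E. (\<Sum>j<m. N e j * v j) \<noteq> 0" if "i < m" "v i \<noteq> 0" for v i
      using that by (rule injective)
    show "girth K d \<le> card {e \<in> ?E. (\<Sum>j<m. N e j * v j) \<noteq> 0}" if "i < m" "v i \<noteq> 0" for v i
      unfolding girth_def cellular_indeps_eq[OF K]
      by (rule circuit_card_le[OF finE _ cycle_support_dependent[of i v]]) (use that in auto)
    fix f assume f: "f \<in> {..<m} \<rightarrow>\<^sub>E ?E" "fdet m (\<lambda>i. N (f i)) \<noteq> 0" "inj_on f {..<m}"
    let ?T = "f ` {..<m}"
    let ?B = "?E - ?T"
    have fE: "f i \<in> ?E" if "i < m" for i using f(1) that by auto
    have TE: "?T \<subseteq> ?E" using fE by auto
    have basis: "?B \<in> ?BB" by (rule complement_minor_basis[OF f(1,2)])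
    have mem: "?T \<in> (\<lambda>B. ?E - B) ` ?BB"
      by (rule image_eqI[of _ _ ?B]) (use basis compl[OF TE] in auto)
    let ?U = "lower_cells K d \<union> ?B"
    have U: "?U \<subseteq> ?C" using E_sub K_sub by (auto simp: lower_cells_def)
    have U_d: "cells_of_deg \<Omega> ?U d = ?B"
    proof (intro equalityI subsetI)
      fix x assume x: "x \<in> cells_of_deg \<Omega> ?U d"
      show "x \<in> ?B"
      proof (rule ccontr)
        assume "x \<notin> ?B"
        with x have "x \<in> lower_cells K d" "bc_deg \<Omega> x = d" unfolding cells_of_deg_def by blast+
        then have "x \<in> bc_cells K" "bc_deg K x \<le> d - 1" "bc_deg \<Omega> x = d"
          by (simp_all add: lower_cells_def)
        with deg[of x] show False by simp
      qed
    next
      fix x assume x: "x \<in> ?B"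
      then have "x \<in> bc_cells K" "bc_deg K x = d" by (simp_all add: facets_def cells_of_deg_def)
      with x deg[of x] show "x \<in> cells_of_deg \<Omega> ?U d" by (simp add: cells_of_deg_def)
    qed
    have U_low: "cells_of_deg \<Omega> ?C (d - 1) \<subseteq> ?U"
    proof
      fix x assume x: "x \<in> cells_of_deg \<Omega> ?C (d - 1)"
      then have "x \<in> bc_cells K" using low[of x] by (simp add: cells_of_deg_def)
      with x deg[of x] show "x \<in> ?U" by (simp add: cells_of_deg_def lower_cells_def)
    qed
    let ?Z = "bc_relcycles \<Omega> ?C ?U d" and ?Bd = "bc_relboundaries \<Omega> ?C ?U d"
    interpret H: frag_quotient "cells_of_deg \<Omega> ?C d" ?Z ?Bd
      by (rule frag_quotient_homology[OF \<Omega>K order_refl U]) (use U_low in \<open>auto simp: cells_of_deg_def\<close>)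
    \<comment> \<open>The forest contains all \<open>(d - 1)\<close>-cells, so every
      \<open>d\<close>-chain is a relative cycle.\<close>
    have Z: "z \<in> ?Z" if "Poly_Mapping.keys z \<subseteq> ?E" for z
    proof -
      have "Poly_Mapping.keys (bc_boundary \<Omega> z) \<subseteq> cells_of_deg \<Omega> ?C (d - 1)"
        by (rule bc_boundary_keys[OF \<Omega>K]) (simp add: cells_d that)
      also have "\<dots> \<subseteq> cells_of_deg \<Omega> ?U (d - 1)" using U_low by (auto simp: cells_of_deg_def)
      finally show ?thesis using that by (simp add: bc_relcycles_def bc_chains_def cells_d)
    qed
    have Bd: "x \<in> ?Bd \<longleftrightarrow> (\<exists>v u. x = fcomb {..<m} q v + u \<and> Poly_Mapping.keys u \<subseteq> ?B)" for x
    proof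
      assume "x \<in> ?Bd"
      then obtain c u where "x = fcomb ?D (bc_bd \<Omega>) c + u" "Poly_Mapping.keys u \<subseteq> ?B"
        unfolding relboundaries_eq[OF finD] U_d by blast
      then show "\<exists>v u. x = fcomb {..<m} q v + u \<and> Poly_Mapping.keys u \<subseteq> ?B"
        unfolding D_fcomb by (intro exI[of _ "\<lambda>j. c (h j)"] exI[of _ u] conjI)
    next
      assume "\<exists>v u. x = fcomb {..<m} q v + u \<and> Poly_Mapping.keys u \<subseteq> ?B"
      then obtain v u where x: "x = fcomb {..<m} q v + u" "Poly_Mapping.keys u \<subseteq> ?B" by blast
      define c where "c = (\<lambda>e. v (the_inv_into {..<m} h e))"
      have "fcomb {..<m} q v = fcomb {..<m} q (\<lambda>j. c (h j))"
        by (rule fcomb_cong)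
          (use bij_betw_imp_inj_on[OF h] in \<open>auto simp: c_def the_inv_into_f_f\<close>)
      then show "x \<in> ?Bd"
        unfolding relboundaries_eq[OF finD] U_d x(1) using x(2)
        by (intro CollectI exI[of _ c] exI[of _ u] conjI) (simp_all add: D_fcomb)
    qed
    \<comment> \<open>Modulo the facets of the forest a chain is determined by its coefficients on
      the omitted facets \<open>f i\<close>, so these parametrize the relative classes.\<close>
    let ?\<phi> = "\<lambda>x. H.cl (fcomb {..<m} (\<lambda>i. frag_of (f i)) x)"
    have lookup_f: "poly_mapping.lookup (fcomb {..<m} (\<lambda>i. frag_of (f i)) x) (f i) = x i" if "i < m" for x i
    proof -
      have "poly_mapping.lookup (fcomb {..<m} (\<lambda>i. frag_of (f i)) x) (f i) = (\<Sum>j<m. if j = i then x j else 0)"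
        unfolding lookup_fcomb using f(3) that by (intro sum.cong refl) (auto simp: inj_on_def)
      then show ?thesis using that by simp
    qed
    have f_keys: "Poly_Mapping.keys (fcomb {..<m} (\<lambda>i. frag_of (f i)) x) \<subseteq> ?E" for x
      by (rule keys_fcomb) (use fE in auto)
    have in_B: "Poly_Mapping.keys u \<subseteq> ?B \<longleftrightarrow> Poly_Mapping.keys u \<subseteq> ?E \<and> (\<forall>i<m. poly_mapping.lookup u (f i) = 0)" for u
      by (auto simp: in_keys_iff)
    have \<phi>: "?\<phi> x = ?\<phi> y \<longleftrightarrow> (\<exists>z. \<forall>i<m. x i - y i = (\<Sum>j<m. N (f i) j * z j))" for x y
      unfolding H.cl_eq_iff fcomb_diff[symmetric] Bd
    proof
      assume "\<exists>v u. fcomb {..<m} (\<lambda>i. frag_of (f i)) (\<lambda>i. x i - y i) = fcomb {..<m} q v + u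
        \<and> Poly_Mapping.keys u \<subseteq> ?B"
      then obtain v u where eq: "fcomb {..<m} (\<lambda>i. frag_of (f i)) (\<lambda>i. x i - y i) = fcomb {..<m} q v + u"
        and u: "Poly_Mapping.keys u \<subseteq> ?B" by blast
      have "x i - y i = (\<Sum>j<m. N (f i) j * v j)" if "i < m" for i
        using arg_cong[OF eq, of "\<lambda>z. poly_mapping.lookup z (f i)"] u[unfolded in_B] that
        unfolding NN lookup_add by (simp add: lookup_f)
      then show "\<exists>z. \<forall>i<m. x i - y i = (\<Sum>j<m. N (f i) j * z j)" by (intro exI[of _ v]) simp
    next
      assume "\<exists>z. \<forall>i<m. x i - y i = (\<Sum>j<m. N (f i) j * z j)"
      then obtain v where v: "\<forall>i<m. x i - y i = (\<Sum>j<m. N (f i) j * v j)" ..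
      let ?u = "fcomb {..<m} (\<lambda>i. frag_of (f i)) (\<lambda>i. x i - y i) - fcomb {..<m} q v"
      have "Poly_Mapping.keys ?u \<subseteq> ?E"
        using keys_diff[of "fcomb {..<m} (\<lambda>i. frag_of (f i)) (\<lambda>i. x i - y i)" "fcomb {..<m} q v"]
          f_keys[of "\<lambda>i. x i - y i"] fq_keys[of v] by blast
      moreover have "\<forall>i<m. poly_mapping.lookup ?u (f i) = 0"
        using v unfolding NN lookup_minus by (simp add: lookup_f)
      ultimately have "Poly_Mapping.keys ?u \<subseteq> ?B" unfolding in_B by (intro conjI)
      then show "\<exists>v u. fcomb {..<m} (\<lambda>i. frag_of (f i)) (\<lambda>i. x i - y i) = fcomb {..<m} q v + u
        \<and> Poly_Mapping.keys u \<subseteq> ?B"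
        by (intro exI[of _ v] exI[of _ ?u]) simp
    qed
    have "carrier H.Quot = range ?\<phi>"
      unfolding H.carrier_Quot
    proof (intro equalityI subsetI)
      fix y assume "y \<in> H.cl ` ?Z"
      then obtain z where z: "z \<in> ?Z" "y = H.cl z" by blast
      let ?x = "\<lambda>i. poly_mapping.lookup z (f i)"
      let ?u = "z - fcomb {..<m} (\<lambda>i. frag_of (f i)) ?x"
      have "Poly_Mapping.keys ?u \<subseteq> ?E"
        using keys_diff[of z "fcomb {..<m} (\<lambda>i. frag_of (f i)) ?x"] f_keys[of ?x] H.Z_keys[OF z(1), unfolded cells_d] by blast
      moreover have "\<forall>i<m. poly_mapping.lookup ?u (f i) = 0" by (simp add: lookup_minus lookup_f)
      ultimately have "Poly_Mapping.keys ?u \<subseteq> ?B" unfolding in_B by (intro conjI)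
      then have "?u \<in> ?Bd" unfolding Bd by (intro exI[of _ "\<lambda>_. 0"] exI[of _ ?u]) simp
      then have "H.cl z = ?\<phi> ?x" by (simp only: H.cl_eq_iff)
      then show "y \<in> range ?\<phi>" unfolding z(2) by (intro image_eqI[of _ ?\<phi> ?x] UNIV_I)
    next
      fix y assume "y \<in> range ?\<phi>"
      then obtain x where "y = ?\<phi> x" by (rule rangeE)
      then show "y \<in> H.cl ` ?Z" by (rule image_eqI) (rule Z[OF f_keys])
    qed
    then have "t ?B = card (range ?\<phi>)"
      by (simp add: t_def bc_rel_homology_def bc_chains_def)
    then show "?T \<in> (\<lambda>B. ?E - B) ` ?BB \<and> \<bar>fdet m (\<lambda>i. N (f i))\<bar> \<le> int (t (?E - ?T))"
      using mem abs_fdet_le_card_quotient(2)[OF f(2), of ?\<phi>, OF \<phi>] by simp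
  qed
  also have "(\<Sum>T\<in>(\<lambda>B. ?E - B) ` ?BB. (t (?E - T))\<^sup>2) = tau_star K d \<Omega>"
  proof -
    have "inj_on (\<lambda>B. ?E - B) ?BB"
      by (rule inj_on_inverseI[of _ "\<lambda>T. ?E - T"]) (rule compl[OF BB_sub])
    then have "(\<Sum>T\<in>(\<lambda>B. ?E - B) ` ?BB. (t (?E - T))\<^sup>2) = (\<Sum>B\<in>?BB. (t B)\<^sup>2)"
      unfolding sum.reindex[OF \<open>inj_on (\<lambda>B. ?E - B) ?BB\<close>]
      by (intro sum.cong refl) (simp add: compl[OF BB_sub])
    then show ?thesis
      unfolding tau_star_def sum_spanning_forests cellular_indeps_eq[OF K] t_def .
  qed
  finally show ?thesis unfolding rank .
qed

theorem theorem9p2: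
  fixes S :: "('a, 'c) cw"
    and K :: "'c option based_complex"
    and d g k r b :: nat
  assumes "finite_cw_complex S"
    and "cw_has_dimension S d"
    and "cellular_chain_complex S K"
    and "g = girth K (int d)"
    and "k = connectivity K (int d)"
    and "r = boundary_rank K (int d)"
    and "b = abelian_rank (bc_homology K (bc_cells K) (int d))"
  shows "(r \<ge> 1 \<longrightarrow>
            real k * real (tau K (int d)) powr (- 1 / real r) \<le> hermite_constant r) \<and>
         (b \<ge> 1 \<longrightarrow>
            (\<forall>\<Omega>. acyclization K (int d) \<Omega> \<longrightarrow>
               real g * real (tau_star K (int d) \<Omega>) powr (- 1 / real b) \<le> hermite_constant b))"
proof -
  have K: "based_complex K" using assms(3) by (simp add: cellular_chain_complex_def)
  \<comment> \<open>The cell \<open>None\<close> of degree -1 is covered because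
    \<open>int d\<close> is nonnegative.\<close>
  have "bc_deg K x \<le> int d" if "x \<in> bc_cells K" for x
    using that assms(2,3) by (auto simp: cellular_chain_complex_def cw_has_dimension_def)
  then show ?thesis
    using cut_lattice_bound[OF K, of "int d"] flow_lattice_bound[OF K, of "int d" _ b] assms(4-7)
    by blast
qed

end
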